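(* Let $T>0$ and let $y\in\mathcal{H}^T$ satisfy $-y''+qy=0$ on $(0,x(T))$. Then the control $f=\left(W^T\frac{d}{dt}\right)^{-1}y$ (i.e. the control for which $u^f_t(\cdot,T)=y$ in the system with Neumann boundary control) is the unique solution in $\mathcal{F}^T$ of the equation $$\left(-\frac{d}{dt}\,C^T\frac{d}{dt}\right)f=-y(0)\,1^T+y'(0)\,(R^T)^*1^T,$$ where $1^T(t)=1$ for $0\leqslant t\leqslant T$.
   Context: All functions are real; smooth means $C^\infty$. Let $\rho,q\in C^\infty[0,\infty)$ with $\rho(x)>0$ and $\int_0^\infty\rho^{1/2}(x)\,dx=\infty$. Put $\tau(x)=\int_0^x\rho^{1/2}(s)\,ds$ and let $x(\cdot)$ be the inverse function of $\tau(\cdot)$. All functions of time are extended by zero to $t<0$. Neumann problem: $\rho u_{tt}-u_{xx}+qu=0$ for $x>0,\ t>0$; $u|_{t=0}=u_t|_{t=0}=0$ for $x\geqslant0$; $u_x|_{x=0}=f$ for $t\geqslant0$. Its fundamental solution $r(x,t):=u^\delta(x,t)$ (the solution for $f=\delta$, the Dirac delta-function) is smooth in $\{(x,t):0\leqslant\tau(x)\leqslant t\}$, vanishes for $t<\tau(x)$, and satisfies $r(x,\tau(x)+0)=-[\rho(0)\rho(x)]^{-1/4}$. For $f\in L_2^{\rm loc}(0,\infty)$ the solution is defined by $$u^f(x,t)=\int_0^{t-\tau(x)}r(x,t-s)f(s)\,ds,\quad x\geqslant0,\ t\geqslant0;$$ its restriction to $0\leqslant t\leqslant T$ depends only on $f|_{[0,T]}$.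 Spaces: $\mathcal{F}^T=L_2(0,T)$; $\mathcal{H}^T=L_{2,\rho}(0,x(T))$ with inner product $(u,v)=\int_0^{x(T)}u(x)v(x)\rho(x)\,dx$. Control operator: $W^T:\mathcal{F}^T\to\mathcal{H}^T$, $(W^Tf)(x)=u^f(x,T)$, $0\leqslant x\leqslant x(T)$. Connecting operator: $C^T=(W^T)^*W^T$. Response operator: $R^T:\mathcal{F}^T\to\mathcal{F}^T$, $(R^Tf)(t)=u^f(0,t)=\int_0^tr(0,t-s)f(s)\,ds$. The operator $W^T\frac{d}{dt}$, defined on $\{f\in H^1[0,T]:f(0)=0\}$ by $f\mapsto W^Tf'$, is continuous from $\mathcal{F}^T$ to $\mathcal{H}^T$, and its extension by continuity, still denoted $W^T\frac{d}{dt}$, is an isomorphism of $\mathcal{F}^T$ onto $\mathcal{H}^T$. For $f\in\mathcal{F}^T$, $u^f_t(\cdot,T)$ is understood as $W^T\frac{d}{dt}f$. The symbol $-\frac{d}{dt}C^T\frac{d}{dt}$ denotes the bounded operator $\left(W^T\frac{d}{dt}\right)^*\left(W^T\frac{d}{dt}\right)$ in $\mathcal{F}^T$, where $-\frac{d}{dt}=\left(\frac{d}{dt}\right)^*$ is the adjoint of $\frac{d}{dt}$ with domain $\{f\in H^1[0,T]:f(0)=0\}$. *)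

theory Defs
  imports "HOL-Analysis.Analysis"
begin

section \<open>Smooth functions\<close>

text \<open>Derivatives are taken within the set, so on \<open>{0..}\<close> this is smoothness up to
  the end point \<open>0\<close>.\<close>

definition smooth1 :: "real set \<Rightarrow> (real \<Rightarrow> real) \<Rightarrow> bool" where
  "smooth1 S f \<longleftrightarrow> (\<exists>D :: nat \<Rightarrow> real \<Rightarrow> real. (\<forall>x\<in>S. D 0 x = f x) \<and>
     (\<forall>n. \<forall>x\<in>S. (D n has_real_derivative D (Suc n) x) (at x within S)))"

text \<open>\<open>D i j\<close> is the partial derivative of \<open>D 0 0\<close>, of order \<open>i\<close> in the first
  variable and of order \<open>j\<close> in the second one.\<close>

definition smooth_partials ::
    "(real \<times> real) set \<Rightarrow> (nat \<Rightarrow> nat \<Rightarrow> real \<times> real \<Rightarrow> real) \<Rightarrow> bool" where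
  "smooth_partials S D \<longleftrightarrow> (\<forall>i j. \<forall>p\<in>S.
     (D i j has_derivative (\<lambda>h. fst h * D (Suc i) j p + snd h * D i (Suc j) p)) (at p within S))"

definition smooth2 :: "(real \<times> real) set \<Rightarrow> (real \<times> real \<Rightarrow> real) \<Rightarrow> bool" where
  "smooth2 S f \<longleftrightarrow> (\<exists>D. smooth_partials S D \<and> (\<forall>p\<in>S. D 0 0 p = f p))"


section \<open>Square-integrable functions\<close>

text \<open>Elements of \<open>L\<^sub>2(M)\<close> are represented by functions; equality in \<open>L\<^sub>2(M)\<close> is equality
  almost everywhere.\<close>

definition L2 :: "'a measure \<Rightarrow> ('a \<Rightarrow> real) set" where
  "L2 M = {f \<in> borel_measurable M. integrable M (\<lambda>x. (f x)\<^sup>2)}"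

definition L2_inner :: "'a measure \<Rightarrow> ('a \<Rightarrow> real) \<Rightarrow> ('a \<Rightarrow> real) \<Rightarrow> real" where
  "L2_inner M f g = (LINT x|M. f x * g x)"

definition L2_eq :: "'a measure \<Rightarrow> ('a \<Rightarrow> real) \<Rightarrow> ('a \<Rightarrow> real) \<Rightarrow> bool" where
  "L2_eq M f g \<longleftrightarrow> (AE x in M. f x = g x)"

definition L2_bounded_linear ::
    "'a measure \<Rightarrow> 'b measure \<Rightarrow> (('a \<Rightarrow> real) \<Rightarrow> 'b \<Rightarrow> real) \<Rightarrow> bool" where
  "L2_bounded_linear M N A \<longleftrightarrow>
     (\<forall>f\<in>L2 M. A f \<in> L2 N) \<and>
     (\<forall>f\<in>L2 M. \<forall>g\<in>L2 M. \<forall>a b.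
        L2_eq N (A (\<lambda>x. a * f x + b * g x)) (\<lambda>x. a * A f x + b * A g x)) \<and>
     (\<exists>K. \<forall>f\<in>L2 M. L2_inner N (A f) (A f) \<le> K * L2_inner M f f)"

definition L2_adjoint ::
    "'a measure \<Rightarrow> 'b measure \<Rightarrow> (('a \<Rightarrow> real) \<Rightarrow> 'b \<Rightarrow> real) \<Rightarrow> ('b \<Rightarrow> real) \<Rightarrow> 'a \<Rightarrow> real" where
  "L2_adjoint M N A g =
     (SOME w. w \<in> L2 M \<and> (\<forall>f\<in>L2 M. L2_inner N (A f) g = L2_inner M f w))"


section \<open>The Neumann problem\<close>

definition tau :: "(real \<Rightarrow> real) \<Rightarrow> real \<Rightarrow> real" where
  "tau \<rho> x = (LBINT s:{0..x}. sqrt (\<rho> s))"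

definition tau_inv :: "(real \<Rightarrow> real) \<Rightarrow> real \<Rightarrow> real" where
  "tau_inv \<rho> = the_inv_into {0..} (tau \<rho>)"

text \<open>The distributional form of the problem
  \<open>\<rho> u\<^sub>t\<^sub>t - u\<^sub>x\<^sub>x + q u = 0\<close>, \<open>u = 0\<close> for \<open>t < 0\<close>, \<open>u\<^sub>x = \<delta>\<close> at \<open>x = 0\<close>.
  For a test function \<open>\<phi> = D 0 0\<close> on the closed half-plane \<open>x \<ge> 0\<close>, not required to satisfy any
  boundary condition, moving all derivatives to \<open>\<phi>\<close> leaves the boundary terms
  \<open>\<integral> u\<^sub>x(0,t) \<phi>(0,t) dt = \<phi>(0,0)\<close> and \<open>- \<integral> u(0,t) \<phi>\<^sub>x(0,t) dt\<close>.\<close>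

definition delta_solution ::
    "(real \<Rightarrow> real) \<Rightarrow> (real \<Rightarrow> real) \<Rightarrow> (real \<Rightarrow> real \<Rightarrow> real) \<Rightarrow> bool" where
  "delta_solution \<rho> q r \<longleftrightarrow> (\<forall>x\<ge>0. \<forall>t<0. r x t = 0) \<and>
     (\<forall>D b. smooth_partials ({0..} \<times> UNIV) D \<longrightarrow>
        (\<forall>p \<in> {0..} \<times> UNIV. norm p > b \<longrightarrow> D 0 0 p = 0) \<longrightarrow>
        (LINT (x, t):{0..} \<times> UNIV|lborel.
            r x t * (\<rho> x * D 0 2 (x, t) - D 2 0 (x, t) + q x * D 0 0 (x, t)))
          + D 0 0 (0, 0) - (LBINT t. r 0 t * D 1 0 (0, t)) = 0)"

text \<open>The distributional solution in its piecewise smooth representative, together with its known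
  support and jump across the characteristic \<open>t = \<tau>(x)\<close>.\<close>

definition fundamental_solution ::
    "(real \<Rightarrow> real) \<Rightarrow> (real \<Rightarrow> real) \<Rightarrow> (real \<Rightarrow> real \<Rightarrow> real) \<Rightarrow> bool" where
  "fundamental_solution \<rho> q r \<longleftrightarrow>
     delta_solution \<rho> q r \<and>
     smooth2 {(x, t). 0 \<le> x \<and> tau \<rho> x \<le> t} (\<lambda>(x, t). r x t) \<and>
     (\<forall>x\<ge>0. \<forall>t<tau \<rho> x. r x t = 0) \<and>
     (\<forall>x\<ge>0. (r x \<longlongrightarrow> - ((\<rho> 0 * \<rho> x) powr (-1/4))) (at_right (tau \<rho> x)))"

definition wave ::
    "(real \<Rightarrow> real) \<Rightarrow> (real \<Rightarrow> real \<Rightarrow> real) \<Rightarrow> (real \<Rightarrow> real) \<Rightarrow> real \<Rightarrow> real \<Rightarrow> real" where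
  "wave \<rho> r f x t = (LBINT s:{0..t - tau \<rho> x}. r x (t - s) * f s)"


section \<open>Spaces and operators\<close>

text \<open>\<open>\<F>\<^sup>T = L2 (F_measure T)\<close> and \<open>\<H>\<^sup>T = L2 (H_measure \<rho> T)\<close>.\<close>

definition F_measure :: "real \<Rightarrow> real measure" where
  "F_measure T = restrict_space lborel {0..T}"

definition H_measure :: "(real \<Rightarrow> real) \<Rightarrow> real \<Rightarrow> real measure" where
  "H_measure \<rho> T = density (restrict_space lborel {0..tau_inv \<rho> T}) (\<lambda>x. ennreal (\<rho> x))"

definition control_op ::
    "(real \<Rightarrow> real) \<Rightarrow> (real \<Rightarrow> real \<Rightarrow> real) \<Rightarrow> real \<Rightarrow> (real \<Rightarrow> real) \<Rightarrow> real \<Rightarrow> real" where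
  "control_op \<rho> r T f x = wave \<rho> r f x T"

definition response_op ::
    "(real \<Rightarrow> real) \<Rightarrow> (real \<Rightarrow> real \<Rightarrow> real) \<Rightarrow> (real \<Rightarrow> real) \<Rightarrow> real \<Rightarrow> real" where
  "response_op \<rho> r f t = wave \<rho> r f 0 t"

text \<open>\<open>f \<in> H\<^sup>1[0,T]\<close> with derivative \<open>g\<close>; \<open>f\<close> is the absolutely continuous representative,
  so that \<open>f 0\<close> is meaningful.\<close>

definition has_H1_derivative :: "real \<Rightarrow> (real \<Rightarrow> real) \<Rightarrow> (real \<Rightarrow> real) \<Rightarrow> bool" where
  "has_H1_derivative T f g \<longleftrightarrow> g \<in> L2 (F_measure T) \<and>
     (\<forall>t\<in>{0..T}. f t = f 0 + (LBINT s:{0..t}. g s))"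

text \<open>The extension by continuity of \<open>f \<mapsto> W\<^sup>T f'\<close> from \<open>{f \<in> H\<^sup>1[0,T]. f 0 = 0}\<close> to
  \<open>\<F>\<^sup>T\<close>. The domain is dense, so the extension is unique up to equality in \<open>\<H>\<^sup>T\<close>.\<close>

definition control_ddt ::
    "(real \<Rightarrow> real) \<Rightarrow> (real \<Rightarrow> real \<Rightarrow> real) \<Rightarrow> real \<Rightarrow> (real \<Rightarrow> real) \<Rightarrow> real \<Rightarrow> real" where
  "control_ddt \<rho> r T =
     (SOME V. L2_bounded_linear (F_measure T) (H_measure \<rho> T) V \<and>
        (\<forall>f g. has_H1_derivative T f g \<and> f 0 = 0 \<longrightarrow>
           L2_eq (H_measure \<rho> T) (V f) (control_op \<rho> r T g)))"

text \<open>The bounded operator denoted \<open>- d/dt C\<^sup>T d/dt\<close>, i.e. \<open>(W\<^sup>T d/dt)\<^sup>* (W\<^sup>T d/dt)\<close>.\<close>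

definition ddt_C_ddt ::
    "(real \<Rightarrow> real) \<Rightarrow> (real \<Rightarrow> real \<Rightarrow> real) \<Rightarrow> real \<Rightarrow> (real \<Rightarrow> real) \<Rightarrow> real \<Rightarrow> real" where
  "ddt_C_ddt \<rho> r T f =
     L2_adjoint (F_measure T) (H_measure \<rho> T) (control_ddt \<rho> r T) (control_ddt \<rho> r T f)"

definition response_adj ::
    "(real \<Rightarrow> real) \<Rightarrow> (real \<Rightarrow> real \<Rightarrow> real) \<Rightarrow> real \<Rightarrow> (real \<Rightarrow> real) \<Rightarrow> real \<Rightarrow> real" where
  "response_adj \<rho> r T = L2_adjoint (F_measure T) (F_measure T) (response_op \<rho> r)"

text \<open>Boundary values at \<open>0\<close> of a function given on an interval \<open>(0,a)\<close>. An element of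
  \<open>\<H>\<^sup>T\<close> is a class of functions, so \<open>y 0\<close> itself carries no information.\<close>

definition value_at_0 :: "(real \<Rightarrow> real) \<Rightarrow> real" where
  "value_at_0 y = Lim (at_right 0) y"

definition deriv_at_0 :: "(real \<Rightarrow> real) \<Rightarrow> real" where
  "deriv_at_0 y = Lim (at_right 0) (deriv y)"

end

theory Submission
  imports Defs "HOL-Computational_Algebra.Polynomial"
begin

text \<open>Write \<open>\<tau>\<close> for the travel time, \<open>c(x) = r(x, \<tau>(x))\<close> for the jump of the fundamental solution across
its front, \<open>W\<close> for the control operator and \<open>R\<close> for the response operator at time \<open>T\<close>.

The operator \<open>W d/dt\<close> can be computed. For \<open>f \<in> H\<^sup>1[0,T]\<close> with \<open>f(0) = 0\<close>, integration by parts moves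
the derivative in \<open>W f'\<close> from the control to \<open>r\<close> and leaves
\<open>V\<^sub>0 f (x) = c(x) f(T - \<tau>(x)) + \<integral>\<^sub>0 r\<^sub>t(x, T - s) f(s) ds\<close>, the integral running up to \<open>T - \<tau>(x)\<close>. The first
term is a weighted composition with the change of variable \<open>s = T - \<tau>(x)\<close>, the second an integral
operator with a bounded kernel; so \<open>V\<^sub>0\<close> is bounded on the whole of \<open>\<F>\<^sup>T\<close> and has an explicit adjoint.
Smooth bumps with support in \<open>(0,T)\<close> belong to the domain of \<open>d/dt\<close> and are total in \<open>\<F>\<^sup>T\<close>; therefore \<open>V\<^sub>0\<close> is
the extension by continuity of \<open>W d/dt\<close> (\<open>control_ddt_eq_V\<^sub>0\<close>). As \<open>c\<close> has no zero, the equation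
\<open>V\<^sub>0 f = y\<close> becomes a Volterra equation of the second kind in the variable \<open>s\<close>, which is uniquely
solvable; therefore \<open>V\<^sub>0\<close> is a bijection (\<open>V\<^sub>0_surj\<close>, \<open>V\<^sub>0_inj\<close>).

The right-hand side of the equation comes from the identity
\<open>((W d/dt) f, y) = (f, - y(0) 1 + y'(0) R\<^sup>* 1)\<close> (\<open>pairing\<close>). By totality it suffices to prove it for a
bump \<open>f\<close>. Let \<open>F\<close> be the primitive of \<open>f\<close> that vanishes at \<open>0\<close>, and test the wave equation for \<open>r\<close> with
\<open>\<phi>(x,t) = y(x) F(T - t)\<close>, cut off where it meets no part of the support of \<open>r\<close>. Since \<open>y'' = q y\<close>, only
\<open>\<rho> \<phi>\<^sub>t\<^sub>t = \<rho> y f'(T - t)\<close> survives in the equation, and integrating it against \<open>r\<close> gives \<open>(W f', y)\<close>. The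
boundary terms are \<open>\<phi>(0,0) = y(0) (f, 1)\<close> and
\<open>y'(0) \<integral>\<^sub>0\<^sup>T r(0,t) F(T - t) dt = y'(0) (R f, 1)\<close>.

So \<open>(W d/dt)\<^sup>* y\<close> is the right-hand side of the equation for \<open>f\<close>. The control that produces \<open>y\<close>
therefore solves it. Conversely, for a solution \<open>g\<close> the state \<open>(W d/dt) g - y\<close> is orthogonal to the range
of \<open>W d/dt\<close>, which is everything; so \<open>g\<close> produces \<open>y\<close>.\<close>

section \<open>Square-integrable functions\<close>

lemma L2_measurable: "f \<in> L2 M \<Longrightarrow> f \<in> borel_measurable M"
  by (simp add: L2_def)

lemma L2_integrable_mult:
  assumes "f \<in> L2 M" "g \<in> L2 M"
  shows "integrable M (\<lambda>x. f x * g x)"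
proof (rule Bochner_Integration.integrable_bound)
  show "integrable M (\<lambda>x. (f x)\<^sup>2 + (g x)\<^sup>2)"
    using assms by (auto simp: L2_def)
  show "(\<lambda>x. f x * g x) \<in> borel_measurable M"
    using assms by (auto simp: L2_def)
  show "AE x in M. norm (f x * g x) \<le> norm ((f x)\<^sup>2 + (g x)\<^sup>2)"
  proof (rule AE_I2)
    fix x
    have "2 * (\<bar>f x\<bar> * \<bar>g x\<bar>) \<le> (f x)\<^sup>2 + (g x)\<^sup>2"
      using sum_squares_bound[of "\<bar>f x\<bar>" "\<bar>g x\<bar>"] by (simp add: mult.assoc)
    moreover have "0 \<le> \<bar>f x\<bar> * \<bar>g x\<bar>" by simp
    ultimately show "norm (f x * g x) \<le> norm ((f x)\<^sup>2 + (g x)\<^sup>2)"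
      unfolding real_norm_def abs_mult by linarith
  qed
qed

lemma L2_lincomb:
  assumes "f \<in> L2 M" "g \<in> L2 M"
  shows "(\<lambda>x. a * f x + b * g x) \<in> L2 M"
proof -
  have "integrable M (\<lambda>x. a\<^sup>2 * (f x * f x) + 2 * a * b * (f x * g x) + b\<^sup>2 * (g x * g x))"
    by (intro Bochner_Integration.integrable_add integrable_mult_right L2_integrable_mult assms)
  moreover have "(\<lambda>x. (a * f x + b * g x)\<^sup>2) =
      (\<lambda>x. a\<^sup>2 * (f x * f x) + 2 * a * b * (f x * g x) + b\<^sup>2 * (g x * g x))"
    by (rule ext) (simp add: power2_eq_square algebra_simps)
  ultimately show ?thesis using assms by (auto simp: L2_def)
qed

lemma L2_add: "f \<in> L2 M \<Longrightarrow> g \<in> L2 M \<Longrightarrow> (\<lambda>x. f x + g x) \<in> L2 M"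
  using L2_lincomb[of f M g 1 1] by simp

lemma L2_diff: "f \<in> L2 M \<Longrightarrow> g \<in> L2 M \<Longrightarrow> (\<lambda>x. f x - g x) \<in> L2 M"
  using L2_lincomb[of f M g 1 "-1"] by simp

lemma L2_scale: "f \<in> L2 M \<Longrightarrow> (\<lambda>x. a * f x) \<in> L2 M"
  using L2_lincomb[of f M f a 0] by simp

lemma L2_bounded:
  assumes "finite_measure M" "f \<in> borel_measurable M" "\<And>x. x \<in> space M \<Longrightarrow> \<bar>f x\<bar> \<le> B"
  shows "f \<in> L2 M"
proof -
  have "integrable M (\<lambda>x. (f x)\<^sup>2)"
    using assms
    by (intro finite_measure.integrable_const_bound[OF assms(1), where B = "B\<^sup>2"])
      (auto intro!: AE_I2 simp: abs_le_square_iff[symmetric] intro: order_trans[OF _ abs_ge_self])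
  then show ?thesis using assms by (simp add: L2_def)
qed

lemma L2_integrable:
  assumes "finite_measure M" "f \<in> L2 M"
  shows "integrable M f"
  using L2_integrable_mult[OF assms(2) L2_bounded[OF assms(1), of "\<lambda>_. 1" 1]] by simp

lemma L2_inner_lincomb:
  assumes "f \<in> L2 M" "g \<in> L2 M" "h \<in> L2 M"
  shows "L2_inner M (\<lambda>x. a * f x + b * g x) h = a * L2_inner M f h + b * L2_inner M g h"
proof -
  have "(\<lambda>x. (a * f x + b * g x) * h x) = (\<lambda>x. a * (f x * h x) + b * (g x * h x))"
    by (rule ext) (simp add: algebra_simps)
  then show ?thesis
    using assms by (simp add: L2_inner_def L2_integrable_mult)
qed

lemma L2_inner_diff:
  assumes "f \<in> L2 M" "g \<in> L2 M" "h \<in> L2 M"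
  shows "L2_inner M (\<lambda>x. f x - g x) h = L2_inner M f h - L2_inner M g h"
  using L2_inner_lincomb[OF assms, of 1 "-1"] by simp

lemma L2_inner_commute: "L2_inner M f g = L2_inner M g f"
  by (simp add: L2_inner_def mult.commute)

lemma L2_inner_self_nonneg: "0 \<le> L2_inner M f f"
  by (simp add: L2_inner_def)

lemma L2_inner_cong:
  assumes "L2_eq M f f'" "L2_eq M g g'"
    and "f \<in> L2 M" "f' \<in> L2 M" "g \<in> L2 M" "g' \<in> L2 M"
  shows "L2_inner M f g = L2_inner M f' g'"
  unfolding L2_inner_def
proof (rule integral_cong_AE)
  show "AE x in M. f x * g x = f' x * g' x"
    using assms(1,2) unfolding L2_eq_def by eventually_elim simp
qed (use assms in \<open>auto simp: L2_def\<close>)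

lemma L2_eq_refl: "L2_eq M f f"
  by (simp add: L2_eq_def)

lemma L2_eq_sym: "L2_eq M f g \<Longrightarrow> L2_eq M g f"
  by (auto simp: L2_eq_def elim: eventually_mono)

lemma L2_eq_trans:
  assumes "L2_eq M f g" "L2_eq M g h"
  shows "L2_eq M f h"
  using assms unfolding L2_eq_def by eventually_elim simp

lemma L2_eq_iff_norm_diff:
  assumes "f \<in> L2 M" "g \<in> L2 M"
  shows "L2_eq M f g \<longleftrightarrow> L2_inner M (\<lambda>x. f x - g x) (\<lambda>x. f x - g x) = 0"
proof -
  have "L2_inner M (\<lambda>x. f x - g x) (\<lambda>x. f x - g x) = 0
      \<longleftrightarrow> (AE x in M. (f x - g x) * (f x - g x) = 0)"
    unfolding L2_inner_def
    by (intro integral_nonneg_eq_0_iff_AE L2_integrable_mult L2_diff assms) simp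
  then show ?thesis by (simp add: L2_eq_def)
qed

lemma L2_Cauchy_Schwarz:
  assumes f: "f \<in> L2 M" and g: "g \<in> L2 M"
  shows "(L2_inner M f g)\<^sup>2 \<le> L2_inner M f f * L2_inner M g g"
proof -
  define A B C where "A = L2_inner M f f" and "B = L2_inner M f g" and "C = L2_inner M g g"
  have pos: "0 \<le> A + 2 * t * B + t\<^sup>2 * C" for t
  proof -
    let ?h = "\<lambda>x. 1 * f x + t * g x"
    have h: "?h \<in> L2 M" by (rule L2_lincomb[OF f g])
    have "L2_inner M f ?h = A + t * B" "L2_inner M g ?h = B + t * C"
      using L2_inner_lincomb[OF f g f, of 1 t] L2_inner_lincomb[OF f g g, of 1 t]
      by (simp_all add: A_def B_def C_def L2_inner_commute[of M g f]
          L2_inner_commute[of M f "\<lambda>x. f x + t * g x"] L2_inner_commute[of M g "\<lambda>x. f x + t * g x"])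
    moreover have "0 \<le> L2_inner M ?h ?h" by (rule L2_inner_self_nonneg)
    moreover have "L2_inner M ?h ?h = 1 * L2_inner M f ?h + t * L2_inner M g ?h"
      by (rule L2_inner_lincomb[OF f g h])
    ultimately have "0 \<le> (A + t * B) + t * (B + t * C)" by simp
    then show ?thesis by (simp add: algebra_simps power2_eq_square)
  qed
  have "B\<^sup>2 \<le> A * C"
  proof (cases "C = 0")
    case True
    have "B = 0"
    proof (rule ccontr)
      assume "B \<noteq> 0"
      then show False using pos[of "- (A + 1) / (2 * B)"] True by (simp add: field_simps)
    qed
    then show ?thesis using True by simp
  next
    case False
    then have C: "C > 0" using L2_inner_self_nonneg[of M g] by (simp add: C_def)
    then show ?thesis using pos[of "- B / C"]
      by (simp add: field_simps power2_eq_square)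
  qed
  then show ?thesis by (simp add: A_def B_def C_def)
qed

text \<open>The adjoint is a choice, which is meaningful as soon as one vector \<open>w\<close> represents the functional
\<open>f \<mapsto> (A f, g)\<close>: the difference of two such vectors is orthogonal to itself.\<close>

lemma L2_adjoint_works:
  assumes w: "w \<in> L2 M" and adj: "\<And>f. f \<in> L2 M \<Longrightarrow> L2_inner N (A f) g = L2_inner M f w"
  shows "L2_adjoint M N A g \<in> L2 M"
    and "f \<in> L2 M \<Longrightarrow> L2_inner N (A f) g = L2_inner M f (L2_adjoint M N A g)"
    and "L2_eq M (L2_adjoint M N A g) w"
proof -
  let ?P = "\<lambda>w. w \<in> L2 M \<and> (\<forall>f\<in>L2 M. L2_inner N (A f) g = L2_inner M f w)"
  have *: "?P (L2_adjoint M N A g)"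
    unfolding L2_adjoint_def by (rule someI[of ?P w]) (use assms in auto)
  then show a: "L2_adjoint M N A g \<in> L2 M"
    and b: "f \<in> L2 M \<Longrightarrow> L2_inner N (A f) g = L2_inner M f (L2_adjoint M N A g)" for f
    by auto
  let ?d = "\<lambda>x. L2_adjoint M N A g x - w x"
  have d: "?d \<in> L2 M" by (intro L2_diff a w)
  have "L2_inner M ?d ?d = L2_inner M ?d (L2_adjoint M N A g) - L2_inner M ?d w"
    using L2_inner_diff[OF a w d]
    by (simp only: L2_inner_commute[of M ?d "L2_adjoint M N A g"] L2_inner_commute[of M ?d w])
  also have "\<dots> = 0" using b[OF d] adj[OF d] by simp
  finally show "L2_eq M (L2_adjoint M N A g) w"
    using L2_eq_iff_norm_diff[OF a w] by simp
qed

text \<open>Parallelogram inequality; it replaces the triangle inequality, since only squared norms occur.\<close>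

lemma L2_norm_add_bound:
  assumes u: "u \<in> L2 M" and v: "v \<in> L2 M"
  shows "L2_inner M (\<lambda>x. u x + v x) (\<lambda>x. u x + v x) \<le> 2 * L2_inner M u u + 2 * L2_inner M v v"
proof -
  have "L2_inner M (\<lambda>x. u x + v x) (\<lambda>x. u x + v x) \<le> (LINT x|M. 2 * (u x * u x) + 2 * (v x * v x))"
    unfolding L2_inner_def
  proof (rule integral_mono)
    show "integrable M (\<lambda>x. (u x + v x) * (u x + v x))" by (intro L2_integrable_mult L2_add u v)
    show "integrable M (\<lambda>x. 2 * (u x * u x) + 2 * (v x * v x))"
      by (intro Bochner_Integration.integrable_add integrable_mult_right L2_integrable_mult u v)
    show "(u x + v x) * (u x + v x) \<le> 2 * (u x * u x) + 2 * (v x * v x)" for x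
      using sum_squares_bound[of "u x" "v x"] by (simp add: power2_eq_square algebra_simps)
  qed
  also have "\<dots> = 2 * L2_inner M u u + 2 * L2_inner M v v"
    using L2_integrable_mult[OF u u] L2_integrable_mult[OF v v] by (simp add: L2_inner_def)
  finally show ?thesis .
qed

lemma L2_bounded_linear_lincomb:
  assumes "L2_bounded_linear M N A" "f \<in> L2 M" "g \<in> L2 M"
  shows "L2_eq N (A (\<lambda>x. a * f x + b * g x)) (\<lambda>x. a * A f x + b * A g x)"
  using assms unfolding L2_bounded_linear_def by blast

lemma L2_bounded_linear_diff:
  assumes A: "L2_bounded_linear M N A" and "f \<in> L2 M" "g \<in> L2 M"
  shows "L2_eq N (A (\<lambda>x. f x - g x)) (\<lambda>x. A f x - A g x)"
  using L2_bounded_linear_lincomb[OF assms, of 1 "-1"] by simp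

lemma L2_bounded_linear_L2: "L2_bounded_linear M N A \<Longrightarrow> f \<in> L2 M \<Longrightarrow> A f \<in> L2 N"
  by (simp add: L2_bounded_linear_def)

text \<open>Linearity holds only almost everywhere, so continuity of \<open>A\<close> has to be derived for \<open>A f\<^sub>n - A f\<close>
instead of \<open>A (f\<^sub>n - f)\<close>.\<close>

lemma L2_bounded_linear_tendsto:
  assumes A: "L2_bounded_linear M N A" and F: "\<And>n. F n \<in> L2 M" and f: "f \<in> L2 M"
    and lim: "(\<lambda>n. L2_inner M (\<lambda>x. F n x - f x) (\<lambda>x. F n x - f x)) \<longlonglongrightarrow> 0"
  shows "(\<lambda>n. L2_inner N (\<lambda>x. A (F n) x - A f x) (\<lambda>x. A (F n) x - A f x)) \<longlonglongrightarrow> 0"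
proof -
  obtain K where K: "\<And>g. g \<in> L2 M \<Longrightarrow> L2_inner N (A g) (A g) \<le> K * L2_inner M g g"
    using A unfolding L2_bounded_linear_def by blast
  show ?thesis
  proof (rule tendsto_sandwich[OF _ _ tendsto_const])
    show "\<forall>\<^sub>F n in sequentially. L2_inner N (\<lambda>x. A (F n) x - A f x) (\<lambda>x. A (F n) x - A f x)
        \<le> K * L2_inner M (\<lambda>x. F n x - f x) (\<lambda>x. F n x - f x)"
    proof (rule always_eventually, rule allI)
      fix n
      have d: "(\<lambda>x. F n x - f x) \<in> L2 M" by (intro L2_diff F f)
      have "L2_inner N (\<lambda>x. A (F n) x - A f x) (\<lambda>x. A (F n) x - A f x)
          = L2_inner N (A (\<lambda>x. F n x - f x)) (A (\<lambda>x. F n x - f x))"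
        by (intro L2_inner_cong L2_eq_sym[OF L2_bounded_linear_diff[OF A F f]]
            L2_diff L2_bounded_linear_L2[OF A] F f d)
      also have "\<dots> \<le> K * L2_inner M (\<lambda>x. F n x - f x) (\<lambda>x. F n x - f x)" by (rule K[OF d])
      finally show "L2_inner N (\<lambda>x. A (F n) x - A f x) (\<lambda>x. A (F n) x - A f x)
          \<le> K * L2_inner M (\<lambda>x. F n x - f x) (\<lambda>x. F n x - f x)" .
    qed
    show "(\<lambda>n. K * L2_inner M (\<lambda>x. F n x - f x) (\<lambda>x. F n x - f x)) \<longlonglongrightarrow> 0"
      using tendsto_mult_right_zero[OF lim] by simp
  qed (simp add: L2_inner_self_nonneg)
qed

lemma L2_inner_tendsto:
  assumes F: "\<And>n. F n \<in> L2 M" and f: "f \<in> L2 M" and g: "g \<in> L2 M"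
    and lim: "(\<lambda>n. L2_inner M (\<lambda>x. F n x - f x) (\<lambda>x. F n x - f x)) \<longlonglongrightarrow> 0"
  shows "(\<lambda>n. L2_inner M (F n) g) \<longlonglongrightarrow> L2_inner M f g"
proof -
  have "(\<lambda>n. (L2_inner M (F n) g - L2_inner M f g)\<^sup>2) \<longlonglongrightarrow> 0"
  proof (rule tendsto_sandwich[OF _ _ tendsto_const])
    show "\<forall>\<^sub>F n in sequentially. (L2_inner M (F n) g - L2_inner M f g)\<^sup>2
        \<le> L2_inner M (\<lambda>x. F n x - f x) (\<lambda>x. F n x - f x) * L2_inner M g g"
      using L2_Cauchy_Schwarz[OF L2_diff[OF F f] g]
      by (simp add: L2_inner_diff[OF F f g])
    show "(\<lambda>n. L2_inner M (\<lambda>x. F n x - f x) (\<lambda>x. F n x - f x) * L2_inner M g g) \<longlonglongrightarrow> 0"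
      using tendsto_mult_left_zero[OF lim] by simp
  qed simp
  from tendsto_real_sqrt[OF this]
  have "(\<lambda>n. L2_inner M (F n) g - L2_inner M f g) \<longlonglongrightarrow> 0"
    by (simp add: tendsto_rabs_zero_iff)
  then show ?thesis by (simp add: LIM_zero_cancel)
qed

section \<open>Integral operators with bounded kernel\<close>

locale bounded_kernel =
  M: finite_measure M + N: finite_measure N
  for M :: "'a measure" and N :: "'b measure" +
  fixes \<kappa> :: "'a \<Rightarrow> 'b \<Rightarrow> real" and B :: real
  assumes kernel_measurable: "(\<lambda>(x, s). \<kappa> x s) \<in> borel_measurable (M \<Otimes>\<^sub>M N)"
    and kernel_bound: "\<And>x s. x \<in> space M \<Longrightarrow> s \<in> space N \<Longrightarrow> \<bar>\<kappa> x s\<bar> \<le> B"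

begin

sublocale MN: pair_sigma_finite M N ..

lemma section_L2: "x \<in> space M \<Longrightarrow> \<kappa> x \<in> L2 N"
  using measurable_compose[OF measurable_Pair1' kernel_measurable]
  by (intro L2_bounded[where B = B] N.finite_measure_axioms) (auto intro: kernel_bound)

lemma section_integrable: "x \<in> space M \<Longrightarrow> f \<in> L2 N \<Longrightarrow> integrable N (\<lambda>s. \<kappa> x s * f s)"
  by (intro L2_integrable_mult section_L2)

lemma apply_measurable:
  assumes "f \<in> borel_measurable N"
  shows "(\<lambda>x. LINT s|N. \<kappa> x s * f s) \<in> borel_measurable M"
proof -
  have "(\<lambda>p. (case p of (x, s) \<Rightarrow> \<kappa> x s) * f (snd p)) \<in> borel_measurable (M \<Otimes>\<^sub>M N)"
    using assms kernel_measurable by measurable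
  then have "(\<lambda>(x, s). \<kappa> x s * f s) \<in> borel_measurable (M \<Otimes>\<^sub>M N)"
    by (simp add: case_prod_beta)
  then show ?thesis by (rule N.borel_measurable_lebesgue_integral)
qed

text \<open>Cauchy--Schwarz in the integration variable gives a bound that is uniform in \<open>x\<close>. It yields both that
images are bounded functions and that the operator is bounded on \<open>L\<^sub>2\<close>.\<close>

lemma apply_square_bound:
  assumes "f \<in> L2 N" "x \<in> space M"
  shows "(LINT s|N. \<kappa> x s * f s)\<^sup>2 \<le> B\<^sup>2 * measure N (space N) * L2_inner N f f"
proof -
  have "L2_inner N (\<kappa> x) (\<kappa> x) \<le> (LINT s|N. B\<^sup>2)"
    unfolding L2_inner_def
  proof (rule integral_mono)
    show "\<kappa> x s * \<kappa> x s \<le> B\<^sup>2" if "s \<in> space N" for s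
      using power_mono[OF kernel_bound[OF assms(2) that], of 2] by (simp add: power2_eq_square)
  qed (auto intro!: L2_integrable_mult section_L2 assms)
  then have "L2_inner N (\<kappa> x) (\<kappa> x) \<le> B\<^sup>2 * measure N (space N)" by (simp add: mult.commute)
  then have "L2_inner N (\<kappa> x) (\<kappa> x) * L2_inner N f f \<le> B\<^sup>2 * measure N (space N) * L2_inner N f f"
    by (intro mult_right_mono L2_inner_self_nonneg)
  with L2_Cauchy_Schwarz[OF section_L2[OF assms(2)] assms(1)] show ?thesis
    unfolding L2_inner_def by linarith
qed

lemma apply_bounded:
  assumes "f \<in> L2 N"
  shows "\<exists>C. \<forall>x\<in>space M. \<bar>LINT s|N. \<kappa> x s * f s\<bar> \<le> C"
proof -
  have "\<bar>LINT s|N. \<kappa> x s * f s\<bar> \<le> sqrt (B\<^sup>2 * measure N (space N) * L2_inner N f f)"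
    if "x \<in> space M" for x
    using real_le_rsqrt[of "\<bar>LINT s|N. \<kappa> x s * f s\<bar>"] apply_square_bound[OF assms that] by simp
  then show ?thesis by blast
qed

lemma apply_L2: "f \<in> L2 N \<Longrightarrow> (\<lambda>x. LINT s|N. \<kappa> x s * f s) \<in> L2 M"
proof -
  assume f: "f \<in> L2 N"
  obtain C where "\<And>x. x \<in> space M \<Longrightarrow> \<bar>LINT s|N. \<kappa> x s * f s\<bar> \<le> C"
    using apply_bounded[OF f] by blast
  then show ?thesis
    by (rule L2_bounded[OF M.finite_measure_axioms apply_measurable[OF L2_measurable[OF f]]])
qed

lemma apply_norm_bound:
  assumes "f \<in> L2 N"
  shows "L2_inner M (\<lambda>x. LINT s|N. \<kappa> x s * f s) (\<lambda>x. LINT s|N. \<kappa> x s * f s)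
     \<le> (B\<^sup>2 * measure N (space N) * measure M (space M)) * L2_inner N f f"
proof -
  have "L2_inner M (\<lambda>x. LINT s|N. \<kappa> x s * f s) (\<lambda>x. LINT s|N. \<kappa> x s * f s)
    \<le> (LINT x|M. B\<^sup>2 * measure N (space N) * L2_inner N f f)"
    unfolding L2_inner_def[of M]
  proof (rule integral_mono)
    show "integrable M (\<lambda>x. (LINT s|N. \<kappa> x s * f s) * (LINT s|N. \<kappa> x s * f s))"
      by (intro L2_integrable_mult apply_L2 assms)
  qed (use apply_square_bound[OF assms] in \<open>auto simp: power2_eq_square\<close>)
  then show ?thesis by (simp add: mult_ac)
qed

lemma apply_lincomb:
  assumes "f \<in> L2 N" "g \<in> L2 N" "x \<in> space M"
  shows "(LINT s|N. \<kappa> x s * (a * f s + b * g s))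
    = a * (LINT s|N. \<kappa> x s * f s) + b * (LINT s|N. \<kappa> x s * g s)"
proof -
  have "(\<lambda>s. \<kappa> x s * (a * f s + b * g s)) = (\<lambda>s. a * (\<kappa> x s * f s) + b * (\<kappa> x s * g s))"
    by (rule ext) (simp add: algebra_simps)
  then show ?thesis using section_integrable assms by simp
qed

lemma transpose: "bounded_kernel N M (\<lambda>s x. \<kappa> x s) B"
proof
  show "(\<lambda>(s, x). \<kappa> x s) \<in> borel_measurable (N \<Otimes>\<^sub>M M)"
    using measurable_compose[OF measurable_pair_swap' kernel_measurable]
    by (simp add: case_prod_beta)
qed (auto intro: kernel_bound)

text \<open>Fubini's theorem; the product \<open>\<bar>f(s) g(x)\<bar>\<close> dominates the integrand, and it is integrable because on
finite measure spaces square-integrable functions are integrable.\<close>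

lemma duality:
  assumes f: "f \<in> L2 N" and g: "g \<in> L2 M"
  shows "L2_inner M (\<lambda>x. LINT s|N. \<kappa> x s * f s) g = L2_inner N f (\<lambda>s. LINT x|M. \<kappa> x s * g x)"
proof -
  have [measurable]: "f \<in> borel_measurable N" "g \<in> borel_measurable M"
    using f g by (auto simp: L2_def)
  let ?h = "\<lambda>(x, s). \<kappa> x s * f s * g x"
  have "(\<lambda>p. (case p of (x, s) \<Rightarrow> \<kappa> x s) * f (snd p) * g (fst p)) \<in> borel_measurable (M \<Otimes>\<^sub>M N)"
    using kernel_measurable by measurable
  then have [measurable]: "?h \<in> borel_measurable (M \<Otimes>\<^sub>M N)"
    by (simp add: case_prod_beta)
  have int: "integrable (M \<Otimes>\<^sub>M N) ?h"
  proof (rule MN.Fubini_integrable)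
    show "AE x in M. integrable N (\<lambda>s. ?h (x, s))"
      using f by (auto intro!: AE_I2 integrable_mult_left section_integrable)
    have abs_f: "(\<lambda>s. \<bar>f s\<bar>) \<in> L2 N" using f by (auto simp: L2_def)
    show "integrable M (\<lambda>x. LINT s|N. norm (?h (x, s)))"
    proof (rule Bochner_Integration.integrable_bound)
      show "integrable M (\<lambda>x. (B * (LINT s|N. \<bar>f s\<bar>)) * g x)"
        using g by (intro integrable_mult_right L2_integrable M.finite_measure_axioms)
      show "AE x in M. norm (LINT s|N. norm (?h (x, s))) \<le> norm ((B * (LINT s|N. \<bar>f s\<bar>)) * g x)"
      proof (rule AE_I2)
        fix x assume x: "x \<in> space M"
        have "(LINT s|N. norm (?h (x, s))) \<le> (LINT s|N. B * \<bar>g x\<bar> * \<bar>f s\<bar>)"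
        proof (rule integral_mono)
          show "integrable N (\<lambda>s. norm (?h (x, s)))"
            using f x by (auto intro!: integrable_norm integrable_mult_left section_integrable simp del: real_norm_def)
          show "integrable N (\<lambda>s. B * \<bar>g x\<bar> * \<bar>f s\<bar>)"
            using abs_f by (intro integrable_mult_right L2_integrable N.finite_measure_axioms)
          show "norm (?h (x, s)) \<le> B * \<bar>g x\<bar> * \<bar>f s\<bar>" if "s \<in> space N" for s
            using mult_right_mono[OF kernel_bound[OF x that], of "\<bar>g x\<bar> * \<bar>f s\<bar>"]
            by (simp add: abs_mult mult_ac)
        qed
        also have "\<dots> = B * (LINT s|N. \<bar>f s\<bar>) * \<bar>g x\<bar>" by simp
        also have "\<dots> \<le> norm ((B * (LINT s|N. \<bar>f s\<bar>)) * g x)"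
          unfolding real_norm_def abs_mult[of _ "g x"] by (intro mult_right_mono) auto
        finally show "norm (LINT s|N. norm (?h (x, s))) \<le> norm ((B * (LINT s|N. \<bar>f s\<bar>)) * g x)"
          by simp
      qed
    qed measurable
  qed measurable
  have "L2_inner M (\<lambda>x. LINT s|N. \<kappa> x s * f s) g = (LINT x|M. LINT s|N. ?h (x, s))"
    by (simp add: L2_inner_def)
  also have "\<dots> = (LINT s|N. LINT x|M. ?h (x, s))"
    using MN.Fubini_integral[of "\<lambda>x s. ?h (x, s)"] int by simp
  also have "\<dots> = L2_inner N f (\<lambda>s. LINT x|M. \<kappa> x s * g x)"
    unfolding L2_inner_def
    by (intro Bochner_Integration.integral_cong refl)
      (simp add: mult_ac flip: integral_mult_right_zero)
  finally show ?thesis .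
qed

end

section \<open>Weighted composition operators\<close>

text \<open>The change of variable \<open>\<phi>\<close> carries the measure \<open>m dM\<close> to \<open>N\<close> and has the left inverse \<open>\<psi>\<close>. The bound
\<open>c\<^sup>2 \<le> K m\<close> is what makes \<open>f \<mapsto> c (f \<circ> \<phi>)\<close> bounded from \<open>L\<^sub>2(N)\<close> to \<open>L\<^sub>2(M)\<close>.\<close>

locale weighted_transport =
  fixes M :: "'a measure" and N :: "'b measure" and \<phi> :: "'a \<Rightarrow> 'b" and \<psi> :: "'b \<Rightarrow> 'a"
    and m c :: "'a \<Rightarrow> real" and K :: real
  assumes \<phi>: "\<phi> \<in> measurable M N" and \<psi>: "\<psi> \<in> measurable N M"
    and inverse: "\<And>x. x \<in> space M \<Longrightarrow> \<psi> (\<phi> x) = x"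
    and m: "m \<in> borel_measurable M" "\<And>x. x \<in> space M \<Longrightarrow> 0 < m x"
    and transport: "N = distr (density M (\<lambda>x. ennreal (m x))) N \<phi>"
    and c: "c \<in> borel_measurable M" "\<And>x. x \<in> space M \<Longrightarrow> (c x)\<^sup>2 \<le> K * m x"

begin

lemma \<phi>_density: "\<phi> \<in> measurable (density M (\<lambda>x. ennreal (m x))) N"
  using \<phi> by simp

lemma integrable_transport:
  fixes F :: "'b \<Rightarrow> real"
  assumes "F \<in> borel_measurable N"
  shows "integrable N F \<longleftrightarrow> integrable M (\<lambda>x. m x * F (\<phi> x))"
proof -
  have "integrable N F \<longleftrightarrow> integrable (density M (\<lambda>x. ennreal (m x))) (\<lambda>x. F (\<phi> x))"
    by (subst transport) (rule integrable_distr_eq[OF \<phi>_density assms])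
  also have "\<dots> \<longleftrightarrow> integrable M (\<lambda>x. m x * F (\<phi> x))"
    using m assms \<phi> by (subst integrable_density) (auto intro!: AE_I2 less_imp_le)
  finally show ?thesis .
qed

lemma integral_transport:
  fixes F :: "'b \<Rightarrow> real"
  assumes "F \<in> borel_measurable N"
  shows "integral\<^sup>L N F = (LINT x|M. m x * F (\<phi> x))"
proof -
  have "integral\<^sup>L N F = (LINT x|density M (\<lambda>x. ennreal (m x)). F (\<phi> x))"
    by (subst transport) (rule integral_distr[OF \<phi>_density assms])
  also have "\<dots> = (LINT x|M. m x * F (\<phi> x))"
    using m assms \<phi> by (subst integral_density) (auto intro!: AE_I2 less_imp_le)
  finally show ?thesis .
qed

lemma comp_L2:
  assumes f: "f \<in> L2 N"
  shows "(\<lambda>x. c x * f (\<phi> x)) \<in> L2 M"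
    and "L2_inner M (\<lambda>x. c x * f (\<phi> x)) (\<lambda>x. c x * f (\<phi> x)) \<le> K * L2_inner N f f"
proof -
  have fm: "f \<in> borel_measurable N" using f by (rule L2_measurable)
  have meas: "(\<lambda>x. c x * f (\<phi> x)) \<in> borel_measurable M"
    using c fm \<phi> by measurable
  have "integrable N (\<lambda>s. f s * f s)" using f by (intro L2_integrable_mult)
  then have int: "integrable M (\<lambda>x. K * (m x * (f (\<phi> x) * f (\<phi> x))))"
    using fm by (subst (asm) integrable_transport) auto
  have le: "(c x * f (\<phi> x)) * (c x * f (\<phi> x)) \<le> K * (m x * (f (\<phi> x) * f (\<phi> x)))" if "x \<in> space M" for x
    using mult_right_mono[OF c(2)[OF that], of "f (\<phi> x) * f (\<phi> x)"] by (simp add: power2_eq_square mult_ac)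
  have "integrable M (\<lambda>x. (c x * f (\<phi> x))\<^sup>2)"
  proof (rule Bochner_Integration.integrable_bound[OF int])
    show "AE x in M. norm ((c x * f (\<phi> x))\<^sup>2) \<le> norm (K * (m x * (f (\<phi> x) * f (\<phi> x))))"
      using le by (intro AE_I2) (force simp: power2_eq_square)
  qed (use meas in simp)
  then show L: "(\<lambda>x. c x * f (\<phi> x)) \<in> L2 M" using meas by (simp add: L2_def)
  have "L2_inner M (\<lambda>x. c x * f (\<phi> x)) (\<lambda>x. c x * f (\<phi> x)) \<le> (LINT x|M. K * (m x * (f (\<phi> x) * f (\<phi> x))))"
    unfolding L2_inner_def by (intro integral_mono L2_integrable_mult L int le)
  also have "\<dots> = K * L2_inner N f f"
    using fm by (simp add: L2_inner_def integral_transport)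
  finally show "L2_inner M (\<lambda>x. c x * f (\<phi> x)) (\<lambda>x. c x * f (\<phi> x)) \<le> K * L2_inner N f f" .
qed

text \<open>Substituting \<open>x = \<psi>(s)\<close> in \<open>\<integral> c (f \<circ> \<phi>) g dM\<close> turns \<open>dM\<close> into \<open>dN / m\<close>.\<close>

lemma comp_adjoint:
  assumes g: "g \<in> L2 M"
  defines "w \<equiv> \<lambda>s. c (\<psi> s) / m (\<psi> s) * g (\<psi> s)"
  shows "w \<in> L2 N"
    and "f \<in> L2 N \<Longrightarrow> L2_inner M (\<lambda>x. c x * f (\<phi> x)) g = L2_inner N f w"
proof -
  have gm: "g \<in> borel_measurable M" using g by (rule L2_measurable)
  have meas: "w \<in> borel_measurable N"
    unfolding w_def using c m gm \<psi> by measurable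
  have w\<phi>: "w (\<phi> x) = c x / m x * g x" if "x \<in> space M" for x
    using inverse[OF that] by (simp add: w_def)
  have "integrable M (\<lambda>x. m x * (w (\<phi> x))\<^sup>2)"
  proof (rule Bochner_Integration.integrable_bound)
    show "integrable M (\<lambda>x. K * (g x)\<^sup>2)" using g by (auto simp: L2_def)
    show "AE x in M. norm (m x * (w (\<phi> x))\<^sup>2) \<le> norm (K * (g x)\<^sup>2)"
    proof (rule AE_I2)
      fix x assume x: "x \<in> space M"
      have "m x * (w (\<phi> x))\<^sup>2 = ((c x)\<^sup>2 / m x) * (g x)\<^sup>2"
        using m(2)[OF x] by (simp add: w\<phi>[OF x] field_simps power2_eq_square)
      also have "\<dots> \<le> K * (g x)\<^sup>2"
        using c(2)[OF x] m(2)[OF x] by (intro mult_right_mono) (auto simp: field_simps)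
      finally show "norm (m x * (w (\<phi> x))\<^sup>2) \<le> norm (K * (g x)\<^sup>2)"
        using m(2)[OF x] by simp
    qed
    show "(\<lambda>x. m x * (w (\<phi> x))\<^sup>2) \<in> borel_measurable M"
      using m meas \<phi> by measurable
  qed
  then have "integrable N (\<lambda>s. (w s)\<^sup>2)"
    using meas by (subst integrable_transport) auto
  then show wL: "w \<in> L2 N" using meas by (simp add: L2_def)
  assume f: "f \<in> L2 N"
  then have "L2_inner N f w = (LINT x|M. m x * (f (\<phi> x) * w (\<phi> x)))"
    unfolding L2_inner_def using meas by (intro integral_transport) (auto simp: L2_def)
  also have "\<dots> = L2_inner M (\<lambda>x. c x * f (\<phi> x)) g"
    unfolding L2_inner_def
    by (intro Bochner_Integration.integral_cong refl) (use m(2) in \<open>force simp: w\<phi>\<close>)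
  finally show "L2_inner M (\<lambda>x. c x * f (\<phi> x)) g = L2_inner N f w" by simp
qed

text \<open>A null set of \<open>M\<close> is seen by \<open>N\<close> through \<open>\<psi>\<close> as a null set. Measurability of \<open>u\<close> matters, because
preimages of arbitrary subsets of null sets need not be measurable.\<close>

lemma AE_transport:
  assumes u: "u \<in> borel_measurable M" and ae: "AE x in M. u x = (0::real)"
  shows "AE s in N. u (\<psi> s) = 0"
proof -
  have u\<psi>: "(\<lambda>s. u (\<psi> s)) \<in> borel_measurable N" using measurable_compose[OF \<psi> u] .
  have "AE x in M. u (\<psi> (\<phi> x)) = 0"
    using ae by (rule AE_mp) (auto intro!: AE_I2 simp: inverse)
  then have "AE x in density M (\<lambda>x. ennreal (m x)). u (\<psi> (\<phi> x)) = 0"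
    using m by (subst AE_density) auto
  then have "AE s in distr (density M (\<lambda>x. ennreal (m x))) N \<phi>. u (\<psi> s) = 0"
    by (subst AE_distr_iff[OF \<phi>_density]) (use u\<psi> in auto)
  then show ?thesis by (subst transport)
qed

end

section \<open>Smooth functions of one variable\<close>

text \<open>The sequences of successive derivatives that witness smoothness, as objects of their own: test functions
are built from such sequences, and their first few terms have to be known.\<close>

definition deriv_seq :: "real set \<Rightarrow> (nat \<Rightarrow> real \<Rightarrow> real) \<Rightarrow> bool" where
  "deriv_seq S D \<longleftrightarrow> (\<forall>n. \<forall>x\<in>S. (D n has_real_derivative D (Suc n) x) (at x within S))"

lemma smooth1_iff: "smooth1 S f \<longleftrightarrow> (\<exists>D. (\<forall>x\<in>S. D 0 x = f x) \<and> deriv_seq S D)"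
  by (simp add: smooth1_def deriv_seq_def)

lemma has_real_derivative_cong_on:
  assumes "(f has_real_derivative d) (at x within S)" "x \<in> S" "\<And>y. y \<in> S \<Longrightarrow> f y = g y"
  shows "(g has_real_derivative d) (at x within S)"
  using has_field_derivative_transform_within[OF assms(1) zero_less_one assms(2)] assms(3) by blast

lemma deriv_seq_case_nat:
  assumes "deriv_seq S D" "\<And>x. x \<in> S \<Longrightarrow> (f has_real_derivative D 0 x) (at x within S)"
  shows "deriv_seq S (case_nat f D)"
  using assms by (auto simp: deriv_seq_def split: nat.split)

text \<open>A family of functions that is closed under differentiation consists of smooth functions: iterating a
choice of derivatives inside the family gives all derivatives. Products, the functions
\<open>p(1/x) exp(-\<epsilon>/x)\<close> and solutions of linear differential equations are all treated in this way.\<close>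

lemma smooth1_coinduct:
  assumes f: "f \<in> F"
    and step: "\<And>g. g \<in> F \<Longrightarrow> \<exists>g'\<in>F. \<forall>x\<in>S. (g has_real_derivative g' x) (at x within S)"
  shows "smooth1 S f"
proof -
  obtain d where d: "\<And>g. g \<in> F \<Longrightarrow> d g \<in> F"
    "\<And>g x. g \<in> F \<Longrightarrow> x \<in> S \<Longrightarrow> (g has_real_derivative d g x) (at x within S)"
    using step by metis
  define D where "D n = (d ^^ n) f" for n
  have "D n \<in> F" for n by (induction n) (auto simp: D_def f d)
  then have "deriv_seq S D" using d by (simp add: deriv_seq_def D_def)
  moreover have "D 0 = f" by (simp add: D_def)
  ultimately show ?thesis unfolding smooth1_iff by metis
qed

lemma smooth1_deriv:
  assumes "smooth1 S f"
  obtains g where "smooth1 S g" "\<And>x. x \<in> S \<Longrightarrow> (f has_real_derivative g x) (at x within S)"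
proof -
  obtain D where D: "\<And>x. x \<in> S \<Longrightarrow> D 0 x = f x" "deriv_seq S D"
    using assms by (auto simp: smooth1_iff)
  have "smooth1 S (D 1)"
    unfolding smooth1_iff using D(2)
    by (intro exI[of _ "\<lambda>n. D (Suc n)"]) (auto simp: deriv_seq_def)
  moreover have "(f has_real_derivative D 1 x) (at x within S)" if "x \<in> S" for x
    using D that by (intro has_real_derivative_cong_on[of "D 0" _ x S f]) (auto simp: deriv_seq_def)
  ultimately show ?thesis using that by blast
qed

lemma smooth1_primitive:
  assumes "smooth1 S g" "\<And>x. x \<in> S \<Longrightarrow> (f has_real_derivative g x) (at x within S)"
  shows "smooth1 S f"
proof -
  obtain D where D: "\<And>x. x \<in> S \<Longrightarrow> D 0 x = g x" "deriv_seq S D"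
    using assms(1) by (auto simp: smooth1_iff)
  then have "deriv_seq S (case_nat f D)"
    using assms(2) by (intro deriv_seq_case_nat) auto
  then show ?thesis unfolding smooth1_iff by (metis nat.case(1))
qed

lemma smooth1_continuous_on:
  assumes "smooth1 S f"
  shows "continuous_on S f"
  using assms
proof (rule smooth1_deriv)
  fix g assume "\<And>x. x \<in> S \<Longrightarrow> (f has_real_derivative g x) (at x within S)"
  then show ?thesis by (rule DERIV_continuous_on)
qed

lemma deriv_seq_subset:
  assumes "deriv_seq S D" "R \<subseteq> S"
  shows "deriv_seq R D"
  unfolding deriv_seq_def
proof (intro allI ballI)
  fix n x assume "x \<in> R"
  then have "(D n has_real_derivative D (Suc n) x) (at x within S)"
    using assms by (auto simp: deriv_seq_def)
  then show "(D n has_real_derivative D (Suc n) x) (at x within R)"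
    by (rule has_field_derivative_subset) fact
qed

lemma smooth1_subset:
  assumes "smooth1 S f" "R \<subseteq> S"
  shows "smooth1 R f"
proof -
  obtain D where D: "\<And>x. x \<in> S \<Longrightarrow> D 0 x = f x" "deriv_seq S D"
    using assms(1) by (auto simp: smooth1_iff)
  then show ?thesis
    unfolding smooth1_iff using assms(2) by (blast intro: deriv_seq_subset)
qed

lemma smooth1_const: "smooth1 S (\<lambda>_. c)"
  by (rule smooth1_coinduct[where F = "range (\<lambda>c _. c)"]) (auto intro: exI[of _ 0])

lemma smooth1_add:
  assumes "smooth1 S f" "smooth1 S g"
  shows "smooth1 S (\<lambda>x. f x + g x)"
proof (rule smooth1_coinduct[where F = "{\<lambda>x. f x + g x |f g. smooth1 S f \<and> smooth1 S g}"])
  fix h assume "h \<in> {\<lambda>x. f x + g x |f g. smooth1 S f \<and> smooth1 S g}"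
  then obtain f g where h: "h = (\<lambda>x. f x + g x)" and fg: "smooth1 S f" "smooth1 S g" by blast
  obtain f' g' where "smooth1 S f'" "\<And>x. x \<in> S \<Longrightarrow> (f has_real_derivative f' x) (at x within S)"
    "smooth1 S g'" "\<And>x. x \<in> S \<Longrightarrow> (g has_real_derivative g' x) (at x within S)"
    using fg by (metis smooth1_deriv)
  then show "\<exists>g'\<in>{\<lambda>x. f x + g x |f g. smooth1 S f \<and> smooth1 S g}.
      \<forall>x\<in>S. (h has_real_derivative g' x) (at x within S)"
    unfolding h by (intro bexI[of _ "\<lambda>x. f' x + g' x"]) (auto intro!: DERIV_add)
qed (use assms in blast)

text \<open>Sums of products: by the product rule this family is closed under differentiation, which the products
alone are not.\<close>

inductive product_sum :: "real set \<Rightarrow> (real \<Rightarrow> real) \<Rightarrow> bool" for S where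
  product: "smooth1 S f \<Longrightarrow> smooth1 S g \<Longrightarrow> product_sum S (\<lambda>x. f x * g x)"
| sum: "product_sum S f \<Longrightarrow> product_sum S g \<Longrightarrow> product_sum S (\<lambda>x. f x + g x)"

lemma smooth1_mult:
  assumes "smooth1 S f" "smooth1 S g"
  shows "smooth1 S (\<lambda>x. f x * g x)"
proof (rule smooth1_coinduct[where F = "Collect (product_sum S)"])
  fix h assume "h \<in> Collect (product_sum S)"
  then have "product_sum S h" by simp
  then show "\<exists>h'\<in>Collect (product_sum S). \<forall>x\<in>S. (h has_real_derivative h' x) (at x within S)"
  proof induction
    case (product f g)
    obtain f' g' where d: "smooth1 S f'" "\<And>x. x \<in> S \<Longrightarrow> (f has_real_derivative f' x) (at x within S)"
      "smooth1 S g'" "\<And>x. x \<in> S \<Longrightarrow> (g has_real_derivative g' x) (at x within S)"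
      using product by (metis smooth1_deriv)
    have "product_sum S (\<lambda>x. f' x * g x + g' x * f x)"
      by (intro product_sum.intros d product)
    then show ?case using d by (intro bexI[of _ "\<lambda>x. f' x * g x + g' x * f x"]) (auto intro!: DERIV_mult)
  next
    case (sum f g)
    then obtain f' g' where "product_sum S f'" "product_sum S g'"
      "\<And>x. x \<in> S \<Longrightarrow> (f has_real_derivative f' x) (at x within S)"
      "\<And>x. x \<in> S \<Longrightarrow> (g has_real_derivative g' x) (at x within S)" by blast
    then show ?case
      by (intro bexI[of _ "\<lambda>x. f' x + g' x"]) (auto intro!: DERIV_add product_sum.intros)
  qed
qed (use assms in \<open>auto intro: product_sum.intros\<close>)

lemma deriv_seq_affine:
  assumes "deriv_seq UNIV D"
  shows "deriv_seq UNIV (\<lambda>n x. m ^ n * D n (m * x + c))"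
  unfolding deriv_seq_def
proof (intro allI ballI)
  fix n x
  have "(D n has_real_derivative D (Suc n) (m * x + c)) (at (m * x + c))"
    using assms by (simp add: deriv_seq_def)
  moreover have "((\<lambda>x. m * x + c) has_real_derivative m) (at x)"
    by (auto intro!: derivative_eq_intros)
  ultimately have "((\<lambda>x. D n (m * x + c)) has_real_derivative D (Suc n) (m * x + c) * m) (at x)"
    by (rule DERIV_chain2)
  from DERIV_cmult[OF this, of "m ^ n"]
  show "((\<lambda>x. m ^ n * D n (m * x + c)) has_real_derivative m ^ Suc n * D (Suc n) (m * x + c)) (at x)"
    by (simp add: mult_ac)
qed

lemma smooth1_affine:
  assumes "smooth1 UNIV f"
  shows "smooth1 UNIV (\<lambda>x. f (m * x + c))"
proof -
  obtain D where "\<And>x. D 0 x = f x" "deriv_seq UNIV D"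
    using assms by (auto simp: smooth1_iff)
  then show ?thesis unfolding smooth1_iff
    by (intro exI[of _ "\<lambda>n x. m ^ n * D n (m * x + c)"]) (auto intro: deriv_seq_affine)
qed

text \<open>Derivatives are determined by the values on any set \<open>R\<close> without isolated points, so two sequences
of derivatives with equal zeroth terms on \<open>R\<close> agree there in all orders, even if they are taken within
different sets.\<close>

lemma deriv_seq_unique:
  assumes D: "deriv_seq S D" and E: "deriv_seq S' E" and R: "R \<subseteq> S" "R \<subseteq> S'"
    and lim: "\<And>x. x \<in> R \<Longrightarrow> at x within R \<noteq> bot"
    and eq: "\<And>x. x \<in> R \<Longrightarrow> D 0 x = E 0 x" and x: "x \<in> R"
  shows "D n x = E n x"
proof -
  have "\<forall>x\<in>R. D n x = E n x"
  proof (induction n)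
    case (Suc n)
    show ?case
    proof
      fix x assume x: "x \<in> R"
      have "(D n has_real_derivative D (Suc n) x) (at x within R)"
        using deriv_seq_subset[OF D R(1)] x by (simp add: deriv_seq_def)
      then have "(E n has_real_derivative D (Suc n) x) (at x within R)"
        by (rule has_real_derivative_cong_on[OF _ x]) (use Suc in auto)
      moreover have "(E n has_real_derivative E (Suc n) x) (at x within R)"
        using deriv_seq_subset[OF E R(2)] x by (simp add: deriv_seq_def)
      ultimately show "D (Suc n) x = E (Suc n) x"
        using lim[OF x] by (rule has_field_derivative_unique)
    qed
  qed (use eq in auto)
  then show ?thesis using x by blast
qed

lemma at_within_Ico_neq_bot: "x \<in> {a..<b} \<Longrightarrow> at x within {a..<b} \<noteq> bot" for x a b :: real
proof -
  assume x: "x \<in> {a..<b}"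
  have "at x within {x..<b} = at_right x"
    by (rule at_within_nhd[of _ "{x - 1<..<b}"]) (use x in auto)
  moreover have "at x within {x..<b} \<le> at x within {a..<b}"
    by (rule at_le) (use x in auto)
  ultimately show ?thesis using trivial_limit_at_right_real[of x] by (auto simp: bot_unique)
qed

text \<open>A smooth function on \<open>[0,a)\<close> that vanishes near \<open>a\<close> extends by zero to a smooth function on \<open>[0,\<infinity>)\<close>. It
suffices that the zeroth term vanishes near \<open>a\<close>, as the higher ones follow.\<close>

lemma deriv_seq_extend_by_zero:
  assumes D: "deriv_seq {0..<a} D" and z: "\<And>x. x \<in> {c<..<a} \<Longrightarrow> D 0 x = 0" and c: "0 \<le> c" "c < a"
  shows "deriv_seq {0..} (\<lambda>n x. if x < a then D n x else (0::real))"
  unfolding deriv_seq_def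
proof (intro allI ballI)
  fix n x assume x: "x \<in> {0::real..}"
  let ?E = "\<lambda>n x. if x < a then D n x else (0::real)"
  have zero: "?E n x = 0" if "c < x" for n x
  proof (cases "x < a")
    case True
    have "D n x = (\<lambda>_ _. 0) n x"
    proof (rule deriv_seq_unique[OF D, of UNIV])
      show "deriv_seq UNIV (\<lambda>_ _. 0)" by (simp add: deriv_seq_def)
      show "at x within {c<..<a} \<noteq> bot" if "x \<in> {c<..<a}" for x
        using at_within_open[OF that open_greaterThanLessThan] by simp
    qed (use z c True that in auto)
    then show ?thesis by simp
  qed simp
  show "(?E n has_real_derivative ?E (Suc n) x) (at x within {0..})"
  proof (cases "x < a")
    case True
    then have "(D n has_real_derivative D (Suc n) x) (at x within {0..<a})"
      using D x by (auto simp: deriv_seq_def)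
    then have "(?E n has_real_derivative D (Suc n) x) (at x within {0..<a})"
      by (rule has_real_derivative_cong_on) (use True x in auto)
    moreover have "at x within {0..<a} = at x within {0..}"
      by (rule at_within_nhd[of _ "{..<a}"]) (use True in auto)
    ultimately show ?thesis using True by simp
  next
    case False
    have "((\<lambda>_. 0) has_real_derivative ?E (Suc n) x) (at x)" using False by simp
    then have "(?E n has_real_derivative ?E (Suc n) x) (at x)"
      by (rule has_field_derivative_transform_within_open[where S = "{c<..}"]) (use zero False c in auto)
    then show ?thesis by (rule has_field_derivative_at_within)
  qed
qed

section \<open>Smooth bumps\<close>

text \<open>For \<open>\<epsilon> > 0\<close> these functions vanish to infinite order at \<open>0\<close>. The polynomial factor makes the family
closed under differentiation.\<close>

definition flat :: "real poly \<Rightarrow> real \<Rightarrow> real \<Rightarrow> real" where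
  "flat p \<epsilon> x = (if 0 < x then poly p (1 / x) * exp (- \<epsilon> / x) else 0)"

text \<open>In the variable \<open>u = 1/x\<close> this is the decay of \<open>u\<^sup>i exp(- \<epsilon> u)\<close> at infinity.\<close>

lemma flat_tendsto_0:
  assumes "\<epsilon> > 0"
  shows "(flat p \<epsilon> \<longlongrightarrow> 0) (at_right 0)"
proof -
  have 1: "((\<lambda>u. \<Sum>i\<le>degree p. (coeff p i / \<epsilon> ^ i) * ((\<epsilon> * u) ^ i / exp (\<epsilon> * u))) \<longlongrightarrow>
      (\<Sum>i\<le>degree p. (coeff p i / \<epsilon> ^ i) * 0)) at_top"
  proof (intro tendsto_sum tendsto_mult tendsto_const)
    fix i
    have "filterlim (\<lambda>u. \<epsilon> * u) at_top at_top"
      using assms by (intro filterlim_tendsto_pos_mult_at_top[OF tendsto_const] filterlim_ident)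
    then show "((\<lambda>u. (\<epsilon> * u) ^ i / exp (\<epsilon> * u)) \<longlongrightarrow> 0) at_top"
      by (rule filterlim_compose[OF tendsto_power_div_exp_0])
  qed
  have 2: "(\<lambda>u. \<Sum>i\<le>degree p. (coeff p i / \<epsilon> ^ i) * ((\<epsilon> * u) ^ i / exp (\<epsilon> * u)))
      = (\<lambda>u. poly p u * exp (- \<epsilon> * u))"
    using assms by (auto simp: poly_altdef power_mult_distrib exp_minus field_simps sum_divide_distrib intro!: ext sum.cong)
  have "((\<lambda>u. poly p u * exp (- \<epsilon> * u)) \<longlongrightarrow> 0) at_top"
    using 1 unfolding 2 by simp
  from filterlim_compose[OF this filterlim_inverse_at_top_right]
  show ?thesis
    by (rule Lim_transform_eventually)
      (auto simp: flat_def eventually_at_right_less divide_inverse intro!: eventually_mono[OF eventually_at_right_less])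
qed

text \<open>At \<open>0\<close> the difference quotient is again a member of the family, with \<open>p(u)\<close> replaced by \<open>u p(u)\<close>.\<close>

lemma flat_has_derivative:
  assumes "\<epsilon> > 0"
  shows "(flat p \<epsilon> has_real_derivative flat ([:0, 0, 1:] * (smult \<epsilon> p - pderiv p)) \<epsilon> x) (at x)"
proof -
  consider "x > 0" | "x < 0" | "x = 0" by linarith
  then show ?thesis
  proof cases
    case 1
    have "((\<lambda>x. poly p (1 / x) * exp (- \<epsilon> / x)) has_real_derivative
        flat ([:0, 0, 1:] * (smult \<epsilon> p - pderiv p)) \<epsilon> x) (at x)"
      using 1 unfolding flat_def
      by (auto intro!: derivative_eq_intros DERIV_chain2[OF poly_DERIV] simp: field_simps power2_eq_square)
    then show ?thesis
      by (rule has_field_derivative_transform_within_open[where S = "{0<..}"])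
        (use 1 in \<open>auto simp: flat_def\<close>)
  next
    case 2
    have "((\<lambda>x. 0) has_real_derivative flat ([:0, 0, 1:] * (smult \<epsilon> p - pderiv p)) \<epsilon> x) (at x)"
      using 2 unfolding flat_def by simp
    then show ?thesis
      by (rule has_field_derivative_transform_within_open[where S = "{..<0}"])
        (use 2 in \<open>auto simp: flat_def\<close>)
  next
    case 3
    have "((\<lambda>x. (flat p \<epsilon> x - flat p \<epsilon> 0) / (x - 0)) \<longlongrightarrow> 0) (at 0)"
    proof (rule filterlim_split_at)
      show "((\<lambda>x. (flat p \<epsilon> x - flat p \<epsilon> 0) / (x - 0)) \<longlongrightarrow> 0) (at_left 0)"
        by (rule tendsto_eventually) (auto simp: flat_def intro!: eventually_at_leftI[of "-1"])
      show "((\<lambda>x. (flat p \<epsilon> x - flat p \<epsilon> 0) / (x - 0)) \<longlongrightarrow> 0) (at_right 0)"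
        by (rule Lim_transform_eventually[OF flat_tendsto_0[OF assms, of "[:0, 1:] * p"]])
          (auto simp: flat_def intro!: eventually_mono[OF eventually_at_right_less])
    qed
    then show ?thesis using 3 by (simp add: has_field_derivative_iff flat_def)
  qed
qed

lemma smooth1_flat:
  assumes "\<epsilon> > 0"
  shows "smooth1 UNIV (flat p \<epsilon>)"
  by (rule smooth1_coinduct[where F = "range (\<lambda>p. flat p \<epsilon>)"]) (auto intro!: flat_has_derivative assms)

text \<open>For \<open>\<epsilon> > 0\<close> a smooth function that is positive exactly on \<open>(a,b)\<close>. The parameter \<open>\<epsilon>\<close> controls its
steepness: for \<open>\<epsilon> \<rightarrow> 0\<close> the bump increases to the indicator function of \<open>(a,b)\<close>.\<close>

definition bump :: "real \<Rightarrow> real \<Rightarrow> real \<Rightarrow> real \<Rightarrow> real" where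
  "bump \<epsilon> a b x = flat 1 \<epsilon> (x - a) * flat 1 \<epsilon> (b - x)"

lemma smooth1_bump:
  assumes "\<epsilon> > 0"
  shows "smooth1 UNIV (bump \<epsilon> a b)"
proof -
  have "smooth1 UNIV (\<lambda>x. flat 1 \<epsilon> (1 * x + - a) * flat 1 \<epsilon> (- 1 * x + b))"
    by (intro smooth1_mult smooth1_affine smooth1_flat assms)
  moreover have "bump \<epsilon> a b = (\<lambda>x. flat 1 \<epsilon> (1 * x + - a) * flat 1 \<epsilon> (- 1 * x + b))"
    by (simp add: bump_def fun_eq_iff)
  ultimately show ?thesis by simp
qed

lemma bump_nonneg: "0 \<le> bump \<epsilon> a b x"
  by (simp add: bump_def flat_def)

lemma bump_le_1: "\<epsilon> > 0 \<Longrightarrow> bump \<epsilon> a b x \<le> 1"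
  by (auto simp: bump_def flat_def intro!: mult_le_one)

lemma bump_eq_0: "x \<notin> {a<..<b} \<Longrightarrow> bump \<epsilon> a b x = 0"
  by (auto simp: bump_def flat_def)

lemma bump_pos: "x \<in> {a<..<b} \<Longrightarrow> 0 < bump \<epsilon> a b x"
  by (auto simp: bump_def flat_def)

lemma bump_tendsto_indicator:
  "(\<lambda>n. bump (1 / Suc n) a b x) \<longlonglongrightarrow> indicator {a<..<b} x"
proof (cases "x \<in> {a<..<b}")
  case True
  have "(\<lambda>n. exp (- (1 / Suc n) / (x - a)) * exp (- (1 / Suc n) / (b - x))) \<longlonglongrightarrow>
      exp (- 0 / (x - a)) * exp (- 0 / (b - x))"
    by (intro tendsto_intros LIMSEQ_Suc[OF lim_1_over_n]) (use True in auto)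
  then show ?thesis using True by (simp add: bump_def flat_def)
qed (simp add: bump_eq_0)

lemma continuous_primitive:
  fixes f :: "real \<Rightarrow> real"
  assumes "continuous_on UNIV f"
  obtains F where "F c = 0" "\<And>x. (F has_real_derivative f x) (at x)"
proof -
  obtain F where "\<And>x. (F has_vector_derivative f x) (at x)"
    using einterval_antiderivative[of "-\<infinity>" "\<infinity>" f] assms
    by (auto simp: continuous_on_eq_continuous_at)
  then have "((\<lambda>x. F x - F c) has_real_derivative f x) (at x)" for x
    by (auto simp: has_real_derivative_iff_has_vector_derivative intro!: derivative_eq_intros)
  then show ?thesis using that[of "\<lambda>x. F x - F c"] by simp
qed

lemma primitive_const_right:
  assumes "\<And>x. (F has_real_derivative f x) (at x)" "\<And>x. x > b \<Longrightarrow> f x = 0" "x \<ge> b"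
  shows "F x = (F b :: real)"
proof (cases "x = b")
  case False
  have z: "(F has_real_derivative 0) (at y)" if "y > b" for y
    using assms(1)[of y] assms(2)[OF that] by simp
  have "continuous_on {b..x} F"
    by (rule DERIV_continuous_on[where D = f]) (rule has_field_derivative_at_within[OF assms(1)])
  then show ?thesis
    using DERIV_isconst2[of b x F x] z assms(3) False by auto
qed simp

lemma primitive_const_left:
  assumes "\<And>x. (F has_real_derivative f x) (at x)" "\<And>x. x < a \<Longrightarrow> f x = 0" "x \<le> a"
  shows "F x = (F a :: real)"
proof (cases "x = a")
  case False
  have z: "(F has_real_derivative 0) (at y)" if "y < a" for y
    using assms(1)[of y] assms(2)[OF that] by simp
  have "continuous_on {x..a} F"
    by (rule DERIV_continuous_on[where D = f]) (rule has_field_derivative_at_within[OF assms(1)])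
  then show ?thesis
    using DERIV_isconst2[of x a F a] z assms(3) False by auto
qed simp

text \<open>The normalised primitive of a bump.\<close>

lemma smooth_step:
  fixes a b :: real
  assumes "a < b"
  obtains h where "smooth1 UNIV h" "\<And>x. x \<le> a \<Longrightarrow> h x = 0" "\<And>x. x \<ge> b \<Longrightarrow> h x = 1"
proof -
  have sm: "smooth1 UNIV (bump 1 a b)" by (rule smooth1_bump) simp
  obtain F where F: "F a = 0" "\<And>x. (F has_real_derivative bump 1 a b x) (at x)"
    using continuous_primitive[OF smooth1_continuous_on[OF sm]] by blast
  have "F a < F b"
  proof (rule DERIV_pos_imp_increasing_open[OF assms])
    show "\<exists>y. (F has_real_derivative y) (at x) \<and> 0 < y" if "a < x" "x < b" for x
      using F(2) bump_pos[of x a b] that by auto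
    show "continuous_on {a..b} F"
      by (rule DERIV_continuous_on[where D = "bump 1 a b"]) (rule has_field_derivative_at_within[OF F(2)])
  qed
  then have pos: "F b > 0" using F by simp
  have "smooth1 UNIV F" using smooth1_primitive[OF sm] F(2) by auto
  then have "smooth1 UNIV (\<lambda>x. (1 / F b) * F x)" by (intro smooth1_mult smooth1_const)
  moreover have "(1 / F b) * F x = 0" if "x \<le> a" for x
    using primitive_const_left[OF F(2) _ that] F(1) by (simp add: bump_eq_0)
  moreover have "(1 / F b) * F x = 1" if "x \<ge> b" for x
    using primitive_const_right[OF F(2) _ that] pos by (simp add: bump_eq_0)
  ultimately show ?thesis using that by blast
qed

section \<open>Bumps are total in the space of controls\<close>

lemma space_F_measure [simp]: "space (F_measure T) = {0..T}"
  by (simp add: F_measure_def space_restrict_space)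

lemma sets_F_measure: "A \<in> sets (F_measure T) \<longleftrightarrow> A \<in> sets borel \<and> A \<subseteq> {0..T}"
  by (auto simp: F_measure_def sets_restrict_space_iff)

lemma finite_measure_F: "finite_measure (F_measure T)"
  unfolding F_measure_def
  by (rule finite_measureI) (simp add: space_restrict_space emeasure_restrict_space emeasure_lborel_Icc_eq)

lemma integral_F_measure:
  "(LINT s|F_measure T. f s) = (LBINT s:{0..T}. (f s :: real))"
  unfolding F_measure_def set_lebesgue_integral_def by (subst integral_restrict_space) auto

lemma borel_measurable_F_measure:
  "f \<in> borel_measurable borel \<Longrightarrow> f \<in> borel_measurable (F_measure T)"
  unfolding F_measure_def by (rule measurable_restrict_space1) simp

lemma L2_F_bounded:
  fixes f :: "real \<Rightarrow> real"
  assumes "f \<in> borel_measurable borel" "\<And>x. x \<in> {0..T} \<Longrightarrow> \<bar>f x\<bar> \<le> B"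
  shows "f \<in> L2 (F_measure T)"
  using assms by (intro L2_bounded[where B = B] finite_measure_F borel_measurable_F_measure) auto

lemma continuous_on_L2_F:
  fixes h :: "real \<Rightarrow> real"
  assumes h: "continuous_on {0..T} h"
  shows "h \<in> L2 (F_measure T)"
proof -
  have "h \<in> borel_measurable (F_measure T)"
    using borel_measurable_continuous_on_restrict[OF h]
    unfolding F_measure_def by (simp cong: measurable_cong_sets add: sets_restrict_space)
  moreover obtain B where "0 \<le> B" "\<And>x. x \<in> {0..T} \<Longrightarrow> norm (h x) \<le> B"
    by (rule continuous_on_compact_bound[OF compact_Icc h]) (blast intro: that)
  ultimately show ?thesis by (intro L2_bounded[where B = B] finite_measure_F) auto
qed

lemma FTC_set_integral:
  fixes F f :: "real \<Rightarrow> real"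
  assumes "a \<le> b" "\<And>x. x \<in> {a..b} \<Longrightarrow> (F has_real_derivative f x) (at x within {a..b})"
    and "continuous_on {a..b} f"
  shows "(LBINT x:{a..b}. f x) = F b - F a"
  unfolding set_lebesgue_integral_def
  using assms by (intro integral_FTC_Icc) (auto simp: has_real_derivative_iff_has_vector_derivative)

lemma AE_F_measure_interior: "AE s in F_measure T. s \<in> {0<..<T}"
proof -
  have "AE s in lborel. s \<in> {0..T} \<longrightarrow> s \<in> {0<..<T}"
    using AE_lborel_singleton[of 0] AE_lborel_singleton[of T] by eventually_elim auto
  then show ?thesis
    unfolding F_measure_def by (subst AE_restrict_space_iff) auto
qed

lemma L2_dominated_convergence:
  assumes F: "\<And>n. F n \<in> L2 M" and f: "f \<in> L2 M" and w: "integrable M w"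
    and lim: "AE x in M. (\<lambda>n. F n x) \<longlonglongrightarrow> f x"
    and bound: "\<And>n. AE x in M. (F n x - f x)\<^sup>2 \<le> w x"
  shows "(\<lambda>n. L2_inner M (\<lambda>x. F n x - f x) (\<lambda>x. F n x - f x)) \<longlonglongrightarrow> 0"
proof -
  have "(\<lambda>n. LINT x|M. (F n x - f x)\<^sup>2) \<longlonglongrightarrow> (LINT x|M. 0)"
  proof (rule integral_dominated_convergence[where w = w])
    show "AE x in M. (\<lambda>n. (F n x - f x)\<^sup>2) \<longlonglongrightarrow> 0"
      using lim
    proof eventually_elim
      case (elim x)
      then have "(\<lambda>n. (F n x - f x)\<^sup>2) \<longlonglongrightarrow> (f x - f x)\<^sup>2" by (intro tendsto_intros)
      then show ?case by simp
    qed
    show "(\<lambda>x. (F n x - f x)\<^sup>2) \<in> borel_measurable M" for n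
      using L2_measurable[OF L2_diff[OF F f]] by (rule borel_measurable_power)
  qed (use w bound in auto)
  then show ?thesis by (simp add: L2_inner_def power2_eq_square)
qed

lemma bump_measurable [measurable]: "bump \<epsilon> a b \<in> borel_measurable borel"
  unfolding bump_def[abs_def] flat_def poly_1 by measurable

lemma bump_L2: "\<epsilon> > 0 \<Longrightarrow> bump \<epsilon> a b \<in> L2 (F_measure T)"
  by (rule L2_F_bounded[where B = 1]) (auto simp: abs_of_nonneg bump_nonneg bump_le_1)

text \<open>Bumps are total: a closed subspace \<open>P\<close> that contains all bumps supported inside \<open>(0,T)\<close> is the whole
space. Letting \<open>\<epsilon> \<rightarrow> 0\<close> puts the indicator functions of intervals into \<open>P\<close>; those of all Borel sets
follow by Dynkin's \<open>\<pi>\<close>-\<open>\<lambda>\<close> argument, then simple functions by linearity, and finally all of \<open>L\<^sub>2\<close> by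
dominated convergence.\<close>

lemma L2_F_closed_subspace_induct:
  assumes f: "f \<in> L2 (F_measure T)" and T: "T > 0"
    and bump: "\<And>\<epsilon> a b. 0 < \<epsilon> \<Longrightarrow> 0 < a \<Longrightarrow> a < b \<Longrightarrow> b < T \<Longrightarrow> P (bump \<epsilon> a b)"
    and lincomb: "\<And>f g a b. f \<in> L2 (F_measure T) \<Longrightarrow> g \<in> L2 (F_measure T) \<Longrightarrow> P f \<Longrightarrow> P g
      \<Longrightarrow> P (\<lambda>x. a * f x + b * g x)"
    and limit: "\<And>F f. (\<And>n. F n \<in> L2 (F_measure T)) \<Longrightarrow> f \<in> L2 (F_measure T) \<Longrightarrow> (\<And>n. P (F n)) \<Longrightarrow>
      (\<lambda>n. L2_inner (F_measure T) (\<lambda>x. F n x - f x) (\<lambda>x. F n x - f x)) \<longlonglongrightarrow> 0 \<Longrightarrow> P f"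
  shows "P f"
proof -
  interpret finite_measure "F_measure T" by (rule finite_measure_F)
  have limit1: "P f" if "\<And>n. F n \<in> borel_measurable borel" "f \<in> borel_measurable borel"
    "\<And>n x. \<bar>F n x\<bar> \<le> 1" "\<And>x. \<bar>f x\<bar> \<le> 1" "\<And>n. P (F n)"
    "\<And>x. x \<in> {0<..<T} \<Longrightarrow> (\<lambda>n. F n x) \<longlonglongrightarrow> f x" for F and f :: "real \<Rightarrow> real"
  proof (rule limit[of F])
    have FL: "F n \<in> L2 (F_measure T)" for n using that by (intro L2_F_bounded[where B = 1]) auto
    have fL: "f \<in> L2 (F_measure T)" using that by (intro L2_F_bounded[where B = 1]) auto
    show "F n \<in> L2 (F_measure T)" "f \<in> L2 (F_measure T)" "P (F n)" for n
      using FL fL that by auto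
    show "(\<lambda>n. L2_inner (F_measure T) (\<lambda>x. F n x - f x) (\<lambda>x. F n x - f x)) \<longlonglongrightarrow> 0"
    proof (rule L2_dominated_convergence[OF FL fL, where w = "\<lambda>_. 4"])
      show "AE x in F_measure T. (\<lambda>n. F n x) \<longlonglongrightarrow> f x"
        using AE_F_measure_interior by eventually_elim (use that in auto)
      show "AE x in F_measure T. (F n x - f x)\<^sup>2 \<le> 4" for n
      proof (rule AE_I2)
        fix x
        have "\<bar>F n x - f x\<bar> \<le> 2" using that(3)[of n x] that(4)[of x] by linarith
        then have "\<bar>F n x - f x\<bar>\<^sup>2 \<le> 2\<^sup>2" by (intro power_mono) auto
        then show "(F n x - f x)\<^sup>2 \<le> 4" by simp
      qed
    qed simp
  qed
  have L2_ind: "indicator A \<in> L2 (F_measure T)" if "A \<in> sets borel" for A :: "real set"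
    using that by (intro L2_F_bounded[where B = 1]) (auto simp: indicator_def)
  have zero: "P (\<lambda>_. 0)"
    using lincomb[of "bump 1 (T/3) (T/2)" "bump 1 (T/3) (T/2)" 0 0] T by (simp add: bump_L2 bump)
  have P_empty: "P (indicator {})"
    using zero by (simp add: indicator_def[abs_def])
  have inner_interval: "P (indicator {a<..<b})" if "0 < a" "a < b" "b < T" for a b
  proof (rule limit1[of "\<lambda>n. bump (1 / Suc n) a b"])
    show "(\<lambda>n. bump (1 / Suc n) a b x) \<longlonglongrightarrow> indicator {a<..<b} x" for x
      by (rule bump_tendsto_indicator)
    show "P (bump (1 / Suc n) a b)" for n using that by (intro bump) auto
  qed (auto simp: indicator_def abs_of_nonneg bump_nonneg bump_le_1)
  \<comment> \<open>arbitrary intervals are approximated from inside \<open>(0,T)\<close>\<close>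
  have interval: "P (indicator {a<..<b})" for a b
  proof (rule limit1[of "\<lambda>n. indicator {max a (T / (Suc n)) <..< min b (T - T / (Suc n))}"])
    fix n
    define e where "e = T / real (Suc n)"
    have e: "e > 0" using T by (simp add: e_def)
    have "P (indicator {max a e <..< min b (T - e)})"
    proof (cases "max a e < min b (T - e)")
      case True
      then show ?thesis using e by (intro inner_interval) (auto simp: less_max_iff_disj min_less_iff_disj)
    next
      case False
      then have "{max a e <..< min b (T - e)} = {}"
        by (subst greaterThanLessThan_empty_iff) linarith
      then show ?thesis using P_empty by simp
    qed
    then show "P (indicator {max a (T / (Suc n)) <..< min b (T - T / (Suc n))})"
      by (simp add: e_def)
  next
    fix x assume x: "x \<in> {0<..<T}"
    have "(\<lambda>n. T / real (Suc n)) \<longlonglongrightarrow> 0"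
      using LIMSEQ_Suc[OF lim_const_over_n[of T]] by simp
    moreover have "min x (T - x) > 0" using x by auto
    ultimately have "\<forall>\<^sub>F n in sequentially. T / real (Suc n) < min x (T - x)"
      by (rule order_tendstoD)
    then have "\<forall>\<^sub>F n in sequentially. indicator {max a (T / (Suc n)) <..< min b (T - T / (Suc n))} x = (indicator {a<..<b} x :: real)"
      by eventually_elim (auto simp: indicator_def)
    then show "(\<lambda>n. indicator {max a (T / (Suc n)) <..< min b (T - T / (Suc n))} x :: real) \<longlonglongrightarrow> indicator {a<..<b} x"
      by (rule tendsto_eventually)
  qed (auto simp: indicator_def)
  have sum: "finite I \<Longrightarrow> (\<And>i. i \<in> I \<Longrightarrow> g i \<in> L2 (F_measure T) \<and> P (g i)) \<Longrightarrow>
      (\<lambda>x. \<Sum>i\<in>I. c i * g i x) \<in> L2 (F_measure T) \<and> P (\<lambda>x. \<Sum>i\<in>I. c i * g i x)" for I :: "'z set" and g c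
  proof (induction I rule: finite_induct)
    case empty
    then show ?case using zero L2_F_bounded[of "\<lambda>_. 0" T 0] by simp
  next
    case (insert i I)
    then show ?case
      using lincomb[of "g i" "\<lambda>x. \<Sum>i\<in>I. c i * g i x" "c i" 1]
        L2_lincomb[of "g i" "F_measure T" "\<lambda>x. \<Sum>i\<in>I. c i * g i x" "c i" 1] by simp
  qed
  have indicator: "P (indicator A)" if "A \<in> sets borel" for A
  proof -
    define G where "G = range (\<lambda>(a, b). {a<..<b::real})"
    have Int: "Int_stable G"
    proof (rule Int_stableI)
      fix A B assume "A \<in> G" "B \<in> G"
      then obtain a b c d where "A = {a<..<b}" "B = {c<..<d}" by (auto simp: G_def)
      then have "A \<inter> B = (\<lambda>(a, b). {a<..<b}) (max a c, min b d)" by auto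
      then show "A \<inter> B \<in> G" unfolding G_def by blast
    qed
    have borel: "sigma_sets UNIV G = sets borel"
      unfolding borel_eq_box G_def by (simp add: case_prod_beta)
    have "G \<subseteq> Pow UNIV" "A \<in> sigma_sets UNIV G" using that borel by auto
    with Int show ?thesis
    proof (induction A rule: sigma_sets_induct_disjoint)
      case (basic A)
      then show ?case using interval by (auto simp: G_def)
    next
      case empty
      then show ?case by (rule P_empty)
    next
      case (compl A)
      then have A: "A \<in> sets borel" using borel by simp
      have one: "P (\<lambda>_. 1)"
        by (rule limit1[of "\<lambda>_. indicator {-1<..<T+1}"]) (use interval T in \<open>auto simp: indicator_def\<close>)
      have "P (\<lambda>x. 1 * 1 + (-1) * indicator A x)"
        by (intro lincomb[of "\<lambda>_. 1" "indicator A" 1 "-1"] compl one L2_ind A L2_F_bounded[where B = 1]) auto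
      moreover have "(\<lambda>x. 1 * 1 + (-1) * indicator A x :: real) = indicator (UNIV - A)"
        by (auto simp: indicator_def)
      ultimately show ?case by simp
    next
      case (union A)
      then have A: "A n \<in> sets borel" for n using borel by auto
      show ?case
      proof (rule limit1[of "\<lambda>n x. \<Sum>i<n. 1 * indicator (A i) x"])
        have eq: "(\<Sum>i<n. indicator (A i) x) = (indicator (\<Union>i<n. A i) x :: real)" for n x
          using union(1) by (subst indicator_UN_disjoint) (auto intro: disjoint_family_on_mono)
        show "P (\<lambda>x. \<Sum>i<n. 1 * indicator (A i) x)" for n
          using sum[of "{..<n}" "\<lambda>i. indicator (A i)" "\<lambda>_. 1"] union(3) L2_ind[OF A] by blast
        show "\<bar>\<Sum>i<n. 1 * indicator (A i) x\<bar> \<le> (1::real)" for n x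
          by (simp add: eq)
        show "(\<lambda>n. \<Sum>i<n. 1 * indicator (A i) x) \<longlonglongrightarrow> (indicator (\<Union>i. A i) x :: real)" for x
          using LIMSEQ_indicator_UN[of A x] by (simp add: eq)
      qed (use A in \<open>auto simp: indicator_def\<close>)
    qed
  qed
  have [measurable]: "f \<in> borel_measurable (F_measure T)" using f by (rule L2_measurable)
  obtain F where F': "\<forall>i. simple_function (F_measure T) (F i)"
    "\<forall>x\<in>{0..T}. (\<lambda>i. F i x) \<longlonglongrightarrow> f x"
    "\<forall>i. \<forall>x\<in>{0..T}. \<bar>F i x\<bar> \<le> 2 * \<bar>f x\<bar>"
    using borel_measurable_implies_sequence_metric[of f "F_measure T" 0]
    by (auto simp del: atLeastAtMost_iff)
  then have F: "simple_function (F_measure T) (F i)"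
    "x \<in> {0..T} \<Longrightarrow> (\<lambda>i. F i x) \<longlonglongrightarrow> f x"
    "x \<in> {0..T} \<Longrightarrow> \<bar>F i x\<bar> \<le> 2 * \<bar>f x\<bar>" for i x
    by blast+
  \<comment> \<open>\<open>F i\<close> as a combination of indicator functions; it agrees with \<open>F i\<close> on \<open>[0,T]\<close> only\<close>
  define G where "G i x = (\<Sum>v\<in>F i ` {0..T}. v * indicator (F i -` {v} \<inter> {0..T}) x)" for i x
  have G: "G i \<in> L2 (F_measure T) \<and> P (G i)" for i
    unfolding G_def
  proof (rule sum)
    show "finite (F i ` {0..T})" using F(1)[of i] by (simp add: simple_function_def)
    fix v
    have "F i -` {v} \<inter> {0..T} \<in> sets (F_measure T)"
      using simple_functionD(2)[OF F(1), of i "{v}"] by simp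
    then have "F i -` {v} \<inter> {0..T} \<in> sets borel" by (simp add: sets_F_measure)
    then show "indicator (F i -` {v} \<inter> {0..T}) \<in> L2 (F_measure T) \<and> P (indicator (F i -` {v} \<inter> {0..T}))"
      using L2_ind indicator by blast
  qed
  have GF: "G i x = F i x" if "x \<in> {0..T}" for i x
  proof -
    have "G i x = (\<Sum>v\<in>F i ` {0..T}. if v = F i x then v else 0)"
      unfolding G_def using that by (intro sum.cong) (auto simp: indicator_def)
    also have "\<dots> = F i x"
      using F(1)[of i] that by (subst sum.delta) (auto simp: simple_function_def)
    finally show ?thesis .
  qed
  show "P f"
  proof (rule limit[of G])
    have "integrable (F_measure T) (\<lambda>x. 9 * (f x)\<^sup>2)" using f by (auto simp: L2_def)
    moreover have "AE x in F_measure T. (\<lambda>n. G n x) \<longlonglongrightarrow> f x"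
      by (rule AE_I2) (simp add: GF F(2))
    moreover have "AE x in F_measure T. (G n x - f x)\<^sup>2 \<le> 9 * (f x)\<^sup>2" for n
    proof (rule AE_I2)
      fix x assume "x \<in> space (F_measure T)"
      then have "\<bar>G n x - f x\<bar> \<le> 3 * \<bar>f x\<bar>" using F(3)[of x n] GF[of x n] by auto
      then have "\<bar>G n x - f x\<bar>\<^sup>2 \<le> (3 * \<bar>f x\<bar>)\<^sup>2" by (intro power_mono) auto
      then show "(G n x - f x)\<^sup>2 \<le> 9 * (f x)\<^sup>2" by (simp add: power_mult_distrib)
    qed
    ultimately show "(\<lambda>n. L2_inner (F_measure T) (\<lambda>x. G n x - f x) (\<lambda>x. G n x - f x)) \<longlonglongrightarrow> 0"
      by (intro L2_dominated_convergence[where w = "\<lambda>x. 9 * (f x)\<^sup>2"]) (use G f in auto)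
  qed (use G f in auto)
qed

lemma L2_bounded_linear_unique:
  assumes A: "L2_bounded_linear (F_measure T) M A" and B: "L2_bounded_linear (F_measure T) M B"
    and T: "T > 0" and f: "f \<in> L2 (F_measure T)"
    and agree: "\<And>\<epsilon> a b. 0 < \<epsilon> \<Longrightarrow> 0 < a \<Longrightarrow> a < b \<Longrightarrow> b < T \<Longrightarrow> L2_eq M (A (bump \<epsilon> a b)) (B (bump \<epsilon> a b))"
  shows "L2_eq M (A f) (B f)"
proof (rule L2_F_closed_subspace_induct[where P = "\<lambda>f. L2_eq M (A f) (B f)", OF f T])
  fix f g a b
  assume lincomb: "f \<in> L2 (F_measure T)" "g \<in> L2 (F_measure T)" "L2_eq M (A f) (B f)" "L2_eq M (A g) (B g)"
  have "L2_eq M (A (\<lambda>x. a * f x + b * g x)) (\<lambda>x. a * A f x + b * A g x)"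
    "L2_eq M (B (\<lambda>x. a * f x + b * g x)) (\<lambda>x. a * B f x + b * B g x)"
    using L2_bounded_linear_lincomb[OF A lincomb(1,2)] L2_bounded_linear_lincomb[OF B lincomb(1,2)] by blast+
  with lincomb(3,4) show "L2_eq M (A (\<lambda>x. a * f x + b * g x)) (B (\<lambda>x. a * f x + b * g x))"
    unfolding L2_eq_def by eventually_elim simp
next
  fix F f
  assume limit: "\<And>n. F n \<in> L2 (F_measure T)" "f \<in> L2 (F_measure T)" "\<And>n. L2_eq M (A (F n)) (B (F n))"
    "(\<lambda>n. L2_inner (F_measure T) (\<lambda>x. F n x - f x) (\<lambda>x. F n x - f x)) \<longlonglongrightarrow> 0"
  let ?AF = "\<lambda>n x. A (F n) x - A f x" and ?BF = "\<lambda>n x. B (F n) x - B f x" and ?d = "\<lambda>x. A f x - B f x"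
  have L: "A (F n) \<in> L2 M" "A f \<in> L2 M" "B (F n) \<in> L2 M" "B f \<in> L2 M" for n
    by (rule L2_bounded_linear_L2[OF A limit(1)] L2_bounded_linear_L2[OF A limit(2)]
        L2_bounded_linear_L2[OF B limit(1)] L2_bounded_linear_L2[OF B limit(2)])+
  have "(\<lambda>n. 2 * L2_inner M (?BF n) (?BF n) + 2 * L2_inner M (\<lambda>x. - ?AF n x) (\<lambda>x. - ?AF n x)) \<longlonglongrightarrow> 2 * 0 + 2 * 0"
    using L2_bounded_linear_tendsto[OF A limit(1,2,4)] L2_bounded_linear_tendsto[OF B limit(1,2,4)]
    unfolding L2_inner_def minus_mult_minus by (intro tendsto_intros)
  moreover have "L2_inner M ?d ?d \<le> 2 * L2_inner M (?BF n) (?BF n) + 2 * L2_inner M (\<lambda>x. - ?AF n x) (\<lambda>x. - ?AF n x)" for n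
  proof -
    have AL: "(\<lambda>x. - ?AF n x) \<in> L2 M" using L2_scale[OF L2_diff[OF L(1,2)], of "-1" n] by simp
    have "L2_inner M ?d ?d = L2_inner M (\<lambda>x. ?BF n x + - ?AF n x) (\<lambda>x. ?BF n x + - ?AF n x)"
    proof (intro L2_inner_cong)
      show "L2_eq M ?d (\<lambda>x. ?BF n x + - ?AF n x)" "L2_eq M ?d (\<lambda>x. ?BF n x + - ?AF n x)"
        using limit(3)[of n] unfolding L2_eq_def by (auto elim: eventually_mono)
    qed (intro L2_diff L2_add L AL)+
    also have "\<dots> \<le> 2 * L2_inner M (?BF n) (?BF n) + 2 * L2_inner M (\<lambda>x. - ?AF n x) (\<lambda>x. - ?AF n x)"
      by (intro L2_norm_add_bound L2_diff L AL)
    finally show ?thesis .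
  qed
  ultimately have "L2_inner M ?d ?d \<le> 2 * 0 + 2 * 0"
    by (intro LIMSEQ_le_const) auto
  then have "L2_inner M ?d ?d = 0" using L2_inner_self_nonneg[of M ?d] by simp
  then show "L2_eq M (A f) (B f)" using L2_eq_iff_norm_diff[OF L(2,4)] by simp
qed (rule agree)

text \<open>Bumps lie in the domain on which \<open>W d/dt\<close> is given by the control operator.\<close>

lemma bump_derivative:
  assumes "\<epsilon> > 0" "0 \<le> a"
  obtains g where "smooth1 UNIV g" "\<And>x. (bump \<epsilon> a b has_real_derivative g x) (at x)"
    "has_H1_derivative T (bump \<epsilon> a b) g" "bump \<epsilon> a b 0 = 0"
proof -
  obtain g where g: "smooth1 UNIV g" "\<And>x. (bump \<epsilon> a b has_real_derivative g x) (at x)"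
    using smooth1_deriv[OF smooth1_bump[OF assms(1)]] by (metis UNIV_I)
  have cont: "continuous_on S g" for S
    using smooth1_continuous_on[OF g(1)] by (rule continuous_on_subset) simp
  have "g \<in> L2 (F_measure T)" by (rule continuous_on_L2_F[OF cont])
  moreover have "(LBINT s:{0..t}. g s) = bump \<epsilon> a b t - bump \<epsilon> a b 0" if "t \<in> {0..T}" for t
    by (rule FTC_set_integral[OF _ has_field_derivative_at_within[OF g(2)] cont]) (use that in auto)
  ultimately have "has_H1_derivative T (bump \<epsilon> a b) g" by (simp add: has_H1_derivative_def)
  with g show ?thesis using bump_eq_0[of 0 a b \<epsilon>] assms that by simp
qed

section \<open>Volterra equations of the second kind\<close>

text \<open>Causality, \<open>\<kappa>(s,\<sigma>) = 0\<close> for \<open>\<sigma> > s\<close>, is what distinguishes Volterra from Fredholm kernels and makes the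
Neumann series converge without any smallness of the kernel.\<close>

locale volterra_kernel = bounded_kernel "F_measure T" "F_measure T" \<kappa> B for T \<kappa> B +
  assumes T_pos: "0 < T"
    and causal: "\<And>s \<sigma>. s \<in> {0..T} \<Longrightarrow> \<sigma> \<in> {0..T} \<Longrightarrow> s < \<sigma> \<Longrightarrow> \<kappa> s \<sigma> = 0"
begin

definition volterra :: "(real \<Rightarrow> real) \<Rightarrow> real \<Rightarrow> real" where
  "volterra f s = (LINT \<sigma>|F_measure T. \<kappa> s \<sigma> * f \<sigma>)"

lemma B_nonneg: "0 \<le> B"
  using kernel_bound[of 0 0] T_pos by simp

lemma volterra_measurable: "f \<in> borel_measurable (F_measure T) \<Longrightarrow> volterra f \<in> borel_measurable (F_measure T)"
  using apply_measurable by (simp add: volterra_def[abs_def])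

lemma volterra_bounded: "f \<in> L2 (F_measure T) \<Longrightarrow> \<exists>C. \<forall>s\<in>{0..T}. \<bar>volterra f s\<bar> \<le> C"
  using apply_bounded[of f] by (simp add: volterra_def)

text \<open>Integrating \<open>\<sigma>\<^sup>n / n!\<close> over \<open>[0,s]\<close>: each application of the operator raises \<open>n\<close> by one.\<close>

lemma volterra_iterate_bound:
  assumes f: "f \<in> borel_measurable (F_measure T)" "f \<in> L2 (F_measure T)"
    and bound: "\<And>\<sigma>. \<sigma> \<in> {0..T} \<Longrightarrow> \<bar>f \<sigma>\<bar> \<le> C * ((B * \<sigma>) ^ n / fact n)"
    and s: "s \<in> {0..T}"
  shows "\<bar>volterra f s\<bar> \<le> C * ((B * s) ^ Suc n / fact (Suc n))"
proof -
  let ?g = "\<lambda>\<sigma>. (C * B ^ Suc n / fact n) * (\<sigma> ^ n * indicator {0..s} \<sigma>)"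
  have g: "integrable (F_measure T) ?g"
  proof (rule L2_integrable[OF finite_measure_F L2_F_bounded])
    fix \<sigma> assume "\<sigma> \<in> {0..T}"
    then have "\<bar>\<sigma> ^ n * indicator {0..s} \<sigma>\<bar> \<le> T ^ n"
      by (auto simp: indicator_def power_mono)
    then show "\<bar>?g \<sigma>\<bar> \<le> \<bar>C * B ^ Suc n / fact n\<bar> * T ^ n"
      unfolding abs_mult[of "C * B ^ Suc n / fact n"] by (intro mult_left_mono) auto
  qed measurable
  have "\<bar>volterra f s\<bar> \<le> (LINT \<sigma>|F_measure T. norm (\<kappa> s \<sigma> * f \<sigma>))"
    unfolding volterra_def using integral_norm_bound[of "F_measure T" "\<lambda>\<sigma>. \<kappa> s \<sigma> * f \<sigma>"] by simp
  also have "\<dots> \<le> (LINT \<sigma>|F_measure T. ?g \<sigma>)"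
  proof (rule integral_mono)
    show "integrable (F_measure T) (\<lambda>\<sigma>. norm (\<kappa> s \<sigma> * f \<sigma>))"
      using section_integrable[OF _ f(2)] s by (intro integrable_norm) simp
    fix \<sigma> assume "\<sigma> \<in> space (F_measure T)"
    then have \<sigma>: "\<sigma> \<in> {0..T}" by simp
    show "norm (\<kappa> s \<sigma> * f \<sigma>) \<le> ?g \<sigma>"
    proof (cases "\<sigma> \<le> s")
      case True
      have "\<bar>\<kappa> s \<sigma>\<bar> * \<bar>f \<sigma>\<bar> \<le> B * (C * ((B * \<sigma>) ^ n / fact n))"
        using kernel_bound[of s \<sigma>] bound[OF \<sigma>] s \<sigma> B_nonneg by (intro mult_mono) auto
      then show ?thesis using True \<sigma> by (simp add: abs_mult power_mult_distrib mult_ac)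
    next
      case False
      then show ?thesis using causal[OF s \<sigma>] by simp
    qed
  qed (rule g)
  also have "(LINT \<sigma>|F_measure T. ?g \<sigma>) = (LBINT \<sigma>. (C * B ^ Suc n / fact n) * (\<sigma> ^ n * indicator {0..s} \<sigma>))"
    unfolding integral_F_measure set_lebesgue_integral_def
    using s by (intro Bochner_Integration.integral_cong) (auto simp: indicator_def)
  also have "\<dots> = (C * B ^ Suc n / fact n) * (s ^ Suc n / Suc n)"
    using s by (simp add: integral_power)
  also have "\<dots> = C * ((B * s) ^ Suc n / fact (Suc n))"
    by (simp add: power_mult_distrib field_simps)
  finally show ?thesis .
qed

lemma volterra_funpow_bound:
  assumes f: "f \<in> borel_measurable (F_measure T)"
    and bound: "\<And>\<sigma>. \<sigma> \<in> {0..T} \<Longrightarrow> \<bar>f \<sigma>\<bar> \<le> C"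
  shows "(volterra ^^ n) f \<in> L2 (F_measure T) \<and> (volterra ^^ n) f \<in> borel_measurable (F_measure T) \<and>
    (\<forall>s\<in>{0..T}. \<bar>(volterra ^^ n) f s\<bar> \<le> C * ((B * s) ^ n / fact n))"
proof (induction n)
  case 0
  have "f \<in> L2 (F_measure T)" by (rule L2_bounded[OF finite_measure_F f]) (use bound in auto)
  then show ?case using f bound by simp
next
  case (Suc n)
  then have "volterra ((volterra ^^ n) f) \<in> L2 (F_measure T)"
    using apply_L2 by (simp add: volterra_def[abs_def])
  with Suc show ?case using volterra_iterate_bound[of "(volterra ^^ n) f" C n] by (auto intro: volterra_measurable)
qed

lemma summable_power_fact: "summable (\<lambda>n. C * ((x::real) ^ n / fact n))"
  using summable_exp[of x] by (intro summable_mult) (simp add: field_simps)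

text \<open>Write \<open>K\<close> for the integral operator. The Neumann series of the bounded function \<open>K h\<close> converges uniformly to some \<open>U\<close> with \<open>U = K h + K U\<close>, and
then \<open>f = h + U\<close> solves the equation. Starting from \<open>K h\<close>, and not from \<open>h\<close>, allows for an unbounded \<open>h\<close>.\<close>

theorem volterra_solvable:
  assumes h: "h \<in> L2 (F_measure T)"
  obtains f where "f \<in> L2 (F_measure T)" "\<And>s. s \<in> {0..T} \<Longrightarrow> f s = h s + volterra f s"
proof -
  have h1: "volterra h \<in> borel_measurable (F_measure T)"
    by (rule volterra_measurable[OF L2_measurable[OF h]])
  obtain C where C: "\<And>s. s \<in> {0..T} \<Longrightarrow> \<bar>volterra h s\<bar> \<le> C"
    using volterra_bounded[OF h] by blast
  define u where "u n = (volterra ^^ n) (volterra h)" for n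
  have u: "u n \<in> L2 (F_measure T)" "u n \<in> borel_measurable (F_measure T)"
    "s \<in> {0..T} \<Longrightarrow> \<bar>u n s\<bar> \<le> C * ((B * s) ^ n / fact n)" for n s
    using volterra_funpow_bound[OF h1 C, of n] by (auto simp: u_def)
  have C0: "0 \<le> C" using C[of 0] T_pos by force
  have uT: "\<bar>u n s\<bar> \<le> C * ((B * T) ^ n / fact n)" if "s \<in> {0..T}" for n s
  proof -
    have "C * ((B * s) ^ n / fact n) \<le> C * ((B * T) ^ n / fact n)"
      using that B_nonneg C0 by (intro mult_left_mono divide_right_mono power_mono) auto
    then show ?thesis using u(3)[OF that, of n] by linarith
  qed
  have abs_sum: "summable (\<lambda>n. \<bar>u n s\<bar>)" if "s \<in> {0..T}" for s
    by (rule summable_comparison_test[OF _ summable_power_fact[of C "B * T"]]) (use uT[OF that] in auto)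
  define U where "U s = (\<Sum>n. u n s)" for s
  have U_meas: "U \<in> borel_measurable (F_measure T)"
    unfolding U_def by (intro borel_measurable_suminf u)
  have U_bound: "\<bar>U s\<bar> \<le> (\<Sum>n. C * ((B * T) ^ n / fact n))" if "s \<in> {0..T}" for s
  proof -
    have "\<bar>U s\<bar> \<le> (\<Sum>n. \<bar>u n s\<bar>)" unfolding U_def by (rule summable_rabs[OF abs_sum[OF that]])
    also have "\<dots> \<le> (\<Sum>n. C * ((B * T) ^ n / fact n))"
      by (intro suminf_le uT[OF that] abs_sum[OF that] summable_power_fact)
    finally show ?thesis .
  qed
  have UL: "U \<in> L2 (F_measure T)"
    by (rule L2_bounded[OF finite_measure_F U_meas]) (use U_bound in auto)
  have fixpoint: "U s = volterra h s + volterra U s" if s: "s \<in> {0..T}" for s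
  proof -
    have "volterra U s = (LINT \<sigma>|F_measure T. (\<Sum>n. \<kappa> s \<sigma> * u n \<sigma>))"
      unfolding volterra_def U_def
      by (intro Bochner_Integration.integral_cong refl suminf_mult[symmetric])
        (use abs_sum in \<open>auto intro: summable_rabs_cancel\<close>)
    also have "\<dots> = (\<Sum>n. LINT \<sigma>|F_measure T. \<kappa> s \<sigma> * u n \<sigma>)"
    proof (rule integral_suminf)
      show int: "integrable (F_measure T) (\<lambda>\<sigma>. \<kappa> s \<sigma> * u n \<sigma>)" for n
        using section_integrable[OF _ u(1)] s by simp
      show "AE \<sigma> in F_measure T. summable (\<lambda>n. norm (\<kappa> s \<sigma> * u n \<sigma>))"
        by (rule AE_I2) (auto simp: abs_mult intro!: summable_mult abs_sum)
      show "summable (\<lambda>n. LINT \<sigma>|F_measure T. norm (\<kappa> s \<sigma> * u n \<sigma>))"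
      proof (rule summable_comparison_test[OF _ summable_power_fact[of "measure (F_measure T) {0..T} * B * C" "B * T"]],
          intro exI[of _ 0] allI impI)
        fix n
        have "(LINT \<sigma>|F_measure T. norm (\<kappa> s \<sigma> * u n \<sigma>)) \<le> (LINT \<sigma>|F_measure T. B * (C * ((B * T) ^ n / fact n)))"
        proof (rule integral_mono)
          fix \<sigma> assume "\<sigma> \<in> space (F_measure T)"
          then show "norm (\<kappa> s \<sigma> * u n \<sigma>) \<le> B * (C * ((B * T) ^ n / fact n))"
            unfolding real_norm_def abs_mult using kernel_bound[of s \<sigma>] uT[of \<sigma> n] s B_nonneg
            by (intro mult_mono) auto
        qed (auto intro!: integrable_norm int simp del: real_norm_def)
        then show "norm (LINT \<sigma>|F_measure T. norm (\<kappa> s \<sigma> * u n \<sigma>))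
            \<le> measure (F_measure T) {0..T} * B * C * ((B * T) ^ n / fact n)"
          by (simp add: mult_ac)
      qed
    qed
    also have "\<dots> = (\<Sum>n. u (Suc n) s)"
      unfolding volterra_def[symmetric] u_def funpow.simps comp_apply ..
    also have "\<dots> = U s - u 0 s"
      unfolding U_def by (rule suminf_split_head[OF summable_rabs_cancel[OF abs_sum[OF s]]])
    finally show ?thesis by (simp add: u_def)
  qed
  show ?thesis
  proof (rule that)
    show "(\<lambda>s. h s + U s) \<in> L2 (F_measure T)" by (intro L2_add h UL)
    fix s assume s: "s \<in> {0..T}"
    have "volterra (\<lambda>s. h s + U s) s = volterra h s + volterra U s"
      using apply_lincomb[OF h UL, of s 1 1] s by (simp add: volterra_def)
    then show "h s + U s = h s + volterra (\<lambda>s. h s + U s) s" using fixpoint[OF s] by simp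
  qed
qed

text \<open>With \<open>K\<close> for the integral operator, \<open>K f\<close> is fixed by \<open>K\<close> at every point, not only almost everywhere, and it is
bounded; so it is below all the bounds on the iterates, which tend to \<open>0\<close>.\<close>

theorem volterra_fixpoint_zero:
  assumes f: "f \<in> L2 (F_measure T)" and eq: "L2_eq (F_measure T) f (volterra f)"
  shows "L2_eq (F_measure T) f (\<lambda>_. 0)"
proof -
  have VL: "volterra f \<in> L2 (F_measure T)" using apply_L2[OF f] by (simp add: volterra_def[abs_def])
  have VV: "volterra (volterra f) s = volterra f s" if s: "s \<in> {0..T}" for s
    using L2_inner_cong[OF L2_eq_refl L2_eq_sym[OF eq] section_L2 section_L2 VL f] s
    by (simp add: volterra_def[of _ s] L2_inner_def)
  obtain C where C: "\<And>s. s \<in> {0..T} \<Longrightarrow> \<bar>volterra f s\<bar> \<le> C"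
    using volterra_bounded[OF f] by blast
  have pow: "\<forall>s\<in>{0..T}. (volterra ^^ n) (volterra f) s = volterra f s" for n
  proof (induction n)
    case (Suc n)
    have "volterra ((volterra ^^ n) (volterra f)) s = volterra (volterra f) s" for s
      unfolding volterra_def[of "(volterra ^^ n) (volterra f)"] volterra_def[of "volterra f"]
      by (intro Bochner_Integration.integral_cong refl) (use Suc in auto)
    then show ?case using VV by simp
  qed simp
  have "volterra f s = 0" if s: "s \<in> {0..T}" for s
  proof -
    have "\<bar>volterra f s\<bar> \<le> C * ((B * s) ^ n / fact n)" for n
      using volterra_funpow_bound[OF L2_measurable[OF VL] C, of n] pow[of n] s by auto
    moreover have "(\<lambda>n. C * ((B * s) ^ n / fact n)) \<longlonglongrightarrow> 0"
      by (rule summable_LIMSEQ_zero[OF summable_power_fact])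
    ultimately have "\<bar>volterra f s\<bar> \<le> 0"
      by (intro LIMSEQ_le_const) auto
    then show ?thesis by simp
  qed
  then have "L2_eq (F_measure T) (volterra f) (\<lambda>_. 0)" by (auto simp: L2_eq_def)
  with eq show ?thesis by (rule L2_eq_trans)
qed

end

section \<open>Integration by parts against a primitive\<close>

lemma measurable_ident_restrict:
  assumes "sets M = sets (restrict_space borel S)"
  shows "(\<lambda>x. x) \<in> measurable M borel"
proof -
  have "(\<lambda>x. x) \<in> measurable (restrict_space borel S) borel"
    by (rule measurable_restrict_space1) simp
  then show ?thesis by (simp cong: measurable_cong_sets add: assms)
qed

lemma L2_F_mono:
  assumes "g \<in> L2 (F_measure T)" "S \<le> T"
  shows "g \<in> L2 (F_measure S)"
proof -
  have g: "g \<in> borel_measurable (F_measure T)" "integrable (F_measure T) (\<lambda>s. (g s)\<^sup>2)"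
    using assms by (auto simp: L2_def)
  have "g \<in> borel_measurable (F_measure S)"
    unfolding F_measure_def
    by (rule measurable_restrict_mono[OF g(1)[unfolded F_measure_def]]) (use assms in auto)
  moreover have "set_integrable lborel {0..T} (\<lambda>s. (g s)\<^sup>2)"
    using g(2) by (simp add: F_measure_def integrable_restrict_space set_integrable_def)
  then have "set_integrable lborel {0..S} (\<lambda>s. (g s)\<^sup>2)"
    by (rule set_integrable_subset) (use assms in auto)
  then have "integrable (F_measure S) (\<lambda>s. (g s)\<^sup>2)"
    by (simp add: F_measure_def integrable_restrict_space set_integrable_def)
  ultimately show ?thesis by (simp add: L2_def)
qed

lemma borel_pair_measurable:
  fixes f :: "real \<times> real \<Rightarrow> real"
  assumes f: "f \<in> borel_measurable borel"
    and M: "(\<lambda>x. x) \<in> measurable M borel" and N: "(\<lambda>x. x) \<in> measurable N borel"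
  shows "f \<in> borel_measurable (M \<Otimes>\<^sub>M N)"
proof -
  have "(\<lambda>p. (fst p, snd p)) \<in> measurable (M \<Otimes>\<^sub>M N) (borel \<Otimes>\<^sub>M borel)"
    using measurable_compose[OF measurable_fst M] measurable_compose[OF measurable_snd N]
    by (rule measurable_Pair)
  then have "(\<lambda>p. p) \<in> measurable (M \<Otimes>\<^sub>M N) borel" by (simp add: borel_prod)
  from measurable_compose[OF this f] show ?thesis .
qed

lemma ident_measurable_F: "(\<lambda>x. x) \<in> measurable (F_measure T) borel"
  by (intro borel_measurable_F_measure) simp

lemma restrict_volterra_kernel:
  "bounded_kernel (F_measure S) (F_measure S) (\<lambda>\<sigma> s. if s \<le> \<sigma> then 1 else 0) 1"
proof -
  interpret finite_measure "F_measure S" by (rule finite_measure_F)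
  show ?thesis
  proof
    have "(\<lambda>p :: real \<times> real. if snd p \<le> fst p then 1 else 0 :: real) \<in> borel_measurable (borel \<Otimes>\<^sub>M borel)"
      by measurable
    then have "(\<lambda>p :: real \<times> real. if snd p \<le> fst p then 1 else 0 :: real) \<in> borel_measurable borel"
      by (simp add: borel_prod)
    then show "(\<lambda>(\<sigma>, s). if s \<le> \<sigma> then 1 else 0 :: real) \<in> borel_measurable (F_measure S \<Otimes>\<^sub>M F_measure S)"
      unfolding case_prod_beta by (rule borel_pair_measurable[OF _ ident_measurable_F ident_measurable_F])
  qed auto
qed

text \<open>The function \<open>f\<close> is only absolutely continuous, as a primitive of \<open>g \<in> L\<^sub>2\<close>. Writing both
\<open>f\<close> and \<open>F(S) - F\<close> as integrals over the triangle \<open>s \<le> \<sigma>\<close> reduces the claim to Fubini's theorem.\<close>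

lemma integral_by_parts_primitive:
  assumes S: "0 \<le> S" and g: "g \<in> L2 (F_measure S)"
    and f: "\<And>t. t \<in> {0..S} \<Longrightarrow> f t = (LBINT s:{0..t}. g s)"
    and F: "\<And>s. s \<in> {0..S} \<Longrightarrow> (F has_real_derivative F' s) (at s within {0..S})"
    and F': "continuous_on {0..S} F'"
  shows "(LBINT s:{0..S}. F s * g s) = F S * f S - (LBINT s:{0..S}. F' s * f s)"
proof -
  interpret bounded_kernel "F_measure S" "F_measure S" "\<lambda>\<sigma> s. if s \<le> \<sigma> then 1 else 0" 1
    by (rule restrict_volterra_kernel)
  have contF: "continuous_on {0..S} F" by (rule DERIV_continuous_on[where D = F', OF F])
  have 1: "(LINT s|F_measure S. (if s \<le> \<sigma> then 1 else 0) * g s) = f \<sigma>" if "\<sigma> \<in> {0..S}" for \<sigma>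
    unfolding f[OF that] integral_F_measure set_lebesgue_integral_def
    using that by (intro Bochner_Integration.integral_cong) (auto simp: indicator_def)
  have 2: "(LINT \<sigma>|F_measure S. (if s \<le> \<sigma> then 1 else 0) * F' \<sigma>) = F S - F s" if s: "s \<in> {0..S}" for s
  proof -
    have "(LINT \<sigma>|F_measure S. (if s \<le> \<sigma> then 1 else 0) * F' \<sigma>) = (LBINT \<sigma>:{s..S}. F' \<sigma>)"
      unfolding integral_F_measure set_lebesgue_integral_def
      using s by (intro Bochner_Integration.integral_cong) (auto simp: indicator_def)
    also have "\<dots> = F S - F s"
    proof (rule FTC_set_integral)
      show "(F has_real_derivative F' x) (at x within {s..S})" if "x \<in> {s..S}" for x
        by (rule has_field_derivative_subset[OF F]) (use s that in auto)
      show "continuous_on {s..S} F'" by (rule continuous_on_subset[OF F']) (use s in auto)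
    qed (use s in auto)
    finally show ?thesis .
  qed
  have "(LBINT s:{0..S}. F' s * f s) = L2_inner (F_measure S) (\<lambda>\<sigma>. LINT s|F_measure S. (if s \<le> \<sigma> then 1 else 0) * g s) F'"
    unfolding L2_inner_def integral_F_measure[symmetric]
  proof (rule Bochner_Integration.integral_cong[OF refl])
    fix \<sigma> assume "\<sigma> \<in> space (F_measure S)"
    then show "F' \<sigma> * f \<sigma> = (LINT s|F_measure S. (if s \<le> \<sigma> then 1 else 0) * g s) * F' \<sigma>"
      using 1[of \<sigma>] by simp
  qed
  also have "\<dots> = L2_inner (F_measure S) g (\<lambda>s. LINT \<sigma>|F_measure S. (if s \<le> \<sigma> then 1 else 0) * F' \<sigma>)"
    by (rule duality[OF g continuous_on_L2_F[OF F']])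
  also have "\<dots> = (LINT s|F_measure S. F S * g s - F s * g s)"
    unfolding L2_inner_def
  proof (rule Bochner_Integration.integral_cong[OF refl])
    fix s assume "s \<in> space (F_measure S)"
    then have s: "s \<in> {0..S}" by simp
    show "g s * (LINT \<sigma>|F_measure S. (if s \<le> \<sigma> then 1 else 0) * F' \<sigma>) = F S * g s - F s * g s"
      unfolding 2[OF s] by (simp add: algebra_simps)
  qed
  also have "\<dots> = F S * (LINT s|F_measure S. g s) - (LINT s|F_measure S. F s * g s)"
    using L2_integrable[OF finite_measure_F g] L2_integrable_mult[OF continuous_on_L2_F[OF contF] g] by simp
  also have "(LINT s|F_measure S. g s) = f S"
    using f[of S] S by (simp add: integral_F_measure)
  finally show ?thesis by (simp add: integral_F_measure)
qed

lemma reflect_integral: "(LBINT t. f t) = (LBINT s. f (T - s))" for f :: "real \<Rightarrow> real"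
  using lborel_integral_real_affine[of "-1" f T] by simp

section \<open>The travel time\<close>

locale neumann_control =
  fixes \<rho> q :: "real \<Rightarrow> real" and r :: "real \<Rightarrow> real \<Rightarrow> real" and T :: real
  assumes \<rho>_smooth: "smooth1 {0..} \<rho>" and q_smooth: "smooth1 {0..} q"
    and \<rho>_pos: "\<And>x. x \<ge> 0 \<Longrightarrow> \<rho> x > 0"
    and \<rho>_divergent: "(\<integral>\<^sup>+ x\<in>{0..}. ennreal (sqrt (\<rho> x)) \<partial>lborel) = \<infinity>"
    and fundamental: "fundamental_solution \<rho> q r"
    and T_pos: "T > 0"

begin

lemma \<rho>_cont: "continuous_on {0..} \<rho>"
  by (rule smooth1_continuous_on[OF \<rho>_smooth])

text \<open>The primitive is extended to the negative half-line, with slope \<open>\<rho>(0)\<^sup>1\<^sup>/\<^sup>2\<close>, in order to have two-sided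
derivatives also at \<open>0\<close>.\<close>

lemma tau_primitive:
  obtains F where "\<And>x. (F has_real_derivative sqrt (\<rho> (max 0 x))) (at x)"
    and "\<And>x. x \<ge> 0 \<Longrightarrow> F x = tau \<rho> x"
proof -
  have cont: "continuous_on UNIV (\<lambda>x. sqrt (\<rho> (max 0 x)))"
    by (intro continuous_on_real_sqrt continuous_on_compose2[OF \<rho>_cont] continuous_intros) auto
  obtain F where F: "F 0 = 0" "\<And>x. (F has_real_derivative sqrt (\<rho> (max 0 x))) (at x)"
    using continuous_primitive[OF cont] by blast
  have "F x = tau \<rho> x" if "x \<ge> 0" for x
  proof -
    have "tau \<rho> x = (LBINT s:{0..x}. sqrt (\<rho> (max 0 s)))"
      unfolding tau_def by (rule set_lebesgue_integral_cong) auto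
    also have "\<dots> = F x - F 0"
      by (rule FTC_set_integral[OF that has_field_derivative_at_within[OF F(2)] continuous_on_subset[OF cont]]) simp
    finally show ?thesis using F by simp
  qed
  with F(2) show ?thesis by (rule that)
qed

lemma tau_0: "tau \<rho> 0 = 0"
  unfolding tau_def set_lebesgue_integral_def
  using AE_lborel_singleton[of 0] by (intro integral_eq_zero_AE) (auto elim!: eventually_mono)

lemma tau_strict_mono:
  assumes "0 \<le> x" "x < y"
  shows "tau \<rho> x < tau \<rho> y"
proof (rule tau_primitive)
  fix F assume F: "\<And>x. (F has_real_derivative sqrt (\<rho> (max 0 x))) (at x)" "\<And>x. x \<ge> 0 \<Longrightarrow> F x = tau \<rho> x"
  have "F x < F y"
    by (rule DERIV_pos_imp_increasing[OF assms(2)]) (use F(1) \<rho>_pos in force)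
  then show ?thesis using F(2) assms by simp
qed

lemma tau_mono: "0 \<le> x \<Longrightarrow> x \<le> y \<Longrightarrow> tau \<rho> x \<le> tau \<rho> y"
  using tau_strict_mono[of x y] by (cases "x = y") auto

lemma tau_less_iff: "0 \<le> x \<Longrightarrow> 0 \<le> y \<Longrightarrow> tau \<rho> x < tau \<rho> y \<longleftrightarrow> x < y"
  using tau_strict_mono tau_mono by (meson linorder_not_less)

lemma tau_le_iff: "0 \<le> x \<Longrightarrow> 0 \<le> y \<Longrightarrow> tau \<rho> x \<le> tau \<rho> y \<longleftrightarrow> x \<le> y"
  using tau_less_iff by (meson linorder_not_less)

lemma tau_nonneg: "0 \<le> x \<Longrightarrow> 0 \<le> tau \<rho> x"
  using tau_mono[of 0 x] tau_0 by simp

lemma tau_cont: "continuous_on {0..} (tau \<rho>)"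
proof (rule tau_primitive)
  fix F assume F: "\<And>x. (F has_real_derivative sqrt (\<rho> (max 0 x))) (at x)" "\<And>x. x \<ge> 0 \<Longrightarrow> F x = tau \<rho> x"
  have "continuous_on {0..} F"
    by (rule DERIV_continuous_on[where D = "\<lambda>x. sqrt (\<rho> (max 0 x))"]) (rule has_field_derivative_at_within[OF F(1)])
  then show ?thesis by (rule continuous_on_eq) (use F(2) in auto)
qed

text \<open>A bounded monotone \<open>\<tau>\<close> would have a limit at infinity, which would be the value of the divergent integral.\<close>

lemma tau_unbounded: "\<exists>x\<ge>0. t < tau \<rho> x"
proof (rule ccontr)
  assume "\<not> ?thesis"
  then have bound: "tau \<rho> x \<le> t" if "x \<ge> 0" for x using that by (simp add: not_less)
  show False
  proof (rule tau_primitive)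
    fix F assume F: "\<And>x. (F has_real_derivative sqrt (\<rho> (max 0 x))) (at x)" "\<And>x. x \<ge> 0 \<Longrightarrow> F x = tau \<rho> x"
    define L where "L = (SUP x\<in>{0..}. tau \<rho> x)"
    have bdd: "bdd_above (tau \<rho> ` {0..})" by (rule bdd_aboveI2[of _ _ t]) (use bound in auto)
    have "(F \<longlongrightarrow> L) at_top"
    proof (rule order_tendstoI)
      fix a assume "a < L"
      then obtain x where x: "x \<ge> 0" "a < tau \<rho> x"
        unfolding L_def using bdd by (subst (asm) less_cSUP_iff) auto
      show "\<forall>\<^sub>F z in at_top. a < F z"
        using eventually_ge_at_top[of x]
      proof eventually_elim
        case (elim z)
        then show ?case using x tau_mono[of x z] F(2)[of z] by simp
      qed
    next
      fix a assume "L < a"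
      show "\<forall>\<^sub>F z in at_top. F z < a"
        using eventually_ge_at_top[of 0]
      proof eventually_elim
        case (elim z)
        then have "tau \<rho> z \<le> L" unfolding L_def using bdd by (intro cSUP_upper) auto
        then show ?case using F(2)[OF elim] \<open>L < a\<close> by simp
      qed
    qed
    moreover have "(\<lambda>x. sqrt (\<rho> (max 0 x))) \<in> borel_measurable borel"
      by (intro borel_measurable_continuous_onI continuous_on_real_sqrt
          continuous_on_compose2[OF \<rho>_cont] continuous_intros) auto
    ultimately have "(\<integral>\<^sup>+x. ennreal (sqrt (\<rho> (max 0 x))) * indicator {0..} x \<partial>lborel) = ennreal (L - F 0)"
    proof (intro nn_integral_FTC_atLeast)
      show "0 \<le> sqrt (\<rho> (max 0 x))" for x using \<rho>_pos[of "max 0 x"] by simp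
      show "(F has_real_derivative sqrt (\<rho> (max 0 x))) (at x)" for x by (rule F(1))
    qed auto
    moreover have "(\<integral>\<^sup>+x. ennreal (sqrt (\<rho> (max 0 x))) * indicator {0..} x \<partial>lborel)
        = (\<integral>\<^sup>+ x\<in>{0..}. ennreal (sqrt (\<rho> x)) \<partial>lborel)"
      by (intro nn_integral_cong) (auto simp: indicator_def)
    ultimately show False using \<rho>_divergent by simp
  qed
qed

lemma inj_tau: "inj_on (tau \<rho>) {0..}"
  by (rule inj_onI) (metis atLeast_iff tau_less_iff linorder_less_linear order_less_irrefl)

lemma tau_inv_tau: "x \<ge> 0 \<Longrightarrow> tau_inv \<rho> (tau \<rho> x) = x"
  unfolding tau_inv_def by (rule the_inv_into_f_f[OF inj_tau]) simp

lemma tau_inv: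
  assumes "t \<ge> 0"
  shows "tau_inv \<rho> t \<ge> 0" "tau \<rho> (tau_inv \<rho> t) = t"
proof -
  obtain b where b: "b \<ge> 0" "t < tau \<rho> b" using tau_unbounded by blast
  have "\<exists>x\<ge>0. x \<le> b \<and> tau \<rho> x = t"
    by (rule IVT') (use b assms tau_0 continuous_on_subset[OF tau_cont] in auto)
  then obtain x where "x \<ge> 0" "tau \<rho> x = t" by blast
  then show "tau_inv \<rho> t \<ge> 0" "tau \<rho> (tau_inv \<rho> t) = t" using tau_inv_tau by auto
qed

text \<open>The point that the front reaches at time \<open>T\<close>.\<close>

definition X :: real where "X = tau_inv \<rho> T"

lemma X: "X > 0" "tau \<rho> X = T"
proof -
  show "tau \<rho> X = T" using tau_inv T_pos by (simp add: X_def)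
  have "X \<ge> 0" using tau_inv T_pos by (simp add: X_def)
  moreover have "X \<noteq> 0" using \<open>tau \<rho> X = T\<close> tau_0 T_pos by auto
  ultimately show "X > 0" by simp
qed

lemma tau_image: "tau \<rho> ` {0..X} = {0..T}"
proof
  show "tau \<rho> ` {0..X} \<subseteq> {0..T}"
    using tau_nonneg tau_mono[of _ X] X by auto
  show "{0..T} \<subseteq> tau \<rho> ` {0..X}"
  proof
    fix t assume t: "t \<in> {0..T}"
    then have "tau_inv \<rho> t \<le> X"
      using tau_le_iff[of "tau_inv \<rho> t" X] tau_inv[of t] X by auto
    then show "t \<in> tau \<rho> ` {0..X}" using tau_inv[of t] t by (metis atLeastAtMost_iff imageI)
  qed
qed

lemma tau_inv_mem:
  assumes "t \<in> {0..T}"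
  shows "tau_inv \<rho> t \<in> {0..X}"
proof -
  obtain x where "x \<in> {0..X}" "t = tau \<rho> x" using assms tau_image by blast
  then show ?thesis using tau_inv_tau[of x] by simp
qed

lemma tau_inv_cont: "continuous_on {0..T} (tau_inv \<rho>)"
  using continuous_on_inv[of "{0..X}" "tau \<rho>" "tau_inv \<rho>"] continuous_on_subset[OF tau_cont]
  by (simp add: tau_image tau_inv_tau)

section \<open>The measure of the state space\<close>

abbreviation "H \<equiv> H_measure \<rho> T"

abbreviation "N \<equiv> F_measure T"

lemma space_H [simp]: "space H = {0..X}"
  by (simp add: H_measure_def space_restrict_space X_def)

lemma sets_H: "sets H = sets (restrict_space borel {0..X})"
  by (simp add: H_measure_def X_def sets_restrict_space)

lemma sets_N: "sets N = sets (restrict_space borel {0..T})"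
  by (simp add: F_measure_def sets_restrict_space)

lemma continuous_measurable_H: "continuous_on {0..X} f \<Longrightarrow> f \<in> borel_measurable H"
  for f :: "real \<Rightarrow> real"
  using borel_measurable_continuous_on_restrict[of "{0..X}" f]
  by (simp cong: measurable_cong_sets add: sets_H)

lemma \<rho>_measurable_lborel: "\<rho> \<in> borel_measurable (restrict_space lborel {0..X})"
proof -
  have "\<rho> \<in> borel_measurable (restrict_space borel {0..X})"
    by (rule borel_measurable_continuous_on_restrict) (rule continuous_on_subset[OF \<rho>_cont], auto)
  then show ?thesis by (simp cong: measurable_cong_sets add: sets_restrict_space)
qed

lemma H_eq: "H = density (restrict_space lborel {0..X}) (\<lambda>x. ennreal (\<rho> x))"
  by (simp add: H_measure_def X_def)

lemma nn_integral_H: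
  assumes "f \<in> borel_measurable (restrict_space borel {0..X})"
  shows "(\<integral>\<^sup>+x. f x \<partial>H) = (\<integral>\<^sup>+x. ennreal (\<rho> x) * f x * indicator {0..X} x \<partial>lborel)"
proof -
  have f: "f \<in> borel_measurable (restrict_space lborel {0..X})"
    using assms by (simp cong: measurable_cong_sets add: sets_restrict_space)
  show ?thesis unfolding H_eq using \<rho>_measurable_lborel f
    by (subst nn_integral_density) (auto simp: nn_integral_restrict_space)
qed

lemma integral_H:
  fixes f :: "real \<Rightarrow> real"
  assumes "f \<in> borel_measurable H"
  shows "(LINT x|H. f x) = (LBINT x:{0..X}. \<rho> x * f x)"
proof -
  have f: "f \<in> borel_measurable (restrict_space lborel {0..X})"
    using assms unfolding H_eq by simp
  have "(LINT x|H. f x) = (LINT x|restrict_space lborel {0..X}. \<rho> x *\<^sub>R f x)"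
    unfolding H_eq
    by (rule integral_density[OF f \<rho>_measurable_lborel])
      (auto intro!: AE_I2 less_imp_le[OF \<rho>_pos] simp: space_restrict_space)
  then show ?thesis
    by (simp add: set_lebesgue_integral_def integral_restrict_space)
qed

lemma \<rho>_bounded:
  obtains A where "\<And>x. x \<in> {0..X} \<Longrightarrow> \<rho> x \<le> A"
proof -
  have "continuous_on {0..X} \<rho>" by (rule continuous_on_subset[OF \<rho>_cont]) auto
  then obtain A where "0 \<le> A" "\<And>x. x \<in> {0..X} \<Longrightarrow> norm (\<rho> x) \<le> A"
    by (rule continuous_on_compact_bound[OF compact_Icc]) (blast intro: that)
  then show ?thesis using that[of A] by (auto simp: abs_le_iff)
qed

lemma finite_measure_H: "finite_measure H"
proof (rule \<rho>_bounded)
  fix A assume A: "\<And>x. x \<in> {0..X} \<Longrightarrow> \<rho> x \<le> A"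
  have "emeasure H (space H) = (\<integral>\<^sup>+x. 1 \<partial>H)" by simp
  also have "\<dots> = (\<integral>\<^sup>+x. ennreal (\<rho> x) * 1 * indicator {0..X} x \<partial>lborel)"
    by (rule nn_integral_H) simp
  also have "\<dots> \<le> (\<integral>\<^sup>+x. ennreal A * indicator {0..X} x \<partial>lborel)"
    using A by (intro nn_integral_mono) (auto simp: indicator_def intro: ennreal_leI)
  also have "\<dots> = ennreal A * ennreal X" using X by (simp add: nn_integral_cmult)
  also have "\<dots> < \<infinity>" by (simp add: ennreal_mult_less_top)
  finally show ?thesis by (intro finite_measureI) auto
qed

lemma front_measurable: "(\<lambda>x. T - tau \<rho> x) \<in> measurable H N"
  unfolding F_measure_def
proof (rule measurable_restrict_space2)
  show "(\<lambda>x. T - tau \<rho> x) \<in> space H \<rightarrow> {0..T}" using tau_image by auto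
  have "continuous_on {0..X} (\<lambda>x. T - tau \<rho> x)"
    by (intro continuous_intros continuous_on_subset[OF tau_cont]) auto
  then show "(\<lambda>x. T - tau \<rho> x) \<in> measurable H lborel"
    using continuous_measurable_H by simp
qed

lemma front_inv_mem: "s \<in> {0..T} \<Longrightarrow> tau_inv \<rho> (T - s) \<in> {0..X}"
  by (rule tau_inv_mem) auto

lemma front_inv_measurable: "(\<lambda>s. tau_inv \<rho> (T - s)) \<in> measurable N H"
proof -
  have "continuous_on {0..T} (\<lambda>s. tau_inv \<rho> (T - s))"
    by (intro continuous_on_compose2[OF tau_inv_cont] continuous_intros) auto
  then have "(\<lambda>s. tau_inv \<rho> (T - s)) \<in> borel_measurable (restrict_space borel {0..T})"
    by (rule borel_measurable_continuous_on_restrict)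
  then have "(\<lambda>s. tau_inv \<rho> (T - s)) \<in> measurable (restrict_space borel {0..T}) (restrict_space borel {0..X})"
    using front_inv_mem by (intro measurable_restrict_space2) (auto simp: space_restrict_space)
  then show ?thesis by (simp cong: measurable_cong_sets add: sets_N sets_H)
qed

text \<open>The substitution \<open>s = T - \<tau>(x)\<close> turns \<open>\<rho>\<^sup>1\<^sup>/\<^sup>2 dx = \<rho>\<^sup>-\<^sup>1\<^sup>/\<^sup>2 (\<rho> dx)\<close> into \<open>ds\<close>.\<close>

lemma front_transport: "N = distr (density H (\<lambda>x. ennreal (1 / sqrt (\<rho> x)))) N (\<lambda>x. T - tau \<rho> x)"
proof (rule measure_eqI)
  fix A assume AN: "A \<in> sets N"
  then have A: "A \<in> sets borel" "A \<subseteq> {0..T}" by (auto simp: sets_F_measure)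
  have m: "(\<lambda>x. 1 / sqrt (\<rho> x)) \<in> borel_measurable H"
    by (intro continuous_measurable_H continuous_intros continuous_on_subset[OF \<rho>_cont])
      (use \<rho>_pos in \<open>auto simp: less_le\<close>)
  have Am: "(\<lambda>x. indicator A (T - tau \<rho> x) :: ennreal) \<in> borel_measurable H"
    using measurable_compose[OF front_measurable borel_measurable_indicator[OF AN]] .
  have front: "(\<lambda>x. T - tau \<rho> x) \<in> measurable (density H (\<lambda>x. ennreal (1 / sqrt (\<rho> x)))) N"
    using front_measurable by simp
  have "emeasure (distr (density H (\<lambda>x. ennreal (1 / sqrt (\<rho> x)))) N (\<lambda>x. T - tau \<rho> x)) A
      = (\<integral>\<^sup>+s. indicator A s \<partial>distr (density H (\<lambda>x. ennreal (1 / sqrt (\<rho> x)))) N (\<lambda>x. T - tau \<rho> x))"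
    using AN by simp
  also have "\<dots> = (\<integral>\<^sup>+x. indicator A (T - tau \<rho> x) \<partial>density H (\<lambda>x. ennreal (1 / sqrt (\<rho> x))))"
    using AN by (intro nn_integral_distr front) simp
  also have "\<dots> = (\<integral>\<^sup>+x. ennreal (1 / sqrt (\<rho> x)) * indicator A (T - tau \<rho> x) \<partial>H)"
    using m Am by (intro nn_integral_density) simp_all
  also have "\<dots> = (\<integral>\<^sup>+x. ennreal (\<rho> x) * (ennreal (1 / sqrt (\<rho> x)) * indicator A (T - tau \<rho> x)) * indicator {0..X} x \<partial>lborel)"
    using m Am by (intro nn_integral_H) (simp cong: measurable_cong_sets add: sets_H[symmetric])
  also have "\<dots> = (\<integral>\<^sup>+u. indicator A (T - u) * indicator {0..T} u \<partial>lborel)"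
  proof (rule tau_primitive)
    fix F assume F: "\<And>x. (F has_real_derivative sqrt (\<rho> (max 0 x))) (at x)" "\<And>x. x \<ge> 0 \<Longrightarrow> F x = tau \<rho> x"
    have "(\<integral>\<^sup>+u. ennreal (indicator A (T - u) * indicator {F 0..F X} u) \<partial>lborel)
       = (\<integral>\<^sup>+x. ennreal (indicator A (T - F x) * sqrt (\<rho> (max 0 x)) * indicator {0..X} x) \<partial>lborel)"
    proof (rule nn_integral_substitution)
      show "set_borel_measurable borel {F 0..F X} (\<lambda>u. indicat_real A (T - u))"
      proof -
        have [measurable]: "indicat_real A \<in> borel_measurable borel" using A by simp
        show ?thesis unfolding set_borel_measurable_def by measurable
      qed
      show "continuous_on {0..X} (\<lambda>x. sqrt (\<rho> (max 0 x)))"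
        by (intro continuous_on_real_sqrt continuous_on_compose2[OF \<rho>_cont] continuous_intros) auto
      show "0 \<le> sqrt (\<rho> (max 0 x))" for x using \<rho>_pos[of "max 0 x"] by simp
      show "(F has_real_derivative sqrt (\<rho> (max 0 x))) (at x)" for x by (rule F(1))
    qed (use X in auto)
    moreover have "ennreal (indicator A (T - F x) * sqrt (\<rho> (max 0 x)) * indicator {0..X} x)
        = ennreal (\<rho> x) * (ennreal (1 / sqrt (\<rho> x)) * indicator A (T - tau \<rho> x)) * indicator {0..X} x" for x
    proof (cases "x \<in> {0..X}")
      case True
      then have "ennreal (\<rho> x) * ennreal (1 / sqrt (\<rho> x)) = ennreal (sqrt (\<rho> x))"
        using \<rho>_pos[of x] by (simp add: ennreal_mult[symmetric] real_div_sqrt)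
      then show ?thesis using True F(2)[of x] by (auto simp: indicator_def)
    qed simp
    moreover have "ennreal (indicator A (T - u) * indicator {F 0..F X} u) = indicator A (T - u) * indicator {0..T} u" for u
      using F(2)[of 0] F(2)[of X] X tau_0 by (auto simp: indicator_def)
    ultimately show ?thesis by simp
  qed
  also have "\<dots> = (\<integral>\<^sup>+u. indicator A u * indicator {0..T} (T - u) \<partial>lborel)"
    using nn_integral_real_affine[of "\<lambda>u. indicator A (T - u) * indicator {0..T} u" "-1" T] A by simp
  also have "\<dots> = (\<integral>\<^sup>+u. indicator A u \<partial>lborel)"
    using A by (intro nn_integral_cong) (auto simp: indicator_def)
  also have "\<dots> = emeasure N A"
    using A by (simp add: F_measure_def emeasure_restrict_space)
  finally show "emeasure N A = emeasure (distr (density H (\<lambda>x. ennreal (1 / sqrt (\<rho> x)))) N (\<lambda>x. T - tau \<rho> x)) A" ..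
qed simp

section \<open>The extension of the control operator\<close>

definition \<Omega> :: "(real \<times> real) set" where "\<Omega> = {(x, t). 0 \<le> x \<and> tau \<rho> x \<le> t}"

text \<open>A fixed choice of the partial derivatives of the fundamental solution on the closed set \<open>\<Omega>\<close> behind the
front, including their values on the front.\<close>

definition r_partials :: "nat \<Rightarrow> nat \<Rightarrow> real \<times> real \<Rightarrow> real" where
  "r_partials = (SOME D. smooth_partials \<Omega> D \<and> (\<forall>p\<in>\<Omega>. D 0 0 p = (case p of (x, t) \<Rightarrow> r x t)))"

lemma r_partials:
  "smooth_partials \<Omega> r_partials" "0 \<le> x \<Longrightarrow> tau \<rho> x \<le> t \<Longrightarrow> r_partials 0 0 (x, t) = r x t"
proof -
  let ?P = "\<lambda>D. smooth_partials \<Omega> D \<and> (\<forall>p\<in>\<Omega>. D 0 0 p = (case p of (x, t) \<Rightarrow> r x t))"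
  have "\<exists>D. ?P D" using fundamental unfolding fundamental_solution_def smooth2_def \<Omega>_def by blast
  then have "?P r_partials" unfolding r_partials_def by (rule someI_ex)
  then show "smooth_partials \<Omega> r_partials" "0 \<le> x \<Longrightarrow> tau \<rho> x \<le> t \<Longrightarrow> r_partials 0 0 (x, t) = r x t"
    by (auto simp: \<Omega>_def)
qed

definition r_t :: "real \<Rightarrow> real \<Rightarrow> real" where "r_t x t = r_partials 0 1 (x, t)"

lemma r_partials_cont: "continuous_on \<Omega> (r_partials i j)"
  using r_partials(1) unfolding smooth_partials_def
  by (intro has_derivative_continuous_on[where f' = "\<lambda>p h. fst h * r_partials (Suc i) j p + snd h * r_partials i (Suc j) p"]) blast

lemma r_cont: "continuous_on \<Omega> (\<lambda>(x, t). r x t)"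
  using r_partials_cont[of 0 0] by (rule continuous_on_eq) (auto simp: \<Omega>_def r_partials)

lemma r_t_cont: "continuous_on \<Omega> (\<lambda>(x, t). r_t x t)"
  using r_partials_cont[of 0 1] by (rule continuous_on_eq) (auto simp: r_t_def)

lemma r_has_derivative:
  assumes "0 \<le> x" "tau \<rho> x \<le> t"
  shows "((\<lambda>t. r x t) has_real_derivative r_t x t) (at t within {tau \<rho> x..})"
proof -
  have "(r_partials 0 0 has_derivative
      (\<lambda>h. fst h * r_partials 1 0 (x, t) + snd h * r_partials 0 1 (x, t))) (at (x, t) within \<Omega>)"
    using r_partials(1) assms unfolding smooth_partials_def by (auto simp: \<Omega>_def)
  then have "(r_partials 0 0 has_derivative
      (\<lambda>h. fst h * r_partials 1 0 (x, t) + snd h * r_partials 0 1 (x, t))) (at (x, t) within Pair x ` {tau \<rho> x..})"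
    by (rule has_derivative_subset) (use assms in \<open>auto simp: \<Omega>_def\<close>)
  moreover have "(Pair x has_derivative (\<lambda>h. (0, h))) (at t within {tau \<rho> x..})"
    by (auto intro!: derivative_eq_intros)
  ultimately have "((\<lambda>t. r_partials 0 0 (x, t)) has_derivative
      (\<lambda>h. fst (0, h) * r_partials 1 0 (x, t) + snd (0, h) * r_partials 0 1 (x, t))) (at t within {tau \<rho> x..})"
    using has_derivative_in_compose by fastforce
  then have "((\<lambda>t. r_partials 0 0 (x, t)) has_real_derivative r_t x t) (at t within {tau \<rho> x..})"
    by (simp add: has_field_derivative_def r_t_def mult_commute_abs)
  then show ?thesis
    by (rule has_real_derivative_cong_on) (use assms r_partials(2) in auto)
qed

definition front :: "real \<Rightarrow> real" where "front x = r x (tau \<rho> x)"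

text \<open>On \<open>\<Omega>\<close> the function \<open>r\<close> is continuous up to the front, so its value there is the given jump.\<close>

lemma front_eq:
  assumes "0 \<le> x"
  shows "front x = - ((\<rho> 0 * \<rho> x) powr (-1/4))"
proof -
  have "((\<lambda>t. r x t) \<longlongrightarrow> r x (tau \<rho> x)) (at (tau \<rho> x) within {tau \<rho> x..})"
    using DERIV_continuous[OF r_has_derivative[OF assms order_refl]]
    by (simp add: continuous_within)
  then have "((\<lambda>t. r x t) \<longlongrightarrow> r x (tau \<rho> x)) (at_right (tau \<rho> x))"
    by (rule tendsto_within_subset) auto
  moreover have "(r x \<longlongrightarrow> - ((\<rho> 0 * \<rho> x) powr (-1/4))) (at_right (tau \<rho> x))"
    using fundamental assms unfolding fundamental_solution_def by blast
  ultimately show ?thesis unfolding front_def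
    using tendsto_unique[OF trivial_limit_at_right_real] by blast
qed

lemma front_nonzero: "0 \<le> x \<Longrightarrow> front x \<noteq> 0"
  using \<rho>_pos[of 0] \<rho>_pos[of x] by (simp add: front_eq)

text \<open>Up to a constant the square of the weight is the density \<open>\<rho>\<^sup>-\<^sup>1\<^sup>/\<^sup>2\<close> of the change of variable, so the
leading term of \<open>V\<^sub>0\<close> below is a multiple of an isometry.\<close>

lemma front_square:
  assumes "0 \<le> x"
  shows "(front x)\<^sup>2 = (1 / sqrt (\<rho> 0)) * (1 / sqrt (\<rho> x))"
proof -
  have "((\<rho> 0 * \<rho> x) powr (-1/4))\<^sup>2 = (\<rho> 0 * \<rho> x) powr (-1/2)"
    by (simp add: power2_eq_square powr_add[symmetric])
  also have "\<dots> = 1 / sqrt (\<rho> 0 * \<rho> x)"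
    using \<rho>_pos[of 0] \<rho>_pos[OF assms] by (simp add: powr_minus_divide powr_half_sqrt[symmetric])
  finally show ?thesis by (simp add: front_eq[OF assms] real_sqrt_mult)
qed

lemma front_cont: "continuous_on {0..X} front"
proof -
  have "continuous_on {0..X} (\<lambda>x. - ((\<rho> 0 * \<rho> x) powr (-1/4)))"
    using \<rho>_pos by (intro continuous_intros continuous_on_subset[OF \<rho>_cont]) (auto simp: less_le)
  then show ?thesis by (rule continuous_on_eq) (simp add: front_eq)
qed

sublocale transport: weighted_transport H N "\<lambda>x. T - tau \<rho> x" "\<lambda>s. tau_inv \<rho> (T - s)"
  "\<lambda>x. 1 / sqrt (\<rho> x)" front "1 / sqrt (\<rho> 0)"
proof
  show "(\<lambda>x. 1 / sqrt (\<rho> x)) \<in> borel_measurable H"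
    by (intro continuous_measurable_H continuous_intros continuous_on_subset[OF \<rho>_cont])
      (use \<rho>_pos in \<open>auto simp: less_le\<close>)
  show "front \<in> borel_measurable H" by (rule continuous_measurable_H[OF front_cont])
  show "(front x)\<^sup>2 \<le> 1 / sqrt (\<rho> 0) * (1 / sqrt (\<rho> x))" if "x \<in> space H" for x
    using that by (simp add: front_square)
qed (use front_measurable front_inv_measurable tau_inv_tau \<rho>_pos front_transport in auto)

definition kernel :: "real \<Rightarrow> real \<Rightarrow> real" where
  "kernel x s = (if 0 \<le> x \<and> x \<le> X \<and> 0 \<le> s \<and> s \<le> T - tau \<rho> x then r_t x (T - s) else 0)"

definition kernel_domain :: "(real \<times> real) set" where
  "kernel_domain = {(x, s). 0 \<le> x \<and> x \<le> X \<and> 0 \<le> s \<and> s \<le> T - tau \<rho> x}"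

lemma kernel_domain_compact: "compact kernel_domain"
proof -
  have "continuous_on ({0..X} \<times> {0..T}) (\<lambda>p. tau \<rho> (fst p) + snd p)"
    by (intro continuous_intros continuous_on_compose2[OF tau_cont]) auto
  then have "closed (({0..X} \<times> {0..T}) \<inter> (\<lambda>p. tau \<rho> (fst p) + snd p) -` {..T})"
    by (intro continuous_closed_preimage closed_Times) auto
  then have "compact (({0..X} \<times> {0..T}) \<inter> (({0..X} \<times> {0..T}) \<inter> (\<lambda>p. tau \<rho> (fst p) + snd p) -` {..T}))"
    by (intro compact_Int_closed compact_Times) auto
  moreover have "kernel_domain = ({0..X} \<times> {0..T}) \<inter> (({0..X} \<times> {0..T}) \<inter> (\<lambda>p. tau \<rho> (fst p) + snd p) -` {..T})"
    using tau_nonneg by (fastforce simp: kernel_domain_def)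
  ultimately show ?thesis by simp
qed

lemma kernel_domain_cont: "continuous_on kernel_domain (\<lambda>p. r_t (fst p) (T - snd p))"
proof -
  have "continuous_on kernel_domain (\<lambda>p. (case (fst p, T - snd p) of (x, t) \<Rightarrow> r_t x t))"
    by (rule continuous_on_compose2[OF r_t_cont])
      (auto intro!: continuous_intros simp: kernel_domain_def \<Omega>_def)
  then show ?thesis by simp
qed

lemma kernel_eq_indicator: "kernel (fst p) (snd p) = indicator kernel_domain p *\<^sub>R r_t (fst p) (T - snd p)"
  by (cases p) (auto simp: kernel_def kernel_domain_def)

lemma kernel_borel: "(\<lambda>p. kernel (fst p) (snd p)) \<in> borel_measurable borel"
  unfolding kernel_eq_indicator
  by (intro borel_measurable_continuous_on_indicator kernel_domain_cont)
    (simp add: borel_compact kernel_domain_compact)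

lemma kernel_bounded: "\<exists>B. \<forall>x s. \<bar>kernel x s\<bar> \<le> B"
proof -
  obtain b where b: "0 \<le> b" "\<And>p. p \<in> kernel_domain \<Longrightarrow> norm (r_t (fst p) (T - snd p)) \<le> b"
    by (rule continuous_on_compact_bound[OF kernel_domain_compact kernel_domain_cont]) (blast intro: that)
  have "\<bar>kernel x s\<bar> \<le> b" for x s
    using b(1) b(2)[of "(x, s)"] by (auto simp: kernel_def kernel_domain_def)
  then show ?thesis by blast
qed

definition kernel_sup :: real where "kernel_sup = (SOME B. \<forall>x s. \<bar>kernel x s\<bar> \<le> B)"

lemma kernel_sup: "\<bar>kernel x s\<bar> \<le> kernel_sup"
  using someI_ex[OF kernel_bounded] by (simp add: kernel_sup_def)

sublocale ker: bounded_kernel H N kernel kernel_sup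
proof -
  interpret H: finite_measure H by (rule finite_measure_H)
  interpret N: finite_measure N by (rule finite_measure_F)
  show "bounded_kernel H N kernel kernel_sup"
  proof
    show "(\<lambda>(x, s). kernel x s) \<in> borel_measurable (H \<Otimes>\<^sub>M N)"
      using borel_pair_measurable[OF kernel_borel measurable_ident_restrict[OF sets_H] ident_measurable_F]
      by (simp add: case_prod_beta)
  qed (rule kernel_sup)
qed

text \<open>The explicit form of \<open>W d/dt\<close>: the front of \<open>r\<close> carries the control itself, the part behind it a memory.\<close>

definition V\<^sub>0 :: "(real \<Rightarrow> real) \<Rightarrow> real \<Rightarrow> real" where
  "V\<^sub>0 f x = front x * f (T - tau \<rho> x) + (LINT s|N. kernel x s * f s)"

lemma V\<^sub>0_L2: "f \<in> L2 N \<Longrightarrow> V\<^sub>0 f \<in> L2 H"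
  unfolding V\<^sub>0_def[abs_def] by (intro L2_add transport.comp_L2 ker.apply_L2)

lemma V\<^sub>0_lincomb:
  assumes "f \<in> L2 N" "g \<in> L2 N" "x \<in> {0..X}"
  shows "V\<^sub>0 (\<lambda>s. a * f s + b * g s) x = a * V\<^sub>0 f x + b * V\<^sub>0 g x"
  using ker.apply_lincomb[OF assms(1,2), of x a b] assms(3)
  by (simp add: V\<^sub>0_def algebra_simps)

lemma V\<^sub>0_bounded_linear: "L2_bounded_linear N H V\<^sub>0"
proof -
  have "L2_inner H (V\<^sub>0 f) (V\<^sub>0 f) \<le>
      (2 / sqrt (\<rho> 0) + 2 * (kernel_sup\<^sup>2 * measure N (space N) * measure H (space H))) * L2_inner N f f"
    if f: "f \<in> L2 N" for f
  proof -
    have "L2_inner H (V\<^sub>0 f) (V\<^sub>0 f) \<le> 2 * ((1 / sqrt (\<rho> 0)) * L2_inner N f f)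
       + 2 * ((kernel_sup\<^sup>2 * measure N (space N) * measure H (space H)) * L2_inner N f f)"
      using L2_norm_add_bound[OF transport.comp_L2(1)[OF f] ker.apply_L2[OF f]]
        transport.comp_L2(2)[OF f] ker.apply_norm_bound[OF f]
      unfolding V\<^sub>0_def[abs_def] by linarith
    then show ?thesis by (simp add: algebra_simps)
  qed
  then show ?thesis
    unfolding L2_bounded_linear_def
    using V\<^sub>0_L2 V\<^sub>0_lincomb by (auto simp: L2_eq_def intro!: AE_I2)
qed

lemma V\<^sub>0_adjoint:
  assumes g: "g \<in> L2 H"
  shows "\<exists>w\<in>L2 N. \<forall>f\<in>L2 N. L2_inner H (V\<^sub>0 f) g = L2_inner N f w"
proof -
  obtain w where w: "w \<in> L2 N" "\<And>f. f \<in> L2 N \<Longrightarrow> L2_inner H (\<lambda>x. front x * f (T - tau \<rho> x)) g = L2_inner N f w"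
    using transport.comp_adjoint[OF g] by blast
  let ?v = "\<lambda>s. LINT x|H. kernel x s * g x"
  interpret t: bounded_kernel N H "\<lambda>s x. kernel x s" kernel_sup by (rule ker.transpose)
  have v: "?v \<in> L2 N" by (rule t.apply_L2[OF g])
  show ?thesis
  proof (intro bexI ballI)
    show wv: "(\<lambda>s. w s + ?v s) \<in> L2 N" by (rule L2_add[OF w(1) v])
    fix f assume f: "f \<in> L2 N"
    have "L2_inner H (V\<^sub>0 f) g = L2_inner N f w + L2_inner N f ?v"
      using L2_inner_lincomb[OF transport.comp_L2(1)[OF f] ker.apply_L2[OF f] g, of 1 1]
      by (simp add: V\<^sub>0_def[abs_def] w(2)[OF f] ker.duality[OF f g])
    also have "\<dots> = L2_inner N f (\<lambda>s. w s + ?v s)"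
      using L2_inner_lincomb[OF w(1) v f, of 1 1]
      by (simp add: L2_inner_commute[of N f w] L2_inner_commute[of N f ?v] L2_inner_commute[of N f "\<lambda>s. w s + ?v s"])
    finally show "L2_inner H (V\<^sub>0 f) g = L2_inner N f (\<lambda>s. w s + ?v s)" .
  qed
qed

text \<open>Integration by parts. The boundary term at \<open>s = T - \<tau>(x)\<close> takes \<open>r\<close> on its front and becomes
\<open>c(x) f(T - \<tau>(x))\<close>; the one at \<open>s = 0\<close> vanishes with \<open>f(0)\<close>.\<close>

lemma V\<^sub>0_H1:
  assumes fg: "has_H1_derivative T f g" "f 0 = 0" and x: "x \<in> {0..X}"
  shows "V\<^sub>0 f x = control_op \<rho> r T g x"
proof -
  define S where "S = T - tau \<rho> x"
  have S: "0 \<le> S" "S \<le> T" using x tau_image tau_nonneg by (auto simp: S_def)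
  have xpos: "0 \<le> x" using x by simp
  have "(LBINT s:{0..S}. r x (T - s) * g s) = r x (T - S) * f S - (LBINT s:{0..S}. - r_t x (T - s) * f s)"
  proof (rule integral_by_parts_primitive[OF S(1)])
    show "g \<in> L2 (F_measure S)" using fg S L2_F_mono by (auto simp: has_H1_derivative_def)
    show "f t = (LBINT s:{0..t}. g s)" if "t \<in> {0..S}" for t
      using fg that S by (auto simp: has_H1_derivative_def)
    show "((\<lambda>s. r x (T - s)) has_real_derivative - r_t x (T - s)) (at s within {0..S})"
      if s: "s \<in> {0..S}" for s
    proof -
      have "((\<lambda>t. r x t) has_real_derivative r_t x (T - s)) (at (T - s) within (\<lambda>s. T - s) ` {0..S})"
        by (rule has_field_derivative_subset[OF r_has_derivative[OF xpos]]) (use s in \<open>auto simp: S_def\<close>)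
      moreover have "((\<lambda>s. T - s) has_real_derivative - 1) (at s within {0..S})"
        by (auto intro!: derivative_eq_intros)
      ultimately show ?thesis using DERIV_image_chain[of "\<lambda>t. r x t" _ "\<lambda>s. T - s" s "{0..S}" "-1"]
        by (simp add: comp_def)
    qed
    have "continuous_on {0..S} (\<lambda>s. (case (x, T - s) of (x, t) \<Rightarrow> r_t x t))"
      by (rule continuous_on_compose2[OF r_t_cont])
        (use xpos in \<open>auto intro!: continuous_intros simp: \<Omega>_def S_def\<close>)
    then show "continuous_on {0..S} (\<lambda>s. - r_t x (T - s))" by (auto intro: continuous_intros)
  qed
  moreover have "(LBINT s:{0..S}. - r_t x (T - s) * f s) = - (LINT s|N. kernel x s * f s)"
  proof -
    have "(LINT s|N. kernel x s * f s) = (LBINT s:{0..S}. r_t x (T - s) * f s)"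
      unfolding integral_F_measure set_lebesgue_integral_def
      using x S by (intro Bochner_Integration.integral_cong) (auto simp: indicator_def kernel_def S_def)
    then show ?thesis by (simp add: set_lebesgue_integral_def)
  qed
  ultimately show ?thesis
    by (simp add: V\<^sub>0_def control_op_def wave_def S_def front_def)
qed

section \<open>The extended control operator is an isomorphism\<close>

lemma control_ddt_spec:
  "L2_bounded_linear N H (control_ddt \<rho> r T)"
  "has_H1_derivative T f g \<Longrightarrow> f 0 = 0 \<Longrightarrow> L2_eq H (control_ddt \<rho> r T f) (control_op \<rho> r T g)"
proof -
  let ?P = "\<lambda>V. L2_bounded_linear N H V \<and>
        (\<forall>f g. has_H1_derivative T f g \<and> f 0 = 0 \<longrightarrow> L2_eq H (V f) (control_op \<rho> r T g))"
  have "?P V\<^sub>0" using V\<^sub>0_bounded_linear V\<^sub>0_H1 by (auto simp: L2_eq_def intro!: AE_I2)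
  then have "?P (control_ddt \<rho> r T)" unfolding control_ddt_def by (rule someI[of ?P])
  then show "L2_bounded_linear N H (control_ddt \<rho> r T)"
    "has_H1_derivative T f g \<Longrightarrow> f 0 = 0 \<Longrightarrow> L2_eq H (control_ddt \<rho> r T f) (control_op \<rho> r T g)"
    by blast+
qed

text \<open>Both operators are bounded and agree on bumps.\<close>

lemma control_ddt_eq_V\<^sub>0:
  assumes "f \<in> L2 N"
  shows "L2_eq H (control_ddt \<rho> r T f) (V\<^sub>0 f)"
proof (rule L2_bounded_linear_unique[OF control_ddt_spec(1) V\<^sub>0_bounded_linear T_pos assms])
  fix \<epsilon> a b :: real assume "0 < \<epsilon>" "0 < a"
  then obtain g where "has_H1_derivative T (bump \<epsilon> a b) g" "bump \<epsilon> a b 0 = 0"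
    using bump_derivative[of \<epsilon> a b T] by (metis less_imp_le)
  note g = this
  have "L2_eq H (control_op \<rho> r T g) (V\<^sub>0 (bump \<epsilon> a b))"
    using V\<^sub>0_H1[OF g] by (auto simp: L2_eq_def)
  with control_ddt_spec(2)[OF g]
  show "L2_eq H (control_ddt \<rho> r T (bump \<epsilon> a b)) (V\<^sub>0 (bump \<epsilon> a b))"
    by (rule L2_eq_trans)
qed

text \<open>The kernel of \<open>V\<^sub>0\<close> in the variable \<open>s = T - \<tau>(x)\<close>, divided by the weight of the leading term and brought
to the right-hand side.\<close>

definition vol_kernel :: "real \<Rightarrow> real \<Rightarrow> real" where
  "vol_kernel s \<sigma> = - kernel (tau_inv \<rho> (T - s)) \<sigma> / front (tau_inv \<rho> (T - s))"

lemma inverse_front_bounded: "\<exists>B. \<forall>x\<in>{0..X}. \<bar>1 / front x\<bar> \<le> B"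
proof -
  have "continuous_on {0..X} (\<lambda>x. 1 / front x)"
    by (intro continuous_intros front_cont) (use front_nonzero in auto)
  then obtain B where "0 \<le> B" "\<And>x. x \<in> {0..X} \<Longrightarrow> norm (1 / front x) \<le> B"
    by (rule continuous_on_compact_bound[OF compact_Icc]) (blast intro: that)
  then show ?thesis by (intro exI[of _ B] ballI) simp
qed

definition vol_sup :: real where
  "vol_sup = kernel_sup * (SOME B. \<forall>x\<in>{0..X}. \<bar>1 / front x\<bar> \<le> B)"

sublocale vol: volterra_kernel T vol_kernel vol_sup
proof -
  interpret N: finite_measure N by (rule finite_measure_F)
  show "volterra_kernel T vol_kernel vol_sup"
  proof
    have "(\<lambda>p. (tau_inv \<rho> (T - fst p), snd p)) \<in> measurable (N \<Otimes>\<^sub>M N) (H \<Otimes>\<^sub>M N)"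
      using measurable_compose[OF measurable_fst front_inv_measurable] measurable_snd
      by (rule measurable_Pair)
    from measurable_compose[OF this ker.kernel_measurable]
    have k: "(\<lambda>p. kernel (tau_inv \<rho> (T - fst p)) (snd p)) \<in> borel_measurable (N \<Otimes>\<^sub>M N)" by simp
    have f: "(\<lambda>p. front (tau_inv \<rho> (T - fst p))) \<in> borel_measurable (N \<Otimes>\<^sub>M N)"
      using measurable_compose[OF measurable_fst measurable_compose[OF front_inv_measurable continuous_measurable_H[OF front_cont]]] .
    show "(\<lambda>(s, \<sigma>). vol_kernel s \<sigma>) \<in> borel_measurable (N \<Otimes>\<^sub>M N)"
      unfolding vol_kernel_def case_prod_beta using k f by (intro borel_measurable_divide borel_measurable_uminus)
    show "\<bar>vol_kernel s \<sigma>\<bar> \<le> vol_sup" if "s \<in> space N" "\<sigma> \<in> space N" for s \<sigma>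
    proof -
      have "\<bar>1 / front (tau_inv \<rho> (T - s))\<bar> \<le> (SOME B. \<forall>x\<in>{0..X}. \<bar>1 / front x\<bar> \<le> B)"
        using someI_ex[OF inverse_front_bounded] front_inv_mem[of s] that by auto
      then have "\<bar>kernel (tau_inv \<rho> (T - s)) \<sigma>\<bar> * \<bar>1 / front (tau_inv \<rho> (T - s))\<bar> \<le> vol_sup"
        unfolding vol_sup_def using kernel_sup[of "tau_inv \<rho> (T - s)" \<sigma>] by (intro mult_mono) auto
      then show ?thesis by (simp add: vol_kernel_def abs_mult)
    qed
    show "vol_kernel s \<sigma> = 0" if "s \<in> {0..T}" "\<sigma> \<in> {0..T}" "s < \<sigma>" for s \<sigma>
      using that tau_inv(2)[of "T - s"] by (simp add: vol_kernel_def kernel_def)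
  qed (rule T_pos)
qed

lemma V\<^sub>0_eq_volterra:
  assumes s: "s \<in> {0..T}"
  shows "V\<^sub>0 f (tau_inv \<rho> (T - s)) = front (tau_inv \<rho> (T - s)) * (f s - vol.volterra f s)"
proof -
  let ?x = "tau_inv \<rho> (T - s)"
  have x: "T - tau \<rho> ?x = s" "front ?x \<noteq> 0"
    using tau_inv[of "T - s"] s front_nonzero by auto
  have "(\<lambda>\<sigma>. kernel ?x \<sigma> * f \<sigma>) = (\<lambda>\<sigma>. - front ?x * (vol_kernel s \<sigma> * f \<sigma>))"
    using x(2) by (auto simp: vol_kernel_def)
  then have "(LINT \<sigma>|N. kernel ?x \<sigma> * f \<sigma>) = - front ?x * vol.volterra f s"
    unfolding vol.volterra_def by (metis integral_mult_right_zero)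
  then show ?thesis by (simp add: V\<^sub>0_def x(1) algebra_simps)
qed

text \<open>The inhomogeneity of the Volterra equation is \<open>y/c\<close> in the variable \<open>s\<close>. Since \<open>c\<^sup>2\<close> is a
constant times the density of the change of variable, it is, up to a constant, the image of \<open>y\<close> under
the adjoint of the leading term, and so it is known to be in \<open>L\<^sub>2\<close>.\<close>

theorem V\<^sub>0_surj:
  assumes y: "y \<in> L2 H"
  obtains f where "f \<in> L2 N" "L2_eq H (V\<^sub>0 f) y"
proof -
  \<comment> \<open>the image of \<open>y\<close> under the adjoint of the weighted composition\<close>
  define w where "w s = front (tau_inv \<rho> (T - s)) / (1 / sqrt (\<rho> (tau_inv \<rho> (T - s)))) * y (tau_inv \<rho> (T - s))" for s
  have "w \<in> L2 N" using transport.comp_adjoint(1)[OF y] by (simp add: w_def[abs_def])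
  then have "(\<lambda>s. sqrt (\<rho> 0) * w s) \<in> L2 N" by (rule L2_scale)
  then obtain f where f: "f \<in> L2 N" "\<And>s. s \<in> {0..T} \<Longrightarrow> f s = sqrt (\<rho> 0) * w s + vol.volterra f s"
    using vol.volterra_solvable by blast
  have "V\<^sub>0 f x = y x" if x: "x \<in> {0..X}" for x
  proof -
    have s: "T - tau \<rho> x \<in> {0..T}" using x tau_image by auto
    have "V\<^sub>0 f x = front x * (sqrt (\<rho> 0) * w (T - tau \<rho> x))"
      using V\<^sub>0_eq_volterra[OF s, of f] f(2)[OF s] tau_inv_tau[of x] x by simp
    also have "\<dots> = (front x)\<^sup>2 * sqrt (\<rho> 0) * sqrt (\<rho> x) * y x"
      using tau_inv_tau[of x] x by (simp add: w_def power2_eq_square)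
    also have "\<dots> = y x" using x \<rho>_pos[of 0] \<rho>_pos[of x] by (simp add: front_square)
    finally show ?thesis .
  qed
  then have "L2_eq H (V\<^sub>0 f) y" by (auto simp: L2_eq_def)
  with f(1) show ?thesis by (rule that)
qed

theorem V\<^sub>0_inj:
  assumes f: "f \<in> L2 N" and zero: "L2_eq H (V\<^sub>0 f) (\<lambda>_. 0)"
  shows "L2_eq N f (\<lambda>_. 0)"
proof -
  have ae: "AE s in N. V\<^sub>0 f (tau_inv \<rho> (T - s)) = 0"
    by (rule transport.AE_transport) (use L2_measurable[OF V\<^sub>0_L2[OF f]] zero in \<open>auto simp: L2_eq_def\<close>)
  have "AE s in N. f s = vol.volterra f s"
  proof (rule AE_mp[OF ae], rule AE_I2, rule impI)
    fix s assume "s \<in> space N" and z: "V\<^sub>0 f (tau_inv \<rho> (T - s)) = 0"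
    then have s: "s \<in> {0..T}" by simp
    then show "f s = vol.volterra f s"
      using V\<^sub>0_eq_volterra[OF s, of f] z front_nonzero[of "tau_inv \<rho> (T - s)"] tau_inv[of "T - s"] by simp
  qed
  then show ?thesis using vol.volterra_fixpoint_zero[OF f] by (simp add: L2_eq_def)
qed

lemma control_ddt_L2: "f \<in> L2 N \<Longrightarrow> control_ddt \<rho> r T f \<in> L2 H"
  by (rule L2_bounded_linear_L2[OF control_ddt_spec(1)])

lemma control_ddt_surj:
  assumes "y \<in> L2 H"
  obtains f where "f \<in> L2 N" "L2_eq H (control_ddt \<rho> r T f) y"
  using V\<^sub>0_surj[OF assms] control_ddt_eq_V\<^sub>0 L2_eq_trans by metis

lemma control_ddt_inj:
  assumes f: "f \<in> L2 N" and g: "g \<in> L2 N"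
    and eq: "L2_eq H (control_ddt \<rho> r T f) (control_ddt \<rho> r T g)"
  shows "L2_eq N f g"
proof -
  have d: "(\<lambda>s. f s - g s) \<in> L2 N" by (rule L2_diff[OF f g])
  have "L2_eq H (V\<^sub>0 (\<lambda>s. f s - g s)) (\<lambda>_. 0)"
    using control_ddt_eq_V\<^sub>0[OF d] L2_bounded_linear_diff[OF control_ddt_spec(1) f g] eq
    unfolding L2_eq_def by eventually_elim simp
  from V\<^sub>0_inj[OF d this] show ?thesis by (simp add: L2_eq_def)
qed

lemma control_ddt_adjoint:
  assumes g: "g \<in> L2 H"
  shows "L2_adjoint N H (control_ddt \<rho> r T) g \<in> L2 N"
    and "f \<in> L2 N \<Longrightarrow> L2_inner H (control_ddt \<rho> r T f) g
      = L2_inner N f (L2_adjoint N H (control_ddt \<rho> r T) g)"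
proof -
  obtain w where w: "w \<in> L2 N" "\<And>f. f \<in> L2 N \<Longrightarrow> L2_inner H (V\<^sub>0 f) g = L2_inner N f w"
    using V\<^sub>0_adjoint[OF g] by blast
  have "L2_inner H (control_ddt \<rho> r T f) g = L2_inner N f w" if f: "f \<in> L2 N" for f
    using L2_inner_cong[OF control_ddt_eq_V\<^sub>0[OF f] L2_eq_refl control_ddt_L2[OF f] V\<^sub>0_L2[OF f] g g] w(2)[OF f]
    by simp
  from L2_adjoint_works[OF w(1) this]
  show "L2_adjoint N H (control_ddt \<rho> r T) g \<in> L2 N"
    and "f \<in> L2 N \<Longrightarrow> L2_inner H (control_ddt \<rho> r T f) g
      = L2_inner N f (L2_adjoint N H (control_ddt \<rho> r T) g)" by auto
qed

section \<open>The response operator\<close>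

definition response_kernel :: "real \<Rightarrow> real \<Rightarrow> real" where
  "response_kernel t s = (if 0 \<le> s \<and> s \<le> t \<and> t \<le> T then r 0 (t - s) else 0)"

lemma response_kernel: "\<exists>B. bounded_kernel N N response_kernel B"
proof -
  define D where "D = {p :: real \<times> real. 0 \<le> snd p \<and> snd p \<le> fst p \<and> fst p \<le> T}"
  have "closed D" unfolding D_def by (intro closed_Collect_conj closed_Collect_le continuous_intros)
  then have "compact (({0..T} \<times> {0..T}) \<inter> D)" by (intro compact_Int_closed compact_Times) auto
  moreover have "({0..T} \<times> {0..T}) \<inter> D = D" by (auto simp: D_def)
  ultimately have D: "compact D" by simp
  have cont: "continuous_on D (\<lambda>p. r 0 (fst p - snd p))"
  proof -
    have "continuous_on D (\<lambda>p. (case (0, fst p - snd p) of (x, t) \<Rightarrow> r x t))"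
      by (rule continuous_on_compose2[OF r_cont]) (auto intro!: continuous_intros simp: D_def \<Omega>_def tau_0)
    then show ?thesis by simp
  qed
  have eq: "response_kernel (fst p) (snd p) = indicator D p *\<^sub>R r 0 (fst p - snd p)" for p
    by (auto simp: response_kernel_def D_def)
  have meas: "(\<lambda>p. response_kernel (fst p) (snd p)) \<in> borel_measurable borel"
    unfolding eq by (intro borel_measurable_continuous_on_indicator cont) (simp add: borel_compact D)
  obtain b where b: "0 \<le> b" "\<And>p. p \<in> D \<Longrightarrow> norm (r 0 (fst p - snd p)) \<le> b"
    by (rule continuous_on_compact_bound[OF D cont]) (blast intro: that)
  interpret N: finite_measure N by (rule finite_measure_F)
  have "bounded_kernel N N response_kernel b"
  proof
    show "(\<lambda>(t, s). response_kernel t s) \<in> borel_measurable (N \<Otimes>\<^sub>M N)"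
      unfolding case_prod_beta by (rule borel_pair_measurable[OF meas ident_measurable_F ident_measurable_F])
    show "\<bar>response_kernel t s\<bar> \<le> b" for t s
      using b(1) b(2)[of "(t, s)"] by (auto simp: response_kernel_def D_def)
  qed
  then show ?thesis by blast
qed

lemma response_op_eq:
  assumes "t \<in> {0..T}"
  shows "response_op \<rho> r f t = (LINT s|N. response_kernel t s * f s)"
  unfolding response_op_def wave_def integral_F_measure set_lebesgue_integral_def tau_0
  using assms by (intro Bochner_Integration.integral_cong) (auto simp: indicator_def response_kernel_def)

text \<open>Here \<open>R\<^sup>* 1\<close> is obtained from \<open>R\<close> by integrating the kernel over the other variable.\<close>

lemma response_adjoint_one:
  shows "response_adj \<rho> r T (\<lambda>_. 1) \<in> L2 N"
    and "f \<in> L2 N \<Longrightarrow> L2_inner N f (response_adj \<rho> r T (\<lambda>_. 1))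
      = L2_inner N f (\<lambda>s. LINT t|N. response_kernel t s)"
proof -
  obtain B where "bounded_kernel N N response_kernel B" using response_kernel by blast
  then interpret R: bounded_kernel N N response_kernel B .
  interpret Rt: bounded_kernel N N "\<lambda>s t. response_kernel t s" B by (rule R.transpose)
  have one: "(\<lambda>_. 1) \<in> L2 N" by (rule L2_F_bounded[where B = 1]) auto
  let ?w = "\<lambda>s. LINT t|N. response_kernel t s"
  have w: "?w \<in> L2 N" using Rt.apply_L2[OF one] by simp
  have adj: "L2_inner N (response_op \<rho> r f) (\<lambda>_. 1) = L2_inner N f ?w" if f: "f \<in> L2 N" for f
  proof -
    have "L2_inner N (response_op \<rho> r f) (\<lambda>_. 1) = L2_inner N (\<lambda>t. LINT s|N. response_kernel t s * f s) (\<lambda>_. 1)"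
      unfolding L2_inner_def by (intro Bochner_Integration.integral_cong refl) (simp add: response_op_eq)
    also have "\<dots> = L2_inner N f ?w" using R.duality[OF f one] by simp
    finally show ?thesis .
  qed
  show "response_adj \<rho> r T (\<lambda>_. 1) \<in> L2 N"
    unfolding response_adj_def by (rule L2_adjoint_works(1)[OF w adj])
  show "f \<in> L2 N \<Longrightarrow> L2_inner N f (response_adj \<rho> r T (\<lambda>_. 1)) = L2_inner N f ?w"
    unfolding response_adj_def using L2_adjoint_works(2)[OF w adj] adj by simp
qed

definition r_primitive :: "real \<Rightarrow> real" where
  "r_primitive u = (LBINT t:{0..u}. r 0 t)"

lemma r_0_cont: "continuous_on {0..} (r 0)"
proof -
  have "continuous_on {0..} (\<lambda>t. (case (0, t) of (x, t) \<Rightarrow> r x t))"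
    by (rule continuous_on_compose2[OF r_cont]) (auto intro!: continuous_intros simp: \<Omega>_def tau_0)
  then show ?thesis by simp
qed

lemma integral_response_kernel:
  assumes s: "s \<in> {0..T}"
  shows "(LINT t|N. response_kernel t s) = r_primitive (T - s)"
proof -
  have "(LINT t|N. response_kernel t s) = (LBINT t. indicator {0..T} t *\<^sub>R response_kernel t s)"
    by (simp add: integral_F_measure set_lebesgue_integral_def)
  also have "\<dots> = (LBINT u. indicator {0..T} (s + 1 * u) *\<^sub>R response_kernel (s + 1 * u) s)"
    using lborel_integral_real_affine[of 1 "\<lambda>t. indicator {0..T} t *\<^sub>R response_kernel t s" s] by simp
  also have "\<dots> = r_primitive (T - s)"
    unfolding r_primitive_def set_lebesgue_integral_def
    using s by (intro Bochner_Integration.integral_cong) (auto simp: indicator_def response_kernel_def)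
  finally show ?thesis .
qed

text \<open>Both sides are \<open>\<integral> f(s) \<integral>\<^sub>0 r(0,t) dt ds\<close> with the inner integral up to \<open>T - s\<close>; on the right this
results from integrating by parts and reflecting the time.\<close>

lemma pairing_response:
  assumes f: "continuous_on UNIV f" and F: "\<And>x. (F has_real_derivative f x) (at x)" "F 0 = 0"
  shows "L2_inner N f (\<lambda>s. LINT t|N. response_kernel t s) = (LBINT t:{0..T}. r 0 t * F (T - t))"
proof -
  have cont: "continuous_on {0..T} (r 0)" by (rule continuous_on_subset[OF r_0_cont]) auto
  have rL: "r 0 \<in> L2 N" by (rule continuous_on_L2_F[OF cont])
  have "(LBINT t:{0..T}. F (T - t) * r 0 t) = F (T - T) * r_primitive T - (LBINT t:{0..T}. - f (T - t) * r_primitive t)"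
  proof (rule integral_by_parts_primitive[OF _ rL])
    show "((\<lambda>t. F (T - t)) has_real_derivative - f (T - t)) (at t within {0..T})" for t
    proof (rule has_field_derivative_at_within)
      have "((\<lambda>t. T - t) has_real_derivative - 1) (at t)" by (auto intro!: derivative_eq_intros)
      from DERIV_chain2[OF F(1) this] show "((\<lambda>t. F (T - t)) has_real_derivative - f (T - t)) (at t)" by simp
    qed
    show "continuous_on {0..T} (\<lambda>t. - f (T - t))"
      by (intro continuous_intros continuous_on_compose2[OF f]) auto
  qed (use T_pos in \<open>auto simp: r_primitive_def\<close>)
  also have "\<dots> = (LBINT t. indicator {0..T} t * (f (T - t) * r_primitive t))"
    by (simp add: F(2) set_lebesgue_integral_def)
  also have "\<dots> = (LBINT s. indicator {0..T} (T - s) * (f (T - (T - s)) * r_primitive (T - s)))"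
    by (rule reflect_integral)
  also have "\<dots> = (LBINT s. indicator {0..T} s * (f s * (LINT t|N. response_kernel t s)))"
    by (intro Bochner_Integration.integral_cong) (auto simp: indicator_def integral_response_kernel)
  also have "\<dots> = L2_inner N f (\<lambda>s. LINT t|N. response_kernel t s)"
    by (simp add: L2_inner_def integral_F_measure set_lebesgue_integral_def)
  finally show ?thesis by (simp add: mult.commute)
qed

end

section \<open>Boundary values of solutions of the ordinary differential equation\<close>

lemma bounded_derivative_imp_right_limit:
  fixes f :: "real \<Rightarrow> real"
  assumes "0 < m" and f: "\<And>x. x \<in> {0<..<m} \<Longrightarrow> (f has_real_derivative f' x) (at x)"
    and f': "\<And>x. x \<in> {0<..<m} \<Longrightarrow> \<bar>f' x\<bar> \<le> C"
  obtains l where "(f \<longlongrightarrow> l) (at_right 0)"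
proof -
  have "0 \<le> C" using f'[of "m/2"] \<open>0 < m\<close> by auto
  have "C-lipschitz_on {0<..<m} f"
  proof (rule lipschitz_onI)
    fix x y assume xy: "x \<in> {0<..<m}" "y \<in> {0<..<m}"
    have "norm (f x - f y) \<le> C * norm (x - y)"
    proof (rule field_differentiable_bound[of "{0<..<m}" f f'])
      show "(f has_real_derivative f' z) (at z within {0<..<m})" if "z \<in> {0<..<m}" for z
        by (rule has_field_derivative_at_within[OF f[OF that]])
    qed (use xy f' in auto)
    then show "dist (f x) (f y) \<le> C * dist x y" by (simp add: dist_norm)
  qed fact
  then have "uniformly_continuous_on {0<..<m} f" by (rule lipschitz_on_uniformly_continuous)
  moreover have "0 \<in> closure {0<..<m}" using \<open>0 < m\<close> by simp
  ultimately obtain l where "(f \<longlongrightarrow> l) (at 0 within {0<..<m})"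
    by (rule uniformly_continuous_on_extension_at_closure)
  moreover have "at 0 within {0<..<m} = at_right 0"
    by (rule at_within_nhd[of _ "{-1<..<m}"]) (use \<open>0 < m\<close> in auto)
  ultimately show ?thesis using that by simp
qed

text \<open>A Gronwall argument: with \<open>\<bar>q\<bar> \<le> Q\<close>, the function \<open>(y\<^sup>2 + y'\<^sup>2) exp((1 + Q) x)\<close> is nondecreasing, so
\<open>y\<close> and \<open>y'\<close> stay bounded as \<open>x\<close> decreases to \<open>0\<close>. Then \<open>y'\<close> and \<open>y'' = q y\<close> are bounded, and the
limits exist.\<close>

lemma linear_ode_right_limits:
  fixes y y' q :: "real \<Rightarrow> real"
  assumes "0 < a" and q: "continuous_on {0..} q"
    and y: "\<And>x. x \<in> {0<..<a} \<Longrightarrow> (y has_real_derivative y' x) (at x)"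
    and y': "\<And>x. x \<in> {0<..<a} \<Longrightarrow> (y' has_real_derivative q x * y x) (at x)"
  obtains y\<^sub>0 y\<^sub>1 where "(y \<longlongrightarrow> y\<^sub>0) (at_right 0)" "(y' \<longlongrightarrow> y\<^sub>1) (at_right 0)"
proof -
  define m where "m = a / 2"
  have m: "0 < m" "m < a" using \<open>0 < a\<close> by (auto simp: m_def)
  have "continuous_on {0..m} q" by (rule continuous_on_subset[OF q]) auto
  then obtain Q where Q0: "0 \<le> Q" and Q: "\<And>x. x \<in> {0..m} \<Longrightarrow> norm (q x) \<le> Q"
    by (rule continuous_on_compact_bound[OF compact_Icc]) (blast intro: that)
  have qQ: "\<bar>q x\<bar> \<le> Q" if "x \<in> {0..m}" for x using Q[OF that] by simp
  define G where "G x = ((y x)\<^sup>2 + (y' x)\<^sup>2) * exp ((1 + Q) * x)" for x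
  have G_deriv: "(G has_real_derivative
      (2 * (y x * y' x) * (1 + q x) + (1 + Q) * ((y x)\<^sup>2 + (y' x)\<^sup>2)) * exp ((1 + Q) * x)) (at x)"
    if "x \<in> {0<..<a}" for x
    unfolding G_def using that
    by (auto intro!: derivative_eq_intros y y' simp: algebra_simps power2_eq_square)
  have G_mono: "G x \<le> G m" if x: "x \<in> {0<..<m}" for x
  proof (rule DERIV_nonneg_imp_nondecreasing[of x m G])
    fix z assume z: "x \<le> z" "z \<le> m"
    have "\<bar>2 * (y z * y' z) * (1 + q z)\<bar> \<le> ((y z)\<^sup>2 + (y' z)\<^sup>2) * (1 + Q)"
      unfolding abs_mult[of "2 * (y z * y' z)"]
    proof (rule mult_mono)
      show "\<bar>2 * (y z * y' z)\<bar> \<le> (y z)\<^sup>2 + (y' z)\<^sup>2"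
        using sum_squares_bound[of "y z" "y' z"] sum_squares_bound[of "- y z" "y' z"]
        by (simp add: abs_le_iff mult.assoc)
      show "\<bar>1 + q z\<bar> \<le> 1 + Q" using qQ[of z] z x by auto
    qed auto
    then have "0 \<le> 2 * (y z * y' z) * (1 + q z) + (1 + Q) * ((y z)\<^sup>2 + (y' z)\<^sup>2)"
      by (simp add: mult.commute)
    then show "\<exists>d. (G has_real_derivative d) (at z) \<and> 0 \<le> d"
      using G_deriv[of z] z x m
      by (intro exI[of _ "(2 * (y z * y' z) * (1 + q z) + (1 + Q) * ((y z)\<^sup>2 + (y' z)\<^sup>2)) * exp ((1 + Q) * z)"]) auto
  qed (use x in auto)
  have bound: "(y x)\<^sup>2 + (y' x)\<^sup>2 \<le> G m" if x: "x \<in> {0<..<m}" for x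
  proof -
    have "((y x)\<^sup>2 + (y' x)\<^sup>2) * 1 \<le> G x"
      unfolding G_def using x Q0 by (intro mult_left_mono) auto
    with G_mono[OF x] show ?thesis by simp
  qed
  have bounds: "\<bar>y x\<bar> \<le> sqrt (G m)" "\<bar>y' x\<bar> \<le> sqrt (G m)" if x: "x \<in> {0<..<m}" for x
  proof -
    have "(y x)\<^sup>2 \<le> G m" "(y' x)\<^sup>2 \<le> G m"
      using bound[OF x] zero_le_power2[of "y x"] zero_le_power2[of "y' x"] by linarith+
    then show "\<bar>y x\<bar> \<le> sqrt (G m)" "\<bar>y' x\<bar> \<le> sqrt (G m)"
      by (auto intro!: real_le_rsqrt)
  qed
  obtain y\<^sub>0 where "(y \<longlongrightarrow> y\<^sub>0) (at_right 0)"
    by (rule bounded_derivative_imp_right_limit[OF m(1), of y y' "sqrt (G m)"]) (use y bounds m in auto)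
  moreover obtain y\<^sub>1 where "(y' \<longlongrightarrow> y\<^sub>1) (at_right 0)"
  proof (rule bounded_derivative_imp_right_limit[OF m(1), of y' "\<lambda>x. q x * y x" "Q * sqrt (G m)"])
    show "\<bar>q x * y x\<bar> \<le> Q * sqrt (G m)" if "x \<in> {0<..<m}" for x
      unfolding abs_mult using that qQ[of x] bounds[OF that] Q0 by (intro mult_mono) auto
  qed (use y' m in auto)
  ultimately show ?thesis by (rule that)
qed

lemma right_derivative_from_limit:
  fixes f f' :: "real \<Rightarrow> real"
  assumes "0 < a" and f: "\<And>x. x \<in> {0<..<a} \<Longrightarrow> (f has_real_derivative f' x) (at x)"
    and l: "(f \<longlongrightarrow> l) (at_right 0)" and d: "(f' \<longlongrightarrow> d) (at_right 0)"
  shows "((\<lambda>x. if x \<le> 0 then l else f x) has_real_derivative d) (at 0 within {0..<a})"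
proof -
  have ev: "\<forall>\<^sub>F x in at_right 0. x \<in> {0<..<a}"
    using \<open>0 < a\<close> by (auto simp: eventually_at_right_field)
  have "((\<lambda>x. (f x - l) / x) \<longlongrightarrow> d) (at_right 0)"
  proof (rule lhopital_right_0[where f' = f' and g' = "\<lambda>_. 1"])
    show "((\<lambda>x. f x - l) \<longlongrightarrow> 0) (at_right 0)" using l by (simp add: LIM_zero)
    show "\<forall>\<^sub>F x in at_right 0. ((\<lambda>x. f x - l) has_real_derivative f' x) (at x)"
      using ev by eventually_elim (auto intro!: derivative_eq_intros f)
    show "\<forall>\<^sub>F x :: real in at_right 0. x \<noteq> 0" using ev by eventually_elim auto
  qed (use d in \<open>auto intro!: derivative_eq_intros\<close>)
  then have "((\<lambda>x. ((if x \<le> 0 then l else f x) - l) / x) \<longlongrightarrow> d) (at_right 0)"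
    by (rule Lim_transform_eventually) (use ev in \<open>auto elim: eventually_mono\<close>)
  moreover have "at 0 within {0..<a} = at_right 0"
    by (rule at_within_nhd[of _ "{-1<..<a}"]) (use \<open>0 < a\<close> in auto)
  ultimately show ?thesis by (simp add: has_field_derivative_iff)
qed

section \<open>Test functions of product form\<close>

lemma smooth_partials_product:
  assumes E: "deriv_seq {0..} E" and P: "deriv_seq UNIV P"
  shows "smooth_partials ({0..} \<times> UNIV) (\<lambda>i j p. E i (fst p) * P j (snd p))"
  unfolding smooth_partials_def
proof (intro allI ballI)
  fix i j and p :: "real \<times> real" assume p: "p \<in> {0..} \<times> UNIV"
  have "(E i has_derivative (\<lambda>h. E (Suc i) (fst p) * h)) (at (fst p) within fst ` ({0..} \<times> (UNIV :: real set)))"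
    using E p by (auto simp: deriv_seq_def has_field_derivative_def)
  from has_derivative_in_compose[OF has_derivative_fst[OF has_derivative_ident] this]
  have 1: "((\<lambda>p. E i (fst p)) has_derivative (\<lambda>h. E (Suc i) (fst p) * fst h)) (at p within {0..} \<times> UNIV)" .
  have "(P j has_derivative (\<lambda>h. P (Suc j) (snd p) * h)) (at (snd p) within snd ` ({0::real..} \<times> (UNIV :: real set)))"
    using P p by (auto simp: deriv_seq_def has_field_derivative_def intro: has_derivative_at_withinI)
  from has_derivative_in_compose[OF has_derivative_snd[OF has_derivative_ident] this]
  have 2: "((\<lambda>p. P j (snd p)) has_derivative (\<lambda>h. P (Suc j) (snd p) * snd h)) (at p within {0..} \<times> UNIV)" .
  from has_derivative_mult[OF 1 2]
  show "((\<lambda>p. E i (fst p) * P j (snd p)) has_derivative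
      (\<lambda>h. fst h * (E (Suc i) (fst p) * P j (snd p)) + snd h * (E i (fst p) * P (Suc j) (snd p))))
      (at p within {0..} \<times> UNIV)"
    by (rule has_derivative_eq_rhs) (simp add: fun_eq_iff algebra_simps)
qed

text \<open>For times \<open>t > -1\<close>, which cover the support of \<open>r\<close>, the test function is \<open>F(T - t)\<close>. It
vanishes for \<open>t \<ge> T - a\<close> by itself, and a smooth step makes it vanish for \<open>t \<le> -2\<close>.\<close>

lemma separated_test_function_time:
  assumes \<epsilon>: "0 < \<epsilon>" and a: "0 < a" and g: "smooth1 UNIV g" "\<And>x. (bump \<epsilon> a b has_real_derivative g x) (at x)"
    and F: "\<And>x. (F has_real_derivative bump \<epsilon> a b x) (at x)" "\<And>x. x \<le> a \<Longrightarrow> F x = 0"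
  obtains P where "deriv_seq UNIV P" "\<And>t. t > -1 \<Longrightarrow> P 0 t = F (T - t)"
    "\<And>t. t > -1 \<Longrightarrow> P 2 t = g (T - t)" "\<And>t. t \<notin> {-2<..<T} \<Longrightarrow> P 0 t = 0"
proof -
  obtain G where G: "\<And>x. G 0 x = g x" "deriv_seq UNIV G"
    using g(1) by (auto simp: smooth1_iff)
  \<comment> \<open>the primitive and the bump are put in front, so that the second derivative is \<open>g\<close> by construction\<close>
  define Q where "Q = case_nat F (case_nat (bump \<epsilon> a b) G)"
  have Q: "deriv_seq UNIV Q"
    unfolding Q_def using F(1) g(2) G by (intro deriv_seq_case_nat) auto
  define R where "R n t = (-1) ^ n * Q n (-1 * t + T)" for n t
  have R: "deriv_seq UNIV R" unfolding R_def by (rule deriv_seq_affine[OF Q])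
  have R02: "R 0 t = F (T - t)" "R 2 t = g (T - t)" for t
    by (simp_all add: R_def Q_def G numeral_2_eq_2)
  obtain L where L: "smooth1 UNIV L" "\<And>x. x \<le> -2 \<Longrightarrow> L x = 0" "\<And>x. x \<ge> -1 \<Longrightarrow> L x = 1"
    using smooth_step[of "-2" "-1"] by auto
  have "smooth1 UNIV (R 0)" using R unfolding smooth1_iff by blast
  then have "smooth1 UNIV (\<lambda>t. R 0 t * L t)" using L(1) by (rule smooth1_mult)
  then obtain P where P: "\<And>t. P 0 t = R 0 t * L t" "deriv_seq UNIV P"
    by (auto simp: smooth1_iff)
  have PR: "P n t = R n t" if "t > -1" for n t
  proof (rule deriv_seq_unique[OF P(2) R, of "{-1<..}"])
    show "at x within {-1<..} \<noteq> bot" if "x \<in> {-1<..}" for x :: real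
      using at_within_open[OF that open_greaterThan] by simp
  qed (use that P L in auto)
  show ?thesis
  proof (rule that[OF P(2)])
    show "P 0 t = 0" if "t \<notin> {-2<..<T}" for t
    proof (cases "t \<le> -2")
      case False
      then have "T - t \<le> a" using that a by auto
      then show ?thesis using F(2) by (simp add: P R02)
    qed (simp add: P L)
  qed (auto simp: PR R02)
qed

locale stationary_state = neumann_control +
  fixes y :: "real \<Rightarrow> real"
  assumes y_L2: "y \<in> L2 (H_measure \<rho> T)"
    and y_ode: "\<And>x. x \<in> {0<..<tau_inv \<rho> T} \<Longrightarrow>
      y differentiable (at x) \<and> deriv y differentiable (at x) \<and> - deriv (deriv y) x + q x * y x = 0"

begin

lemma y_deriv:
  assumes "x \<in> {0<..<X}"
  shows "(y has_real_derivative deriv y x) (at x)" "(deriv y has_real_derivative q x * y x) (at x)"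
  using y_ode[of x] assms by (auto simp: X_def DERIV_deriv_iff_real_differentiable[symmetric])

lemma boundary_limits: "(y \<longlongrightarrow> value_at_0 y) (at_right 0)" "(deriv y \<longlongrightarrow> deriv_at_0 y) (at_right 0)"
proof -
  obtain y\<^sub>0 y\<^sub>1 where l: "(y \<longlongrightarrow> y\<^sub>0) (at_right 0)" "(deriv y \<longlongrightarrow> y\<^sub>1) (at_right 0)"
    using linear_ode_right_limits[OF X(1) smooth1_continuous_on[OF q_smooth] y_deriv] by blast
  then show "(y \<longlongrightarrow> value_at_0 y) (at_right 0)" "(deriv y \<longlongrightarrow> deriv_at_0 y) (at_right 0)"
    unfolding value_at_0_def deriv_at_0_def
    using tendsto_Lim[OF trivial_limit_at_right_real l(1)] tendsto_Lim[OF trivial_limit_at_right_real l(2)] by auto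
qed

text \<open>The state and its derivative, with their limits filled in at \<open>0\<close>, where \<open>y\<close> itself is arbitrary.\<close>

definition Y :: "real \<Rightarrow> real" where "Y x = (if x \<le> 0 then value_at_0 y else y x)"

definition Y' :: "real \<Rightarrow> real" where "Y' x = (if x \<le> 0 then deriv_at_0 y else deriv y x)"

lemma Y_deriv:
  assumes x: "x \<in> {0..<X}"
  shows "(Y has_real_derivative Y' x) (at x within {0..<X})"
    and "(Y' has_real_derivative q x * Y x) (at x within {0..<X})"
proof -
  have "(Y has_real_derivative Y' x) (at x within {0..<X}) \<and>
      (Y' has_real_derivative q x * Y x) (at x within {0..<X})"
  proof (cases "x = 0")
    case True
    have "((\<lambda>x. q x * y x) \<longlongrightarrow> q 0 * value_at_0 y) (at_right 0)"
    proof (rule tendsto_mult[OF _ boundary_limits(1)])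
      have "(q \<longlongrightarrow> q 0) (at 0 within {0..})"
        using smooth1_continuous_on[OF q_smooth] by (auto simp: continuous_on_def)
      then show "(q \<longlongrightarrow> q 0) (at_right 0)" by (rule tendsto_within_subset) auto
    qed
    then show ?thesis
      using right_derivative_from_limit[OF X(1) y_deriv(1) boundary_limits]
        right_derivative_from_limit[OF X(1) y_deriv(2) boundary_limits(2)] True
      by (simp add: Y_def[abs_def] Y'_def[abs_def])
  next
    case False
    with x have x: "x \<in> {0<..<X}" by auto
    have "(Y has_real_derivative Y' x) (at x)"
      by (rule has_field_derivative_transform_within_open[where S = "{0<..<X}" and f = y])
        (use y_deriv(1)[OF x] x in \<open>auto simp: Y_def Y'_def\<close>)
    moreover have "(Y' has_real_derivative q x * Y x) (at x)"
      by (rule has_field_derivative_transform_within_open[where S = "{0<..<X}" and f = "deriv y"])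
        (use y_deriv(2)[OF x] x in \<open>auto simp: Y_def Y'_def\<close>)
    ultimately show ?thesis by (auto intro: has_field_derivative_at_within)
  qed
  then show "(Y has_real_derivative Y' x) (at x within {0..<X})"
    "(Y' has_real_derivative q x * Y x) (at x within {0..<X})" by auto
qed

lemma q_smooth_X: "smooth1 {0..<X} q"
  by (rule smooth1_subset[OF q_smooth]) auto

text \<open>As \<open>Y'' = q Y\<close>, all derivatives of \<open>Y\<close> have the form \<open>a Y + b Y'\<close> with smooth \<open>a\<close> and \<open>b\<close>.\<close>

lemma Y_smooth: "smooth1 {0..<X} Y"
proof (rule smooth1_coinduct[where F = "{\<lambda>x. a x * Y x + b x * Y' x |a b. smooth1 {0..<X} a \<and> smooth1 {0..<X} b}"])
  show "Y \<in> {\<lambda>x. a x * Y x + b x * Y' x |a b. smooth1 {0..<X} a \<and> smooth1 {0..<X} b}"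
    by (rule CollectI, rule exI[of _ "\<lambda>_. 1"], rule exI[of _ "\<lambda>_. 0"]) (simp add: smooth1_const)
next
  fix h assume "h \<in> {\<lambda>x. a x * Y x + b x * Y' x |a b. smooth1 {0..<X} a \<and> smooth1 {0..<X} b}"
  then obtain a b where h: "h = (\<lambda>x. a x * Y x + b x * Y' x)" and ab: "smooth1 {0..<X} a" "smooth1 {0..<X} b"
    by blast
  obtain a' where a': "smooth1 {0..<X} a'" "\<And>x. x \<in> {0..<X} \<Longrightarrow> (a has_real_derivative a' x) (at x within {0..<X})"
    using smooth1_deriv[OF ab(1)] by blast
  obtain b' where b': "smooth1 {0..<X} b'" "\<And>x. x \<in> {0..<X} \<Longrightarrow> (b has_real_derivative b' x) (at x within {0..<X})"
    using smooth1_deriv[OF ab(2)] by blast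
  let ?h' = "\<lambda>x. (a' x + b x * q x) * Y x + (a x + b' x) * Y' x"
  show "\<exists>g'\<in>{\<lambda>x. a x * Y x + b x * Y' x |a b. smooth1 {0..<X} a \<and> smooth1 {0..<X} b}.
      \<forall>x\<in>{0..<X}. (h has_real_derivative g' x) (at x within {0..<X})"
  proof (rule bexI[of _ ?h'])
    show "\<forall>x\<in>{0..<X}. (h has_real_derivative ?h' x) (at x within {0..<X})"
    proof
      fix x assume x: "x \<in> {0..<X}"
      show "(h has_real_derivative ?h' x) (at x within {0..<X})" unfolding h
        using DERIV_add[OF DERIV_mult[OF a'(2)[OF x] Y_deriv(1)[OF x]] DERIV_mult[OF b'(2)[OF x] Y_deriv(2)[OF x]]]
        by (rule DERIV_cong) (simp add: algebra_simps)
    qed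
    have "smooth1 {0..<X} (\<lambda>x. a' x + b x * q x)" "smooth1 {0..<X} (\<lambda>x. a x + b' x)"
      by (intro smooth1_add smooth1_mult a' b' ab q_smooth_X)+
    then show "?h' \<in> {\<lambda>x. a x * Y x + b x * Y' x |a b. smooth1 {0..<X} a \<and> smooth1 {0..<X} b}"
      by (intro CollectI exI[of _ "\<lambda>x. a' x + b x * q x", OF exI[of _ "\<lambda>x. a x + b' x"]] conjI refl)
  qed
qed

text \<open>The state is cut off between \<open>c\<close> and \<open>X\<close>; up to \<open>c\<close> the test function and its derivatives are those
of the state.\<close>

lemma separated_test_function_space:
  assumes "0 \<le> c" "c < X"
  obtains E where "deriv_seq {0..} E" "\<And>x. x \<in> {0..c} \<Longrightarrow> E 0 x = Y x" "E 1 0 = deriv_at_0 y"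
    "\<And>x. x \<in> {0..c} \<Longrightarrow> E 2 x = q x * Y x" "\<And>x. x \<ge> X \<Longrightarrow> E 0 x = 0"
proof -
  \<comment> \<open>\<open>d > c\<close> makes the cutoff constant near \<open>c\<close>, so the derivatives at \<open>c\<close> itself are right, too\<close>
  obtain d e where de: "c < d" "d < e" "e < X" by (meson assms(2) dense)
  obtain h where h: "smooth1 UNIV h" "\<And>x. x \<le> d \<Longrightarrow> h x = 0" "\<And>x. x \<ge> e \<Longrightarrow> h x = 1"
    using smooth_step[OF de(2)] by blast
  have "smooth1 {0..<X} (\<lambda>x. Y x * (1 + (-1) * h x))"
    by (intro smooth1_mult smooth1_add smooth1_const Y_smooth smooth1_subset[OF h(1)]) auto
  then obtain D where D: "\<And>x. x \<in> {0..<X} \<Longrightarrow> D 0 x = Y x * (1 + (-1) * h x)" "deriv_seq {0..<X} D"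
    unfolding smooth1_iff by blast
  have "smooth1 {0..<X} (\<lambda>x. q x * Y x)" by (intro smooth1_mult q_smooth_X Y_smooth)
  then obtain G where G: "\<And>x. x \<in> {0..<X} \<Longrightarrow> G 0 x = q x * Y x" "deriv_seq {0..<X} G"
    unfolding smooth1_iff by blast
  \<comment> \<open>a sequence of derivatives of \<open>Y\<close> whose second term is \<open>q Y\<close> by construction\<close>
  define K where "K = case_nat Y (case_nat Y' G)"
  have K: "deriv_seq {0..<X} K"
    unfolding K_def
  proof (intro deriv_seq_case_nat G(2))
    show "(Y' has_real_derivative G 0 x) (at x within {0..<X})" if "x \<in> {0..<X}" for x
      using Y_deriv(2)[OF that] G(1)[OF that] by simp
    show "(Y has_real_derivative (case 0 of 0 \<Rightarrow> Y' | Suc k \<Rightarrow> G k) x) (at x within {0..<X})" if "x \<in> {0..<X}" for x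
      using Y_deriv(1)[OF that] by simp
  qed
  have DK: "D n x = K n x" if "x \<in> {0..<d}" for n x
  proof (rule deriv_seq_unique[OF D(2) K, of "{0..<d}"])
    show "at x within {0..<d} \<noteq> bot" if "x \<in> {0..<d}" for x
      using that by (rule at_within_Ico_neq_bot)
  qed (use that D(1) h(2) de in \<open>auto simp: K_def\<close>)
  show ?thesis
  proof (rule that)
    show "deriv_seq {0..} (\<lambda>n x. if x < X then D n x else 0)"
      by (rule deriv_seq_extend_by_zero[OF D(2), of e]) (use D(1) h(3) de assms in auto)
  qed (use DK G(1) de assms X(1) in \<open>auto simp: K_def numeral_2_eq_2 Y'_def\<close>)
qed

section \<open>The pairing of a state with the waves\<close>

lemma Y_cont: "continuous_on {0..<X} Y"
  by (rule smooth1_continuous_on[OF Y_smooth])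

text \<open>Fubini's theorem: for fixed \<open>x\<close> the integral over \<open>t\<close> is the wave \<open>u\<^sup>g(x,T)\<close> in reflected time. As
\<open>g\<close> vanishes on \<open>[0,a)\<close>, the domain of integration can be cut at \<open>t \<le> T - a\<close>. This keeps it in \<open>x < X\<close>, where
\<open>Y\<close> is known to be continuous.\<close>

lemma pairing_wave:
  assumes a: "0 < a" "a < T" and g: "continuous_on UNIV g" "\<And>s. s < a \<Longrightarrow> g s = 0"
    and meas: "control_op \<rho> r T g \<in> borel_measurable H"
  defines "K \<equiv> {(x, t). 0 \<le> x \<and> tau \<rho> x \<le> t \<and> t \<le> T - a}"
  shows "(LBINT p. indicator K p * (r (fst p) (snd p) * (\<rho> (fst p) * Y (fst p) * g (T - snd p))))
    = L2_inner H (control_op \<rho> r T g) y"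
proof -
  define c where "c = tau_inv \<rho> (T - a)"
  have c: "0 \<le> c" "tau \<rho> c = T - a" using tau_inv[of "T - a"] a by (auto simp: c_def)
  have cX: "c < X" using tau_less_iff[of c X] c X a by auto
  have Kc: "x \<le> c" if "(x, t) \<in> K" for x t
    using tau_le_iff[of x c] c that by (auto simp: K_def)
  let ?J = "\<lambda>p. r (fst p) (snd p) * (\<rho> (fst p) * Y (fst p) * g (T - snd p))"
  have "continuous_on ({0..c} \<times> {0..T - a}) (\<lambda>p. tau \<rho> (fst p) - snd p)"
    by (intro continuous_intros continuous_on_compose2[OF tau_cont]) auto
  then have "closed (({0..c} \<times> {0..T - a}) \<inter> (\<lambda>p. tau \<rho> (fst p) - snd p) -` {..0})"
    by (intro continuous_closed_preimage closed_Times) auto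
  then have "compact (({0..c} \<times> {0..T - a}) \<inter> (({0..c} \<times> {0..T - a}) \<inter> (\<lambda>p. tau \<rho> (fst p) - snd p) -` {..0}))"
    by (intro compact_Int_closed compact_Times) auto
  moreover have "K = ({0..c} \<times> {0..T - a}) \<inter> (({0..c} \<times> {0..T - a}) \<inter> (\<lambda>p. tau \<rho> (fst p) - snd p) -` {..0})"
  proof -
    have "(x, t) \<in> K \<longleftrightarrow> x \<in> {0..c} \<and> t \<in> {0..T - a} \<and> tau \<rho> x - t \<le> 0" for x t
      using Kc[of x t] tau_nonneg[of x] unfolding K_def by auto
    then show ?thesis by (intro set_eqI) (simp add: split_paired_all mem_Times_iff)
  qed
  ultimately have K: "compact K" by simp
  have "continuous_on K ?J"
  proof -
    have "continuous_on K (\<lambda>p. case (fst p, snd p) of (x, t) \<Rightarrow> r x t)"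
      by (rule continuous_on_compose2[OF r_cont]) (auto intro!: continuous_intros simp: K_def \<Omega>_def)
    then have "continuous_on K (\<lambda>p. r (fst p) (snd p))" by (simp add: case_prod_beta)
    moreover have "continuous_on K (\<lambda>p. \<rho> (fst p))"
      by (rule continuous_on_compose2[OF \<rho>_cont]) (auto intro!: continuous_intros simp: K_def)
    moreover have "continuous_on K (\<lambda>p. Y (fst p))"
      by (rule continuous_on_compose2[OF Y_cont]) (use Kc cX in \<open>force intro!: continuous_intros simp: K_def\<close>)+
    moreover have "continuous_on K (\<lambda>p. g (T - snd p))"
      by (rule continuous_on_compose2[OF g(1)]) (auto intro!: continuous_intros)
    ultimately show ?thesis by (intro continuous_on_mult)
  qed
  from borel_integrable_compact[OF K this]
  have "integrable (lborel \<Otimes>\<^sub>M lborel) (\<lambda>p. indicator K p * ?J p)"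
    by (simp add: lborel_prod)
  from lborel_pair.integral_fst'[OF this]
  have "(LBINT p. indicator K p * ?J p) = (LBINT x. LBINT t. indicator K (x, t) * ?J (x, t))"
    by (simp add: lborel_prod)
  also have "\<dots> = (LBINT x. indicator {0..X} x *\<^sub>R (\<rho> x * (control_op \<rho> r T g x * y x)))"
    \<comment> \<open>\<open>Y\<close> may differ from \<open>y\<close> at \<open>0\<close>\<close>
  proof (rule integral_discrete_difference[of "{0::real}"])
    fix x :: real assume x: "x \<notin> {0}"
    show "(LBINT t. indicator K (x, t) * ?J (x, t)) = indicator {0..X} x *\<^sub>R (\<rho> x * (control_op \<rho> r T g x * y x))"
    proof (cases "x \<in> {0..X}")
      case False
      then have "(x, t) \<notin> K" for t using Kc[of x t] cX by (auto simp: K_def)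
      then show ?thesis using False by simp
    next
      case True
      have "(LBINT t. indicator K (x, t) * ?J (x, t)) = (LBINT s. indicator K (x, T - s) * ?J (x, T - s))"
        by (rule reflect_integral)
      also have "\<dots> = (LBINT s. (\<rho> x * y x) * (indicator {0..T - tau \<rho> x} s *\<^sub>R (r x (T - s) * g s)))"
      proof (intro Bochner_Integration.integral_cong refl)
        fix s
        show "indicator K (x, T - s) * ?J (x, T - s) = (\<rho> x * y x) * (indicator {0..T - tau \<rho> x} s *\<^sub>R (r x (T - s) * g s))"
        proof (cases "s < a")
          case False
          then have "(x, T - s) \<in> K \<longleftrightarrow> s \<in> {0..T - tau \<rho> x}" using True a by (auto simp: K_def)
          then show ?thesis using True x by (auto simp: indicator_def Y_def)
        qed (use g(2) in \<open>simp add: K_def\<close>)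
      qed
      also have "\<dots> = \<rho> x * y x * control_op \<rho> r T g x"
        by (simp add: control_op_def wave_def set_lebesgue_integral_def)
      finally show ?thesis using True by (simp add: mult_ac)
    qed
  qed auto
  also have "\<dots> = L2_inner H (control_op \<rho> r T g) y"
    unfolding L2_inner_def using meas L2_measurable[OF y_L2]
    by (subst integral_H) (auto simp: set_lebesgue_integral_def)
  finally show ?thesis .
qed

text \<open>The weak form of the wave equation for \<open>r\<close>, tested with \<open>Y(x) F(T - t)\<close>.\<close>

theorem bump_pairing:
  assumes \<epsilon>: "0 < \<epsilon>" and a: "0 < a" "a < b" "b < T"
  defines "f \<equiv> bump \<epsilon> a b"
  shows "L2_inner H (V\<^sub>0 f) y = - value_at_0 y * (LINT s|N. f s)
    + deriv_at_0 y * L2_inner N f (\<lambda>s. LINT t|N. response_kernel t s)"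
proof -
  obtain g where g: "smooth1 UNIV g" "\<And>x. (f has_real_derivative g x) (at x)"
    "has_H1_derivative T f g" "f 0 = 0"
    unfolding f_def using bump_derivative[OF \<epsilon>, of a b T] a by (metis less_imp_le)
  have gcont: "continuous_on UNIV g" by (rule smooth1_continuous_on[OF g(1)])
  have fcont: "continuous_on UNIV f" unfolding f_def by (rule smooth1_continuous_on[OF smooth1_bump[OF \<epsilon>]])
  have g0: "g s = 0" if "s < a" for s
  proof -
    have "((\<lambda>_. 0) has_real_derivative 0) (at s)" by simp
    then have "(f has_real_derivative 0) (at s)"
      by (rule has_field_derivative_transform_within_open[where S = "{..<a}"])
        (use that in \<open>auto simp: f_def bump_eq_0\<close>)
    then show ?thesis using DERIV_unique[OF g(2)] by blast
  qed
  obtain F where F: "F a = 0" "\<And>x. (F has_real_derivative f x) (at x)"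
    using continuous_primitive[OF fcont] by blast
  have Fa: "F x = 0" if "x \<le> a" for x
    using primitive_const_left[OF F(2) _ that] F(1) by (simp add: f_def bump_eq_0)
  have FT: "F T = (LINT s|N. f s)"
  proof -
    have "(LBINT s:{0..T}. f s) = F T - F 0"
      by (rule FTC_set_integral[OF _ has_field_derivative_at_within[OF F(2)] continuous_on_subset[OF fcont]])
        (use T_pos in auto)
    then show ?thesis using Fa[of 0] a by (simp add: integral_F_measure)
  qed
  obtain P where P: "deriv_seq UNIV P" "\<And>t. t > -1 \<Longrightarrow> P 0 t = F (T - t)"
    "\<And>t. t > -1 \<Longrightarrow> P 2 t = g (T - t)" "\<And>t. t \<notin> {-2<..<T} \<Longrightarrow> P 0 t = 0"
    using separated_test_function_time[OF \<epsilon> a(1) g(1) g(2)[unfolded f_def] F(2)[unfolded f_def] Fa] by blast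
  \<comment> \<open>up to time \<open>T - a\<close> the front has not passed \<open>c\<close>\<close>
  define c where "c = tau_inv \<rho> (T - a)"
  have c: "0 \<le> c" "tau \<rho> c = T - a" using tau_inv[of "T - a"] a by (auto simp: c_def)
  have cX: "c < X" using tau_less_iff[of c X] c X a by auto
  obtain E where E: "deriv_seq {0..} E" "\<And>x. x \<in> {0..c} \<Longrightarrow> E 0 x = Y x" "E 1 0 = deriv_at_0 y"
    "\<And>x. x \<in> {0..c} \<Longrightarrow> E 2 x = q x * Y x" "\<And>x. x \<ge> X \<Longrightarrow> E 0 x = 0"
    using separated_test_function_space[OF c(1) cX] by blast
  define D where "D i j p = E i (fst p) * P j (snd p)" for i j and p :: "real \<times> real"
  have D: "smooth_partials ({0..} \<times> UNIV) D"
    using smooth_partials_product[OF E(1) P(1)] by (simp add: D_def[abs_def])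
  have D0: "D 0 0 p = 0" if "p \<in> {0..} \<times> UNIV" "norm p > X + 2 + T" for p
  proof (rule ccontr)
    assume "D 0 0 p \<noteq> 0"
    then have "E 0 (fst p) \<noteq> 0" "P 0 (snd p) \<noteq> 0" by (auto simp: D_def)
    then have "fst p < X" "snd p \<in> {-2<..<T}" using E(5) P(4) by (auto simp: not_le[symmetric])
    moreover have "norm p \<le> \<bar>fst p\<bar> + \<bar>snd p\<bar>" using norm_Pair_le[of "fst p" "snd p"] by simp
    ultimately show False using that T_pos by (auto simp: mem_Times_iff)
  qed
  have "delta_solution \<rho> q r" using fundamental by (simp add: fundamental_solution_def)
  then have main: "(LINT (x, t):{0..} \<times> UNIV|lborel.
            r x t * (\<rho> x * D 0 2 (x, t) - D 2 0 (x, t) + q x * D 0 0 (x, t)))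
          + D 0 0 (0, 0) - (LBINT t. r 0 t * D 1 0 (0, t)) = 0"
    unfolding delta_solution_def using D D0 by blast
  define K where "K = {(x, t). 0 \<le> x \<and> tau \<rho> x \<le> t \<and> t \<le> T - a}"
  have "(LINT (x, t):{0..} \<times> UNIV|lborel.
            r x t * (\<rho> x * D 0 2 (x, t) - D 2 0 (x, t) + q x * D 0 0 (x, t)))
      = (LBINT p. indicator K p * (r (fst p) (snd p) * (\<rho> (fst p) * Y (fst p) * g (T - snd p))))"
    unfolding set_lebesgue_integral_def
  proof (rule Bochner_Integration.integral_cong[OF refl])
    fix p :: "real \<times> real"
    obtain x t where p: "p = (x, t)" by (cases p)
    have r0: "r x t = 0" if "0 \<le> x" "t < tau \<rho> x"
      using fundamental that by (simp add: fundamental_solution_def)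
    have "r x t * (\<rho> x * D 0 2 (x, t) - D 2 0 (x, t) + q x * D 0 0 (x, t))
        = indicator K (x, t) * (r x t * (\<rho> x * Y x * g (T - t)))" if x: "0 \<le> x"
    proof (cases "tau \<rho> x \<le> t")
      case False
      then show ?thesis using r0[OF x] by (simp add: K_def)
    next
      case True
      then have t: "t > -1" using tau_nonneg[OF x] by linarith
      show ?thesis
      proof (cases "t \<le> T - a")
        case False
        then show ?thesis using P(2,3)[OF t] Fa[of "T - t"] g0[of "T - t"] by (simp add: D_def K_def)
      next
        case le: True
        then have "x \<in> {0..c}" using tau_le_iff[OF x c(1)] c(2) True x by auto
        then show ?thesis using E(2)[of x] E(4)[of x] P(2,3)[OF t] True le x
          by (simp add: D_def K_def algebra_simps)
      qed
    qed
    then show "indicator ({0..} \<times> UNIV) p *\<^sub>R (case p of (x, t) \<Rightarrow>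
          r x t * (\<rho> x * D 0 2 (x, t) - D 2 0 (x, t) + q x * D 0 0 (x, t)))
        = indicator K p * (r (fst p) (snd p) * (\<rho> (fst p) * Y (fst p) * g (T - snd p)))"
      by (cases "0 \<le> x") (simp_all add: p, simp add: K_def)
  qed
  also have "\<dots> = L2_inner H (control_op \<rho> r T g) y"
  proof -
    have fL: "f \<in> L2 N" unfolding f_def by (rule bump_L2[OF \<epsilon>])
    have "control_op \<rho> r T g \<in> borel_measurable H \<longleftrightarrow> V\<^sub>0 f \<in> borel_measurable H"
      by (rule measurable_cong) (use V\<^sub>0_H1[OF g(3,4)] in auto)
    then have "control_op \<rho> r T g \<in> borel_measurable H" using L2_measurable[OF V\<^sub>0_L2[OF fL]] by simp
    then show ?thesis unfolding K_def by (intro pairing_wave gcont g0) (use a in auto)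
  qed
  also have "\<dots> = L2_inner H (V\<^sub>0 f) y"
    unfolding L2_inner_def
    by (intro Bochner_Integration.integral_cong refl) (use V\<^sub>0_H1[OF g(3,4)] in auto)
  finally have I1: "(LINT (x, t):{0..} \<times> UNIV|lborel.
            r x t * (\<rho> x * D 0 2 (x, t) - D 2 0 (x, t) + q x * D 0 0 (x, t))) = L2_inner H (V\<^sub>0 f) y" .
  have "(LBINT t. r 0 t * D 1 0 (0, t)) = (LBINT t. deriv_at_0 y * (indicator {0..T} t *\<^sub>R (r 0 t * F (T - t))))"
  proof (rule Bochner_Integration.integral_cong[OF refl])
    fix t
    have r0: "r 0 t = 0" if "t < 0"
      using fundamental that tau_0 by (simp add: fundamental_solution_def)
    consider "t < 0" | "t \<in> {0..T}" | "t > T" by fastforce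
    then show "r 0 t * D 1 0 (0, t) = deriv_at_0 y * (indicator {0..T} t *\<^sub>R (r 0 t * F (T - t)))"
    proof cases
      case 2
      then show ?thesis using P(2)[of t] E(3) by (simp add: D_def)
    next
      case 3
      then show ?thesis using P(4)[of t] by (simp add: D_def)
    qed (simp add: r0)
  qed
  also have "\<dots> = deriv_at_0 y * (LBINT t:{0..T}. r 0 t * F (T - t))"
    by (simp add: set_lebesgue_integral_def)
  also have "(LBINT t:{0..T}. r 0 t * F (T - t)) = L2_inner N f (\<lambda>s. LINT t|N. response_kernel t s)"
    using pairing_response[OF fcont F(2)] Fa[of 0] a by simp
  finally have I2: "(LBINT t. r 0 t * D 1 0 (0, t)) = deriv_at_0 y * L2_inner N f (\<lambda>s. LINT t|N. response_kernel t s)" .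
  have "D 0 0 (0, 0) = value_at_0 y * (LINT s|N. f s)"
    using E(2)[of 0] P(2)[of 0] c by (simp add: D_def Y_def FT)
  with main I1 I2 show ?thesis by simp
qed

text \<open>The adjoint of \<open>W d/dt\<close> sends the stationary state to the right-hand side of the equation. Both sides are
continuous and linear in \<open>f\<close>, so the case of bumps suffices.\<close>

theorem pairing:
  assumes f: "f \<in> L2 N"
  shows "L2_inner H (control_ddt \<rho> r T f) y
    = L2_inner N f (\<lambda>t. - value_at_0 y * 1 + deriv_at_0 y * response_adj \<rho> r T (\<lambda>_. 1) t)"
proof -
  let ?w = "\<lambda>t. - value_at_0 y * 1 + deriv_at_0 y * response_adj \<rho> r T (\<lambda>_. 1) t"
  have one: "(\<lambda>_. 1) \<in> L2 N" by (rule L2_F_bounded[where B = 1]) auto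
  have w: "?w \<in> L2 N" by (rule L2_lincomb[OF one response_adjoint_one(1)])
  show ?thesis
  proof (rule L2_F_closed_subspace_induct[OF f T_pos])
    fix \<epsilon> a b :: real assume ab: "0 < \<epsilon>" "0 < a" "a < b" "b < T"
    let ?f = "bump \<epsilon> a b"
    have bL: "?f \<in> L2 N" by (rule bump_L2[OF ab(1)])
    have "L2_inner H (control_ddt \<rho> r T ?f) y = L2_inner H (V\<^sub>0 ?f) y"
      by (intro L2_inner_cong control_ddt_eq_V\<^sub>0 L2_eq_refl control_ddt_L2 V\<^sub>0_L2 bL y_L2)
    also have "\<dots> = - value_at_0 y * L2_inner N (\<lambda>_. 1) ?f + deriv_at_0 y * L2_inner N (response_adj \<rho> r T (\<lambda>_. 1)) ?f"
      using bump_pairing[OF ab] response_adjoint_one(2)[OF bL]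
      by (simp add: L2_inner_commute[of N _ ?f]) (simp add: L2_inner_def)
    also have "\<dots> = L2_inner N ?w ?f"
      by (rule L2_inner_lincomb[OF one response_adjoint_one(1) bL, symmetric])
    finally show "L2_inner H (control_ddt \<rho> r T ?f) y = L2_inner N ?f ?w"
      by (simp only: L2_inner_commute[of N ?w ?f])
  next
    fix f g :: "real \<Rightarrow> real" and a b
    assume fg: "f \<in> L2 N" "g \<in> L2 N"
      and eq: "L2_inner H (control_ddt \<rho> r T f) y = L2_inner N f ?w"
        "L2_inner H (control_ddt \<rho> r T g) y = L2_inner N g ?w"
    have "L2_inner H (control_ddt \<rho> r T (\<lambda>x. a * f x + b * g x)) y
        = L2_inner H (\<lambda>x. a * control_ddt \<rho> r T f x + b * control_ddt \<rho> r T g x) y"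
      by (intro L2_inner_cong L2_bounded_linear_lincomb[OF control_ddt_spec(1)] L2_eq_refl
          control_ddt_L2 L2_lincomb fg y_L2)
    also have "\<dots> = L2_inner N (\<lambda>x. a * f x + b * g x) ?w"
      by (simp only: L2_inner_lincomb[OF control_ddt_L2[OF fg(1)] control_ddt_L2[OF fg(2)] y_L2]
          L2_inner_lincomb[OF fg w] eq)
    finally show "L2_inner H (control_ddt \<rho> r T (\<lambda>x. a * f x + b * g x)) y
        = L2_inner N (\<lambda>x. a * f x + b * g x) ?w" .
  next
    fix F and f :: "real \<Rightarrow> real"
    assume F: "\<And>n. F n \<in> L2 N" and f: "f \<in> L2 N"
      and eq: "\<And>n. L2_inner H (control_ddt \<rho> r T (F n)) y = L2_inner N (F n) ?w"
      and lim: "(\<lambda>n. L2_inner N (\<lambda>x. F n x - f x) (\<lambda>x. F n x - f x)) \<longlonglongrightarrow> 0"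
    have "(\<lambda>n. L2_inner H (control_ddt \<rho> r T (F n)) y) \<longlonglongrightarrow> L2_inner H (control_ddt \<rho> r T f) y"
      by (intro L2_inner_tendsto control_ddt_L2 F f y_L2 L2_bounded_linear_tendsto[OF control_ddt_spec(1)] lim)
    moreover have "(\<lambda>n. L2_inner N (F n) ?w) \<longlonglongrightarrow> L2_inner N f ?w"
      by (intro L2_inner_tendsto F f w lim)
    ultimately show "L2_inner H (control_ddt \<rho> r T f) y = L2_inner N f ?w"
      unfolding eq by (rule LIMSEQ_unique)
  qed
qed

end

section \<open>The control that produces a given state\<close>

theorem theorem4:
  fixes \<rho> q :: "real \<Rightarrow> real" and r :: "real \<Rightarrow> real \<Rightarrow> real"
    and T :: real and y :: "real \<Rightarrow> real"
  assumes "smooth1 {0..} \<rho>" and "smooth1 {0..} q"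
    and "\<And>x. x \<ge> 0 \<Longrightarrow> \<rho> x > 0"
    and "(\<integral>\<^sup>+ x\<in>{0..}. ennreal (sqrt (\<rho> x)) \<partial>lborel) = \<infinity>"
    and "fundamental_solution \<rho> q r"
    and "T > 0"
    and "y \<in> L2 (H_measure \<rho> T)"
    and "\<And>x. x \<in> {0<..<tau_inv \<rho> T} \<Longrightarrow>
           y differentiable (at x) \<and> deriv y differentiable (at x) \<and>
           - deriv (deriv y) x + q x * y x = 0"
  shows "\<exists>f \<in> L2 (F_measure T).
           (\<forall>g \<in> L2 (F_measure T).
              L2_eq (H_measure \<rho> T) (control_ddt \<rho> r T g) y \<longleftrightarrow> L2_eq (F_measure T) g f) \<and>
           (\<forall>g \<in> L2 (F_measure T).
              L2_eq (F_measure T) (ddt_C_ddt \<rho> r T g)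
                (\<lambda>t. - value_at_0 y * 1 + deriv_at_0 y * response_adj \<rho> r T (\<lambda>_. 1) t)
              \<longleftrightarrow> L2_eq (F_measure T) g f)"
proof -
  interpret stationary_state \<rho> q r T y by unfold_locales (use assms in auto)
  let ?V = "control_ddt \<rho> r T"
  let ?w = "\<lambda>t. - value_at_0 y * 1 + deriv_at_0 y * response_adj \<rho> r T (\<lambda>_. 1) t"
  have w: "?w \<in> L2 N"
    by (rule L2_lincomb[OF _ response_adjoint_one(1)]) (rule L2_F_bounded[where B = 1], auto)
  obtain f where f: "f \<in> L2 N" "L2_eq H (?V f) y" using control_ddt_surj[OF y_L2] by blast
  have V_iff: "L2_eq H (?V g) y \<longleftrightarrow> L2_eq N g f" if g: "g \<in> L2 N" for g
  proof
    assume "L2_eq H (?V g) y"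
    then show "L2_eq N g f" by (intro control_ddt_inj g f L2_eq_trans[OF _ L2_eq_sym[OF f(2)]])
  next
    assume gf: "L2_eq N g f"
    have d: "(\<lambda>s. g s - f s) \<in> L2 N" by (rule L2_diff[OF g f(1)])
    obtain K where "L2_inner H (?V (\<lambda>s. g s - f s)) (?V (\<lambda>s. g s - f s)) \<le> K * L2_inner N (\<lambda>s. g s - f s) (\<lambda>s. g s - f s)"
      using control_ddt_spec(1) d unfolding L2_bounded_linear_def by blast
    then have "L2_inner H (?V (\<lambda>s. g s - f s)) (?V (\<lambda>s. g s - f s)) = 0"
      using gf L2_eq_iff_norm_diff[OF g f(1)] L2_inner_self_nonneg[of H "?V (\<lambda>s. g s - f s)"] by simp
    moreover have "L2_inner H (?V (\<lambda>s. g s - f s)) (?V (\<lambda>s. g s - f s))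
        = L2_inner H (\<lambda>x. ?V g x - ?V f x) (\<lambda>x. ?V g x - ?V f x)"
      by (intro L2_inner_cong L2_bounded_linear_diff[OF control_ddt_spec(1)] control_ddt_L2 L2_diff g f(1))
    ultimately have "L2_eq H (?V g) (?V f)"
      using L2_eq_iff_norm_diff[OF control_ddt_L2[OF g] control_ddt_L2[OF f(1)]] by simp
    then show "L2_eq H (?V g) y" using f(2) by (rule L2_eq_trans)
  qed
  have "L2_eq N (ddt_C_ddt \<rho> r T g) ?w \<longleftrightarrow> L2_eq H (?V g) y" if g: "g \<in> L2 N" for g
  proof -
    note Vg = control_ddt_L2[OF g]
    have adj: "ddt_C_ddt \<rho> r T g \<in> L2 N"
      "L2_inner H (?V h) (?V g) = L2_inner N h (ddt_C_ddt \<rho> r T g)" if "h \<in> L2 N" for h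
      using control_ddt_adjoint[OF Vg] that by (auto simp: ddt_C_ddt_def)
    show ?thesis
    proof
      assume eq: "L2_eq N (ddt_C_ddt \<rho> r T g) ?w"
      have d: "(\<lambda>x. ?V g x - y x) \<in> L2 H" by (rule L2_diff[OF Vg y_L2])
      \<comment> \<open>the difference is itself produced by some control \<open>h\<close>, and it is orthogonal to all such states\<close>
      obtain h where h: "h \<in> L2 N" "L2_eq H (?V h) (\<lambda>x. ?V g x - y x)"
        using control_ddt_surj[OF d] by blast
      have "L2_inner H (\<lambda>x. ?V g x - y x) (\<lambda>x. ?V g x - y x) = L2_inner H (\<lambda>x. ?V g x - y x) (?V h)"
        by (intro L2_inner_cong L2_eq_refl L2_eq_sym[OF h(2)] d control_ddt_L2 h(1))
      also have "\<dots> = L2_inner H (?V h) (?V g) - L2_inner H (?V h) y"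
        using L2_inner_diff[OF Vg y_L2 control_ddt_L2[OF h(1)]]
        by (simp only: L2_inner_commute[of H "?V h" "?V g"] L2_inner_commute[of H "?V h" y])
      also have "\<dots> = L2_inner N h (ddt_C_ddt \<rho> r T g) - L2_inner N h ?w"
        by (simp only: adj(2)[OF h(1)] pairing[OF h(1)])
      also have "\<dots> = 0"
        using L2_inner_cong[OF L2_eq_refl eq h(1) h(1) adj(1)[OF g] w] by simp
      finally show "L2_eq H (?V g) y" using L2_eq_iff_norm_diff[OF Vg y_L2] by simp
    next
      assume eq: "L2_eq H (?V g) y"
      have "L2_inner H (?V h) (?V g) = L2_inner N h ?w" if h: "h \<in> L2 N" for h
        using L2_inner_cong[OF L2_eq_refl eq control_ddt_L2[OF h] control_ddt_L2[OF h] Vg y_L2] pairing[OF h]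
        by simp
      from L2_adjoint_works(3)[OF w this]
      show "L2_eq N (ddt_C_ddt \<rho> r T g) ?w" by (simp add: ddt_C_ddt_def)
    qed
  qed
  with V_iff f(1) show ?thesis by blast
qed

end
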